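(* Let $n\ge 1$ and let $F\times G\subset K_{n+1}\times K_{n+1}$ be a Matching Pair of faces of the associahedron $K_{n+1}$. Then $F_{\min}\times G_{\min}\subset P_n\times P_n$ is a Complementary Pair and $F\times G=\theta(F_{\min})\times\theta(G_{\min})$. Consequently, the diagonals $\Delta'_K$ and $\Delta_K$ agree, i.e. $\Delta'_K(e^{n-1})=\Delta_K(e^{n-1})$ as sets of product cells of $K_{n+1}\times K_{n+1}$, where $e^{n-1}$ is the top-dimensional cell of $K_{n+1}$.
   Context: **Permutahedron.** $P_n$ is the $(n-1)$-dimensional permutahedron. Its faces are identified with ordered partitions $A_1|\cdots|A_p$ of $\underline n=\{1,\dots,n\}$ into nonempty blocks; such a face has dimension $n-p$. A face $e'$ is contained in $e$ iff $e'$ is obtained from $e$ by replacing each block by an ordered partition of it. Vertices are permutations $x_1|\cdots|x_n\in S_n$. The weak order on $S_n$ is generated by $\cdots|x_i|x_{i+1}|\cdots<\cdots|x_{i+1}|x_i|\cdots$ whenever $x_i<x_{i+1}$. Each face $e$ has a minimal vertex $\min e$ (each block written in increasing order) and a maximal vertex $\max e$ (each block written in decreasing order). $|e|$ denotes dimension. **Associahedron and $\theta$.** Faces of the $(n-1)$-dimensional associahedron $K_{n+1}$ are planar rooted trees with $n+1$ leaves, equivalently sets $T$ of nonempty proper intervals $[s,t]\subsetneq\underline n$ (the interval $[s,t]$ brackets leaves $s,\dots,t+1$) any two of which are either nested or disjoint with union not an interval. The dimension of $T$ is $n-1-\#T$, and the face $T'$ is contained in the face $T$ iff $T'\supseteq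 T$. Tonks' projection $\theta:P_n\to K_{n+1}$ (ordered partition = planar leveled tree; forget levels; last block = root level) sends $A_1|\cdots|A_p$ to the set of all maximal runs of consecutive integers of the sets $A_1\cup\cdots\cup A_i$, $1\le i<p$. **Runs.** For $\sigma\in S_n$, let $\overleftarrow{\sigma}_1|\cdots|\overleftarrow{\sigma}_p$ be the ordered partition whose blocks are the maximal runs of consecutive entries of $\sigma$ that are decreasing from left to right, and $\overrightarrow{\sigma}_q|\cdots|\overrightarrow{\sigma}_1$ the ordered partition whose blocks are the maximal runs of consecutive entries of $\sigma$ that are increasing from left to right (blocks listed in the order in which they occur in $\sigma$, the indices in the second running downward). E.g. $\sigma=2|1|3|5|4$ gives $21|3|54$ and $2|135|4$. **Degeneracy.** A positive-dimensional ordered partition $A_1|\cdots|A_p$ is degenerate if for some $j$ and some $k>0$ there are $x,z\in A_j$, $y\in A_{j+k}$ with $x<y<z$; otherwise it is non-degenerate (equivalently $|\theta(e)|=|e|$). A vertex $v$ of $P_n$ is associahedral (= non-degenerate) iff $\overrightarrow v_q|\cdots|\overrightarrow v_1$ is non-degenerate (in particular $n|\cdots|1$ is associahedral). $\theta$ restricts to a bijection from associahedral vertices of $P_n$ to vertices of $K_{n+1}$; vertices of $K_{n+1}$ are thereby regarded as permutations, and the Tamari order on them is the restriction of the weak order. For a face $F$ of $K_{n+1}$, $\min F$ and $\max F$ are its minimal and maximal vertices in this order, regarded as permutations. For faces $F,G$ of $K_{n+1}$, $F\le G$ means $\max F\le\min G$. **Subdivision cells and $F_{\min}$.** $P_n$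 is viewed as a subdivision of $K_{n+1}$: the $k$-face $F=T$ of $K_{n+1}$ is the union of those $k$-faces $u=U_1|\cdots|U_{n-k}$ of $P_n$ for which $T=\{r(U_1\cup\cdots\cup U_i):1\le i<n-k\}$, where $r(A)$ is the maximal run of consecutive integers in $A$ that contains $\min A$. $F_{\min}$ is the one of these $k$-faces $u$ with $\min u=\min F$. **Matching Pair.** A pair of faces $a\times b\subseteq K_{n+1}\times K_{n+1}$ is a Matching Pair (MP) if $a\le b$ and $|a|+|b|=n-1$. **Complementary Pair.** For $a=A_1|\cdots|A_p$ and $1\le j<p$, let $M_j\subseteq A_j\smallsetminus\{\min A_j\}$ with $\min M_j>\max A_{j+1}$ if $M_j\ne\varnothing$; then $R_{M_j}(a)$ is obtained from $a$ by moving the elements of $M_j$ from $A_j$ to $A_{j+1}$ ($R_\varnothing(a)=a$). For $\mathbf M=(M_1,\dots,M_{p-1})$, $R_{\mathbf M}(a):=R_{M_{p-1}}\cdots R_{M_2}R_{M_1}(a)$, where each $M_j$ must satisfy the stated conditions with respect to the partition to which $R_{M_j}$ is applied. Dually, for $b=B_q|\cdots|B_1$ and $1\le i<q$, let $N_i\subseteq B_i\smallsetminus\{\min B_i\}$ with $\min N_i>\max B_{i+1}$ if $N_i\neq\varnothing$; then $L_{N_i}(b)$ is obtained by moving the elements of $N_i$ from $B_i$ to $B_{i+1}$ (the block immediately to its left), $L_\varnothing(b)=b$, and $L_{\mathbf N}(b):=L_{N_{q-1}}\cdots L_{N_1}(b)$ for $\mathbf N=(N_1,\dots,N_{q-1})$,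 with the conditions imposed at each step on the current partition. For $\sigma\in S_n$ put $a_\sigma=\overleftarrow{\sigma}_1|\cdots|\overleftarrow{\sigma}_p$ and $b_\sigma=\overrightarrow{\sigma}_q|\cdots|\overrightarrow{\sigma}_1$. A Complementary Pair (CP) is a pair $R_{\mathbf M}(a_\sigma)\times L_{\mathbf N}(b_\sigma)$ for some $\sigma\in S_n$ and some admissible $\mathbf M,\mathbf N$. A CP $\alpha\times\beta$ is non-degenerate if $\alpha$ and $\beta$ are both non-degenerate. **Diagonals.** On the top cell $e^{n-1}$ of $K_{n+1}$, $$\Delta_K(e^{n-1})=\{\theta(\alpha)\times\theta(\beta):\alpha\times\beta\text{ a non-degenerate CP in }P_n\times P_n\},$$ $$\Delta'_K(e^{n-1})=\{a\times b: a\times b\subseteq K_{n+1}\times K_{n+1}\text{ an MP}\}.$$ *)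

theory Defs
  imports
    "HOL-Library.Disjoint_Sets"
    "HOL-Combinatorics.Multiset_Permutations"
begin

section \<open>Permutahedra\<close>

text \<open>
  A face of the permutahedron \<open>P\<^sub>n\<close> is an ordered partition of \<open>{1..n}\<close>, given as the list of its
  blocks. A vertex is a permutation in one-line notation, i.e. an element of
  \<^term>\<open>permutations_of_set {1..n}\<close>; \<open>vertex_face\<close> turns it into a face.
\<close>

definition P_face :: "nat \<Rightarrow> nat set list \<Rightarrow> bool" where
  "P_face n A \<longleftrightarrow> partition_on {1..n} (set A) \<and> distinct A"

definition P_dim :: "nat \<Rightarrow> nat set list \<Rightarrow> nat" where
  "P_dim n A = n - length A"

definition vertex_face :: "nat list \<Rightarrow> nat set list" where
  "vertex_face v = map (\<lambda>x. {x}) v"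

definition P_min :: "nat set list \<Rightarrow> nat list" where
  "P_min A = concat (map sorted_list_of_set A)"

inductive weak_step :: "nat list \<Rightarrow> nat list \<Rightarrow> bool" where
  "x < y \<Longrightarrow> weak_step (us @ [x, y] @ vs) (us @ [y, x] @ vs)"

definition weak_le :: "nat list \<Rightarrow> nat list \<Rightarrow> bool" where
  "weak_le = weak_step\<^sup>*\<^sup>*"


section \<open>Associahedra and the projection\<close>

text \<open>
  A face of the associahedron \<open>K\<^sub>n\<^sub>+\<^sub>1\<close> is a set of bracketings, each bracketing being an interval.
  The top-dimensional face is the empty set.
\<close>

definition nat_interval :: "nat set \<Rightarrow> bool" where
  "nat_interval I \<longleftrightarrow> (\<exists>s t. s \<le> t \<and> I = {s..t})"

definition K_face :: "nat \<Rightarrow> nat set set \<Rightarrow> bool" where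
  "K_face n T \<longleftrightarrow>
     (\<forall>I\<in>T. nat_interval I \<and> I \<subset> {1..n}) \<and>
     (\<forall>I\<in>T. \<forall>J\<in>T. I \<subseteq> J \<or> J \<subseteq> I \<or> (I \<inter> J = {} \<and> \<not> nat_interval (I \<union> J)))"

text \<open>A face has at most \<open>n - 1\<close> elements, so the subtraction below never truncates.\<close>

definition K_dim :: "nat \<Rightarrow> nat set set \<Rightarrow> nat" where
  "K_dim n T = n - 1 - card T"

definition K_subface :: "nat set set \<Rightarrow> nat set set \<Rightarrow> bool" where
  "K_subface T' T \<longleftrightarrow> T \<subseteq> T'"

definition max_runs :: "nat set \<Rightarrow> nat set set" where
  "max_runs S = {R. nat_interval R \<and> R \<subseteq> S \<and>
     (\<forall>R'. nat_interval R' \<and> R \<subseteq> R' \<and> R' \<subseteq> S \<longrightarrow> R' = R)}"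

definition theta :: "nat set list \<Rightarrow> nat set set" where
  "theta A = {R. \<exists>i. 1 \<le> i \<and> i < length A \<and> R \<in> max_runs (\<Union> (set (take i A)))}"


section \<open>Monotone runs and degeneracy\<close>

text \<open>\<open>runs_wrt r\<close> splits a list into its maximal runs of consecutive entries whose neighbours are
  related by \<open>r\<close>.\<close>

fun runs_wrt :: "(nat \<Rightarrow> nat \<Rightarrow> bool) \<Rightarrow> nat list \<Rightarrow> nat list list" where
  "runs_wrt r [] = []"
| "runs_wrt r [x] = [[x]]"
| "runs_wrt r (x # y # zs) =
     (let rs = runs_wrt r (y # zs) in if r x y then (x # hd rs) # tl rs else [x] # rs)"

definition desc_partition :: "nat list \<Rightarrow> nat set list" where
  "desc_partition v = map set (runs_wrt (>) v)"

definition asc_partition :: "nat list \<Rightarrow> nat set list" where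
  "asc_partition v = map set (runs_wrt (<) v)"

definition has_degeneracy :: "nat set list \<Rightarrow> bool" where
  "has_degeneracy A \<longleftrightarrow>
     (\<exists>j k x y z. 0 < k \<and> j + k < length A \<and>
        x \<in> A ! j \<and> z \<in> A ! j \<and> y \<in> A ! (j + k) \<and> x < y \<and> y < z)"

text \<open>
  A partition into singletons never satisfies \<^const>\<open>has_degeneracy\<close>, so \<open>n|\<dots>|1\<close>, whose
  ascending runs are singletons, is associahedral.
\<close>

definition associahedral :: "nat list \<Rightarrow> bool" where
  "associahedral v \<longleftrightarrow> \<not> has_degeneracy (asc_partition v)"

text \<open>For vertices, non-degeneracy means being associahedral; \<^term>\<open>P_min A\<close> is the permutation
  corresponding to a zero-dimensional face \<open>A\<close>.\<close>

definition non_degenerate :: "nat \<Rightarrow> nat set list \<Rightarrow> bool" where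
  "non_degenerate n A \<longleftrightarrow>
     (if P_dim n A > 0 then \<not> has_degeneracy A else associahedral (P_min A))"


section \<open>Tamari order and matching pairs\<close>

text \<open>
  The vertices of a face of \<open>K\<^sub>n\<^sub>+\<^sub>1\<close>, regarded as associahedral permutations via \<^const>\<open>theta\<close>. The
  Tamari order is \<^const>\<open>weak_le\<close> restricted to associahedral permutations.
\<close>

definition K_vertices :: "nat \<Rightarrow> nat set set \<Rightarrow> nat list set" where
  "K_vertices n F = {v \<in> permutations_of_set {1..n}.
     associahedral v \<and> K_subface (theta (vertex_face v)) F}"

definition K_min :: "nat \<Rightarrow> nat set set \<Rightarrow> nat list" where
  "K_min n F = (THE v. v \<in> K_vertices n F \<and> (\<forall>w\<in>K_vertices n F. weak_le v w))"

definition K_max :: "nat \<Rightarrow> nat set set \<Rightarrow> nat list" where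
  "K_max n F = (THE v. v \<in> K_vertices n F \<and> (\<forall>w\<in>K_vertices n F. weak_le w v))"

definition K_le :: "nat \<Rightarrow> nat set set \<Rightarrow> nat set set \<Rightarrow> bool" where
  "K_le n F G \<longleftrightarrow> weak_le (K_max n F) (K_min n G)"

definition matching_pair :: "nat \<Rightarrow> nat set set \<Rightarrow> nat set set \<Rightarrow> bool" where
  "matching_pair n a b \<longleftrightarrow>
     K_face n a \<and> K_face n b \<and> K_le n a b \<and> K_dim n a + K_dim n b = n - 1"


section \<open>Subdivision cells\<close>

definition first_run :: "nat set \<Rightarrow> nat set" where
  "first_run A = (THE R. R \<in> max_runs A \<and> Min A \<in> R)"

text \<open>The faces of \<open>P\<^sub>n\<close> of the same dimension as \<open>F\<close> that subdivide \<open>F\<close>.\<close>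

definition subdivision_cells :: "nat \<Rightarrow> nat set set \<Rightarrow> nat set list set" where
  "subdivision_cells n F = {u. P_face n u \<and> length u = n - K_dim n F \<and>
     F = {first_run (\<Union> (set (take i u))) | i. 1 \<le> i \<and> i < length u}}"

definition F_min :: "nat \<Rightarrow> nat set set \<Rightarrow> nat set list" where
  "F_min n F = (THE u. u \<in> subdivision_cells n F \<and> P_min u = K_min n F)"


section \<open>Complementary pairs\<close>

text \<open>
  Blocks are numbered from 0, so \<open>move_right j M A\<close> moves \<open>M\<close> from the block at position \<open>j\<close> to the
  one right after it. \<open>move_right_seq j Ms A\<close> performs such moves successively at the positions
  \<open>j, j + 1, \<dots>\<close>, and \<open>admissible_seq\<close> tests each move on the partition it is applied to.
\<close>

definition move_right :: "nat \<Rightarrow> nat set \<Rightarrow> nat set list \<Rightarrow> nat set list" where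
  "move_right j M A = A[j := A ! j - M, Suc j := A ! Suc j \<union> M]"

definition admissible_move :: "nat \<Rightarrow> nat set \<Rightarrow> nat set list \<Rightarrow> bool" where
  "admissible_move j M A \<longleftrightarrow>
     M \<subseteq> A ! j - {Min (A ! j)} \<and> (M \<noteq> {} \<longrightarrow> Min M > Max (A ! Suc j))"

fun move_right_seq :: "nat \<Rightarrow> nat set list \<Rightarrow> nat set list \<Rightarrow> nat set list" where
  "move_right_seq j [] A = A"
| "move_right_seq j (M # Ms) A = move_right_seq (Suc j) Ms (move_right j M A)"

fun admissible_seq :: "nat \<Rightarrow> nat set list \<Rightarrow> nat set list \<Rightarrow> bool" where
  "admissible_seq j [] A \<longleftrightarrow> True"
| "admissible_seq j (M # Ms) A \<longleftrightarrow>
     admissible_move j M A \<and> admissible_seq (Suc j) Ms (move_right j M A)"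

definition R_admissible :: "nat set list \<Rightarrow> nat set list \<Rightarrow> bool" where
  "R_admissible Ms a \<longleftrightarrow> length Ms = length a - 1 \<and> admissible_seq 0 Ms a"

definition R_move :: "nat set list \<Rightarrow> nat set list \<Rightarrow> nat set list" where
  "R_move Ms a = move_right_seq 0 Ms a"

text \<open>
  The blocks of \<open>b = B\<^sub>q|\<dots>|B\<^sub>1\<close> are numbered from right to left, and \<open>N\<^sub>i\<close> moves from \<open>B\<^sub>i\<close> to
  \<open>B\<^sub>i\<^sub>+\<^sub>1\<close> under the same condition as for right moves. Hence the left moves on \<open>b\<close> are the right
  moves on the reversed list \<open>[B\<^sub>1, \<dots>, B\<^sub>q]\<close>.
\<close>

definition L_admissible :: "nat set list \<Rightarrow> nat set list \<Rightarrow> bool" where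
  "L_admissible Ns b \<longleftrightarrow> R_admissible Ns (rev b)"

definition L_move :: "nat set list \<Rightarrow> nat set list \<Rightarrow> nat set list" where
  "L_move Ns b = rev (R_move Ns (rev b))"

definition complementary_pair :: "nat \<Rightarrow> nat set list \<Rightarrow> nat set list \<Rightarrow> bool" where
  "complementary_pair n \<alpha> \<beta> \<longleftrightarrow>
     (\<exists>\<sigma>\<in>permutations_of_set {1..n}. \<exists>Ms Ns.
        R_admissible Ms (desc_partition \<sigma>) \<and> L_admissible Ns (asc_partition \<sigma>) \<and>
        \<alpha> = R_move Ms (desc_partition \<sigma>) \<and> \<beta> = L_move Ns (asc_partition \<sigma>))"


section \<open>Diagonals\<close>

text \<open>The values of the two diagonals on the top cell of \<open>K\<^sub>n\<^sub>+\<^sub>1\<close>; a product cell \<open>a \<times> b\<close> is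
  the pair \<open>(a, b)\<close>.\<close>

definition Delta_K :: "nat \<Rightarrow> (nat set set \<times> nat set set) set" where
  "Delta_K n = {(theta \<alpha>, theta \<beta>) | \<alpha> \<beta>.
     complementary_pair n \<alpha> \<beta> \<and> non_degenerate n \<alpha> \<and> non_degenerate n \<beta>}"

definition Delta_K' :: "nat \<Rightarrow> (nat set set \<times> nat set set) set" where
  "Delta_K' n = {(a, b) | a b. matching_pair n a b}"

end

theory Submission
  imports Defs
begin

text \<open>
  An ordered partition is described by the function \<open>f\<close> sending an element to the index of its block.
  The cell \<open>F\<^sub>m\<^sub>i\<^sub>n\<close> lists the nodes of the tree \<open>F\<close> in right-to-left postorder; such partitions are the
  132-avoiding ones: \<open>x < y < z\<close> and \<open>f x \<le> f z\<close> imply \<open>f y \<le> f z\<close>. If \<open>f\<close> and \<open>g\<close> belong to \<open>F\<^sub>m\<^sub>i\<^sub>n\<close>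
  and \<open>G\<^sub>m\<^sub>i\<^sub>n\<close>, then \<open>F \<le> G\<close> says that \<open>x < y\<close> and \<open>g x \<le> g y\<close> imply \<open>f x < f y\<close>.

  For such a pair, every \<open>j\<close> that is not the minimum of its \<open>g\<close>-block satisfies \<open>f (j - 1) < f j\<close>, and
  by 132-avoidance there is at most one such \<open>j\<close> for each value \<open>f (j - 1)\<close>, which is never the last
  block. Hence the numbers of blocks add up to at least \<open>n + 1\<close>. Matching pairs are the case of equality,
  in which the largest element \<open>n\<close> splits the pair into two smaller tight pairs on
  \<open>{x. f x \<le> f (n - 1)}\<close> and its complement, unless \<open>f (n - 1) = f n\<close>, when the first part is empty.
  The words obtained for the parts by induction, with \<open>n\<close> between them, form \<open>\<sigma>\<close>. No other letter
  moves past \<open>n\<close>, whereas \<open>n\<close> itself is free to move to any later block.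

  Conversely, right moves keep the two entries of a non-inversion of \<open>\<sigma>\<close> in distinct blocks in the same
  order, which gives the inequality \<open>F \<le> G\<close> for every complementary pair, and non-degeneracy gives the
  dimensions.
\<close>

section \<open>Precedence in a word\<close>

text \<open>The weak order is reverse inclusion of non-inversions, the pairs \<open>i < j\<close>
  with \<open>i\<close> written first, and for both extreme vertices of a face these can be read off
  its brackets. In the minimal vertex of \<open>G\<close> they are the pairs with \<open>i\<close>
  in the smallest bracket around \<open>j\<close>, the most that 132-avoidance permits; in the
  maximal vertex of \<open>F\<close> they are the pairs forced by a bracket that contains
  \<open>i\<close> and ends at \<open>j - 1\<close>. So \<open>F \<le> G\<close> becomes a condition
  on brackets alone. The case of equality is proved for functions on an interval, not for lists of
  blocks, because the recursion restricts both partitions to subintervals: only the order of the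
  values counts, and nothing has to be renumbered. No letter passes \<open>n\<close> because moved
  letters must exceed everything in the block that they enter. For the same reason \<open>n\<close>
  is never stopped.\<close>

fun prec :: "'a list \<Rightarrow> 'a \<Rightarrow> 'a \<Rightarrow> bool" where
  "prec [] x y \<longleftrightarrow> False"
| "prec (a # v) x y \<longleftrightarrow> x = a \<and> y \<in> set v \<or> prec v x y"

lemma prec_append:
  "prec (us @ vs) x y \<longleftrightarrow> prec us x y \<or> prec vs x y \<or> x \<in> set us \<and> y \<in> set vs"
  by (induction us) auto

lemma prec_in_set: "prec v x y \<Longrightarrow> x \<in> set v \<and> y \<in> set v"
  by (induction v) auto

lemma prec_linear: "x \<in> set v \<Longrightarrow> y \<in> set v \<Longrightarrow> x \<noteq> y \<Longrightarrow> prec v x y \<or> prec v y x"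
  by (induction v) auto

lemma prec_asym: "distinct v \<Longrightarrow> prec v x y \<Longrightarrow> \<not> prec v y x"
  by (induction v) (auto dest: prec_in_set)

lemma prec_irrefl: "distinct v \<Longrightarrow> \<not> prec v x x"
  using prec_asym by metis

lemma prec_trans: "distinct v \<Longrightarrow> prec v x y \<Longrightarrow> prec v y z \<Longrightarrow> prec v x z"
  by (induction v) (auto dest: prec_in_set)

lemma prec_nth: "i < j \<Longrightarrow> j < length v \<Longrightarrow> prec v (v ! i) (v ! j)"
  by (induction v arbitrary: i j) (auto simp: nth_Cons split: nat.splits)

lemma prec_sorted_wrt: "sorted_wrt r v \<Longrightarrow> prec v x y \<Longrightarrow> r x y"
  by (induction v) auto

lemma prec_rev: "prec (rev v) x y \<longleftrightarrow> prec v y x"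
  by (induction v) (auto simp: prec_append)

lemma prec_unique:
  assumes "distinct v" "distinct w" "set v = set w" "\<And>x y. prec v x y \<Longrightarrow> prec w x y"
  shows "v = w"
  using assms
proof (induction v arbitrary: w)
  case (Cons a v)
  then obtain b w' where w: "w = b # w'" by (cases w) auto
  have "a = b"
  proof (rule ccontr)
    assume "a \<noteq> b"
    then have "prec (a # v) a b" using Cons.prems(3) w by auto
    then have "prec w a b" using Cons.prems(4) by blast
    moreover have "prec w b a" using w Cons.prems(3) \<open>a \<noteq> b\<close> by auto
    ultimately show False using prec_asym Cons.prems(2) by metis
  qed
  have "v = w'"
  proof (rule Cons.IH)
    fix x y assume xy: "prec v x y"
    then have "x \<noteq> a" using Cons.prems(1) prec_in_set by fastforce
    then show "prec w' x y" using Cons.prems(4)[of x y] xy w \<open>a = b\<close> by auto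
  next
    show "set v = set w'" using Cons.prems(1-3) w \<open>a = b\<close> by auto
  qed (use Cons.prems(1,2) w in auto)
  then show ?case using w \<open>a = b\<close> by simp
qed auto

section \<open>Weak order\<close>

lemma weak_step_Cons: "weak_step v w \<Longrightarrow> weak_step (a # v) (a # w)"
proof (induction rule: weak_step.induct)
  case (1 x y us vs)
  then show ?case using weak_step.intros[of x y "a # us" vs] by simp
qed

lemma weak_le_Cons: "weak_le v w \<Longrightarrow> weak_le (a # v) (a # w)"
  unfolding weak_le_def
  by (induction rule: rtranclp_induct) (auto intro: weak_step_Cons rtranclp.rtrancl_into_rtrancl)

lemma weak_step_imp:
  assumes "weak_step v w" "distinct v"
  shows "distinct w \<and> set w = set v \<and> (\<forall>x y. x < y \<longrightarrow> prec w x y \<longrightarrow> prec v x y)"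
  using assms by (cases rule: weak_step.cases) (auto simp: prec_append)

lemma weak_le_imp:
  assumes "weak_le v w" "distinct v"
  shows "distinct w \<and> set w = set v \<and> (\<forall>x y. x < y \<longrightarrow> prec w x y \<longrightarrow> prec v x y)"
  using assms(1) unfolding weak_le_def
proof (induction rule: rtranclp_induct)
  case base
  then show ?case using assms(2) by auto
next
  case (step w u)
  then show ?case using weak_step_imp[OF step(2)] by (metis (no_types, lifting))
qed

lemma weak_le_bring_front:
  assumes "\<forall>y\<in>set p. y < x"
  shows "weak_le (p @ x # s) (x # p @ s)"
  using assms
proof (induction p)
  case Nil
  then show ?case by (simp add: weak_le_def)
next
  case (Cons a p)
  have "weak_le (a # p @ x # s) (a # x # p @ s)"
    using Cons by (intro weak_le_Cons) auto
  moreover have "weak_step ([] @ [a, x] @ p @ s) ([] @ [x, a] @ p @ s)"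
    using Cons.prems by (intro weak_step.intros) auto
  then have "weak_step (a # x # p @ s) (x # a # p @ s)" by simp
  ultimately show ?case unfolding weak_le_def
    by (metis append_Cons rtranclp.rtrancl_into_rtrancl)
qed

text \<open>Every letter of \<open>v\<close> standing before the first letter \<open>x\<close> of
  \<open>w\<close> is smaller than \<open>x\<close>: a larger one would give a non-inversion of
  \<open>w\<close> that \<open>v\<close> lacks. So \<open>x\<close> can be carried to the front of
  \<open>v\<close> by upward steps, and the induction continues behind it.\<close>

lemma weak_le_if_noninversions:
  assumes "distinct v" "distinct w" "set v = set w"
    "\<And>x y. x < y \<Longrightarrow> prec w x y \<Longrightarrow> prec v x y"
  shows "weak_le v w"
  using assms
proof (induction w arbitrary: v)
  case Nil
  then show ?case by (simp add: weak_le_def)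
next
  case (Cons x w)
  then obtain p s where v: "v = p @ x # s" by (metis list.set_intros(1) split_list)
  have set: "set p \<union> set s = set w" using Cons.prems(1-3) v by auto
  have "\<forall>y\<in>set p. y < x"
  proof
    fix y assume y: "y \<in> set p"
    show "y < x"
    proof (rule ccontr)
      assume "\<not> y < x"
      moreover have "x \<noteq> y" using Cons.prems(1) v y by auto
      ultimately have "x < y" by simp
      moreover have "prec (x # w) x y" using y set by auto
      ultimately have "prec v x y" using Cons.prems(4) by blast
      moreover have "prec v y x" using v y by (auto simp: prec_append)
      ultimately show False using prec_asym Cons.prems(1) by metis
    qed
  qed
  then have 1: "weak_le v (x # p @ s)" using weak_le_bring_front v by blast
  have "weak_le (p @ s) w"
  proof (rule Cons.IH)
    fix y z assume yz: "y < z" "prec w y z"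
    then have "prec v y z" using Cons.prems(4) by auto
    moreover have "y \<noteq> x" "z \<noteq> x" using Cons.prems(2) yz prec_in_set by fastforce+
    ultimately show "prec (p @ s) y z" using v by (auto simp: prec_append)
  qed (use Cons.prems(1,2) v set in auto)
  then have "weak_le (x # p @ s) (x # w)" by (rule weak_le_Cons)
  then show ?case using 1 unfolding weak_le_def by (rule rtranclp_trans[rotated])
qed

lemma weak_le_antisym:
  assumes "weak_le v w" "weak_le w v" "distinct v"
  shows "v = w"
proof -
  have w: "distinct w" "set w = set v" and vw: "\<And>x y. x < y \<Longrightarrow> prec v x y \<longleftrightarrow> prec w x y"
    using weak_le_imp[OF assms(1,3)] weak_le_imp[OF assms(2)] by auto
  show ?thesis
  proof (rule prec_unique)
    fix x y assume xy: "prec v x y"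
    then have in_set: "x \<in> set w" "y \<in> set w" using prec_in_set w by fastforce+
    consider "x < y" | "y < x" using prec_irrefl[OF assms(3)] xy by (metis linorder_less_linear)
    then show "prec w x y"
    proof cases
      case 2
      then show ?thesis using vw[of y x] xy prec_asym[OF assms(3)] prec_linear in_set by (metis less_irrefl)
    qed (use vw xy in simp)
  qed (use w assms in auto)
qed

section \<open>Monotone runs\<close>

lemma runs_wrt_eq_Nil_iff [simp]: "runs_wrt r v = [] \<longleftrightarrow> v = []"
  by (induction r v rule: runs_wrt.induct) (auto simp: Let_def)

lemma runs_wrt_nonempty: "[] \<notin> set (runs_wrt r v)"
proof (induction r v rule: runs_wrt.induct)
  case (3 r x y zs)
  then show ?case by (cases "runs_wrt r (y # zs)") (auto simp: Let_def)
qed auto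

lemma hd_hd_runs_wrt: "v \<noteq> [] \<Longrightarrow> hd (hd (runs_wrt r v)) = hd v"
  by (induction r v rule: runs_wrt.induct) (auto simp: Let_def)

lemma concat_runs_wrt: "concat (runs_wrt r v) = v"
proof (induction r v rule: runs_wrt.induct)
  case (3 r x y zs)
  then show ?case by (cases "runs_wrt r (y # zs)") (auto simp: Let_def)
qed auto

lemma sorted_wrt_runs_wrt:
  assumes "transp r"
  shows "\<forall>R\<in>set (runs_wrt r v). sorted_wrt r R"
  using assms
proof (induction r v rule: runs_wrt.induct)
  case (3 r x y zs)
  obtain R Rs where R: "runs_wrt r (y # zs) = R # Rs" by (cases "runs_wrt r (y # zs)") auto
  then have "R \<noteq> []" "hd R = y"
    using runs_wrt_nonempty[of r "y # zs"] hd_hd_runs_wrt[of "y # zs" r] by auto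
  then obtain R' where R': "R = y # R'" by (cases R) auto
  have "\<forall>R\<in>set (R # Rs). sorted_wrt r R" using 3 R by metis
  then show ?case using R R' 3(2) by (auto simp: Let_def dest: transpD)
qed auto

lemma runs_wrt_adjacent:
  "r a b \<Longrightarrow> \<exists>R\<in>set (runs_wrt r (us @ a # b # ws)). a \<in> set R \<and> b \<in> set R"
proof (induction us)
  case Nil
  obtain R Rs where R: "runs_wrt r (b # ws) = R # Rs" by (cases "runs_wrt r (b # ws)") auto
  then have "R \<noteq> []" "hd R = b" using runs_wrt_nonempty[of r "b # ws"] hd_hd_runs_wrt[of "b # ws" r] by auto
  then have "b \<in> set R" by (metis hd_in_set)
  then show ?case using R Nil by auto
next
  case (Cons c us)
  obtain d ds where d: "us @ a # b # ws = d # ds" by (cases us) auto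
  obtain R Rs where R: "runs_wrt r (d # ds) = R # Rs" by (cases "runs_wrt r (d # ds)") auto
  show ?case using Cons R d by (auto simp: Let_def)
qed

lemma runs_wrt_append:
  "xs = [] \<or> ys = [] \<or> \<not> r (last xs) (hd ys) \<Longrightarrow> runs_wrt r (xs @ ys) = runs_wrt r xs @ runs_wrt r ys"
proof (induction r xs rule: runs_wrt.induct)
  case (2 r x)
  then show ?case by (cases ys) (auto simp: Let_def)
next
  case (3 r x y zs)
  have "runs_wrt r (y # zs) \<noteq> []" by simp
  then show ?case using 3 by (auto simp: Let_def)
qed auto

lemma runs_wrt_snoc:
  "r y x \<Longrightarrow> runs_wrt r (xs @ [y, x]) =
     butlast (runs_wrt r (xs @ [y])) @ [last (runs_wrt r (xs @ [y])) @ [x]]"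
proof (induction xs)
  case (Cons a xs)
  obtain b bs where b: "xs @ [y] = b # bs" by (cases xs) auto
  obtain R Rs where R: "runs_wrt r (b # bs) = R # Rs" by (cases "runs_wrt r (b # bs)") auto
  have b': "xs @ [y, x] = b # (bs @ [x])" using b by (metis append.assoc append_Cons append_Nil)
  have "runs_wrt r (b # bs @ [x]) = butlast (R # Rs) @ [last (R # Rs) @ [x]]"
    using Cons b' b R by simp
  then have "runs_wrt r (a # b # bs @ [x]) =
      butlast (runs_wrt r (a # b # bs)) @ [last (runs_wrt r (a # b # bs)) @ [x]]"
    using R by (auto simp: Let_def)
  then show ?case by (simp only: append_Cons b b')
qed auto

text \<open>Left moves act as right moves on the reversed list; this turns the ascending runs of a
  word into the descending runs of its reversal.\<close>

lemma runs_wrt_rev: "runs_wrt r (rev v) = rev (map rev (runs_wrt (\<lambda>x y. r y x) v))"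
proof (induction v rule: induct_list012)
  case (3 x y zs)
  have ne: "runs_wrt (\<lambda>x y. r y x) (y # zs) \<noteq> []" by simp
  show ?case
  proof (cases "r y x")
    case True
    then show ?thesis
      using runs_wrt_snoc[of r y x "rev zs"] 3 ne
      by (cases "runs_wrt (\<lambda>x y. r y x) (y # zs)") (auto simp: Let_def)
  next
    case False
    then show ?thesis
      using runs_wrt_append[of "rev (y # zs)" "[x]" r] 3 by (auto simp: Let_def)
  qed
qed auto

text \<open>Each adjacent pair is a break between runs of exactly one of the two kinds, and each
  kind has one run more than breaks.\<close>

lemma length_runs_wrt:
  assumes "v \<noteq> []" "distinct v"
  shows "length (runs_wrt (>) v) + length (runs_wrt (<) (v::nat list)) = length v + 1"
  using assms
proof (induction v rule: induct_list012)
  case (3 x y zs)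
  have "runs_wrt (>) (y # zs) \<noteq> []" "runs_wrt (<) (y # zs) \<noteq> []" by auto
  then have "0 < length (runs_wrt (>) (y # zs))" "0 < length (runs_wrt (<) (y # zs))" by blast+
  then show ?case using 3 by (auto simp: Let_def)
qed auto

section \<open>Ordered partitions as fibres\<close>

text \<open>The values of \<open>f\<close> may have gaps. This allows arbitrary keys as values and
  restriction to a subset without renumbering.\<close>

definition fibres :: "('a \<Rightarrow> nat) \<Rightarrow> 'a set \<Rightarrow> 'a set list" where
  "fibres f X = map (\<lambda>c. {x\<in>X. f x = c}) (sorted_list_of_set (f ` X))"

lemma length_fibres: "length (fibres f X) = card (f ` X)"
  by (simp add: fibres_def)

lemma fibres_empty [simp]: "fibres f {} = []"
  by (simp add: fibres_def)

lemma fibres_nth: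
  assumes "h ` X = {..<p}" "i < p"
  shows "fibres h X ! i = {x\<in>X. h x = i}"
proof -
  have "sorted_list_of_set {..<p} ! i = i" using assms(2) by (simp add: lessThan_atLeast0)
  moreover have "length (sorted_list_of_set {..<p}) = p" by simp
  ultimately show ?thesis unfolding fibres_def assms(1) using assms(2) by (simp only: nth_map)
qed

lemma fibres_singleton [simp]: "fibres f {x} = [{x}]"
  by (auto simp: fibres_def)

lemma sorted_list_of_set_Un:
  fixes A B :: "nat set"
  assumes "finite A" "finite B" "\<And>a b. a \<in> A \<Longrightarrow> b \<in> B \<Longrightarrow> a < b"
  shows "sorted_list_of_set (A \<union> B) = sorted_list_of_set A @ sorted_list_of_set B"
proof (rule sorted_distinct_set_unique)
  show "sorted (sorted_list_of_set A @ sorted_list_of_set B)"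
    using assms by (auto simp: sorted_append intro: less_imp_le)
  show "distinct (sorted_list_of_set A @ sorted_list_of_set B)"
    using assms(1,2) assms(3) by (simp add: disjoint_iff) (metis less_irrefl)
qed (use assms in auto)

lemma fibres_Un:
  assumes "finite A" "finite B" "\<And>a b. a \<in> A \<Longrightarrow> b \<in> B \<Longrightarrow> f a < f b"
  shows "fibres f (A \<union> B) = fibres f A @ fibres f B"
proof -
  have "sorted_list_of_set (f ` A \<union> f ` B) = sorted_list_of_set (f ` A) @ sorted_list_of_set (f ` B)"
    using assms by (intro sorted_list_of_set_Un) auto
  moreover have "{x \<in> A \<union> B. f x = c} = {x \<in> A. f x = c}" if "c \<in> f ` A" for c
    using assms(3) that by fastforce
  moreover have "{x \<in> A \<union> B. f x = c} = {x \<in> B. f x = c}" if "c \<in> f ` B" for c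
    using assms(3) that by fastforce
  ultimately show ?thesis
    using assms(1,2) by (simp add: fibres_def image_Un)
qed

lemma fibres_insert:
  assumes "finite X" "x \<notin> X" "f x \<in> f ` X"
  obtains k where "k < length (fibres f X)"
    "fibres f (insert x X) = (fibres f X)[k := insert x (fibres f X ! k)]"
proof -
  define cs where "cs = sorted_list_of_set (f ` X)"
  have cs: "distinct cs" "set cs = f ` X" using assms by (auto simp: cs_def)
  obtain k where k: "k < length cs" "cs ! k = f x"
    using assms(3) cs by (metis in_set_conv_nth)
  have *: "f ` insert x X = f ` X" using assms by auto
  have "fibres f (insert x X) = (fibres f X)[k := insert x (fibres f X ! k)]"
    unfolding fibres_def * cs_def[symmetric]
  proof (rule nth_equalityI)
    fix i assume i: "i < length (map (\<lambda>c. {y \<in> insert x X. f y = c}) cs)"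
    then have "cs ! i = f x \<longleftrightarrow> i = k" using k nth_eq_iff_index_eq[OF cs(1), of i k] by simp
    then show "map (\<lambda>c. {y \<in> insert x X. f y = c}) cs ! i =
        (map (\<lambda>c. {y \<in> X. f y = c}) cs)
          [k := insert x (map (\<lambda>c. {y \<in> X. f y = c}) cs ! k)] ! i"
      using i k by (cases "i = k") auto
  qed auto
  then show ?thesis using that k by (simp add: fibres_def cs_def)
qed

lemma fibres_cong:
  assumes "finite X" "\<And>x y. x \<in> X \<Longrightarrow> y \<in> X \<Longrightarrow> f x < f y \<longleftrightarrow> g x < g y"
  shows "fibres f X = fibres g X"
proof -
  have eq: "f x = f y \<longleftrightarrow> g x = g y" if "x \<in> X" "y \<in> X" for x y
    using assms(2)[OF that] assms(2)[OF that(2,1)] by (metis linorder_neq_iff)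
  \<comment> \<open>\<open>\<phi>\<close> translates a value of \<open>f\<close> into the value of
    \<open>g\<close> on the same block.\<close>
  define \<phi> where "\<phi> c = g (inv_into X f c)" for c
  have \<phi>: "\<phi> (f x) = g x" if "x \<in> X" for x
    using eq[of "inv_into X f (f x)" x] that by (simp add: \<phi>_def inv_into_into f_inv_into_f)
  have "sorted_list_of_set (g ` X) = map \<phi> (sorted_list_of_set (f ` X))"
  proof (rule sorted_distinct_set_unique)
    have mono: "\<phi> c < \<phi> d" if "c \<in> f ` X" "d \<in> f ` X" "c < d" for c d
      using that \<phi> assms(2) by auto
    have "sorted_wrt (<) (sorted_list_of_set (f ` X))" by simp
    then have "sorted_wrt (\<lambda>c d. \<phi> c < \<phi> d) (sorted_list_of_set (f ` X))"
      by (rule sorted_wrt_mono_rel[rotated]) (use mono assms(1) in auto)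
    then have "sorted_wrt (<) (map \<phi> (sorted_list_of_set (f ` X)))"
      by (simp add: sorted_wrt_map)
    then show "sorted (map \<phi> (sorted_list_of_set (f ` X)))"
      "distinct (map \<phi> (sorted_list_of_set (f ` X)))"
      by (auto simp: strict_sorted_iff)
    show "set (sorted_list_of_set (g ` X)) = set (map \<phi> (sorted_list_of_set (f ` X)))"
      using assms(1) \<phi> by (simp add: image_image)
  qed auto
  moreover have "{x \<in> X. g x = \<phi> c} = {x \<in> X. f x = c}" if "c \<in> f ` X" for c
    using that \<phi> eq by auto
  ultimately show ?thesis using assms(1) by (auto simp: fibres_def)
qed

section \<open>Admissible moves\<close>

text \<open>The moves sweep once from left to right, so the leading block is final as soon as
  \<open>M\<close> has left it, and the sweep goes on with the enlarged next block. In this form no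
  positions occur.\<close>

inductive moves_to :: "nat set list \<Rightarrow> nat set list \<Rightarrow> bool" where
  Nil: "moves_to [] []"
| single: "moves_to [A] [A]"
| move: "M \<subseteq> A - {Min A} \<Longrightarrow> M \<noteq> {} \<longrightarrow> Min M > Max B \<Longrightarrow> moves_to ((B \<union> M) # As) As' \<Longrightarrow>
    moves_to (A # B # As) ((A - M) # As')"

lemma moves_to_eq_Nil: "moves_to A B \<Longrightarrow> A = [] \<longleftrightarrow> B = []"
  by (auto elim: moves_to.cases)

text \<open>\<open>P\<close> holds the blocks that are already final, so that
  \<open>length P\<close> is the position of the next move.\<close>

lemma moves_to_R_move_aux:
  assumes "moves_to A B"
  shows "\<exists>Ms. length Ms = length A - 1 \<and> admissible_seq (length P) Ms (P @ A) \<and>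
    move_right_seq (length P) Ms (P @ A) = P @ B"
  using assms
proof (induction arbitrary: P)
  case (move M A B As As')
  obtain Ms where Ms: "length Ms = length ((B \<union> M) # As) - 1"
    "admissible_seq (length (P @ [A - M])) Ms ((P @ [A - M]) @ (B \<union> M) # As)"
    "move_right_seq (length (P @ [A - M])) Ms ((P @ [A - M]) @ (B \<union> M) # As) = (P @ [A - M]) @ As'"
    using move.IH[of "P @ [A - M]"] by blast
  have "move_right (length P) M (P @ A # B # As) = P @ (A - M) # (B \<union> M) # As"
    by (simp add: move_right_def list_update_append nth_append)
  moreover have "admissible_move (length P) M (P @ A # B # As)"
    using move.hyps by (simp add: admissible_move_def nth_append)
  ultimately show ?case using Ms by (intro exI[of _ "M # Ms"]) auto
qed auto

lemma moves_to_R_move: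
  "moves_to A B \<Longrightarrow> \<exists>Ms. R_admissible Ms A \<and> R_move Ms A = B"
  using moves_to_R_move_aux[of A B "[]"] by (auto simp: R_admissible_def R_move_def)

lemma moves_to_append: "moves_to A B \<Longrightarrow> moves_to A' B' \<Longrightarrow> moves_to (A @ A') (B @ B')"
proof (induction rule: moves_to.induct)
  case (single A)
  show ?case
  proof (cases A')
    case Nil
    then show ?thesis using moves_to_eq_Nil[OF single] moves_to.single by simp
  next
    case (Cons C As)
    \<comment> \<open>The empty move leads across the junction of the two lists.\<close>
    have "moves_to (A # C # As) ((A - {}) # B')"
      using single Cons by (intro moves_to.move) auto
    then show ?thesis using Cons by simp
  qed
next
  case (move M A B As As')
  then show ?case using moves_to.move[of M A B "As @ A'" "As' @ B'"] by simp
qed auto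

text \<open>A new maximum can be added to each of the first \<open>k\<close> moves: it exceeds the
  block it enters, does not lower the minimum of a nonempty \<open>M\<close>, and is not the minimum
  of the block it leaves. It travels along with the other letters and then stays at position
  \<open>k\<close>.\<close>

lemma moves_to_insert:
  assumes "moves_to (A # As) Bs" "k < length Bs" "\<forall>B\<in>set (A # As). finite B \<and> B \<noteq> {} \<and> (\<forall>x\<in>B. x < n)"
  shows "moves_to (insert n A # As) (Bs[k := insert n (Bs ! k)])"
  using assms
proof (induction "A # As" Bs arbitrary: A As k rule: moves_to.induct)
  case (single A)
  then show ?case using moves_to.single by auto
next
  case (move M A B As As')
  have fin: "finite A" "A \<noteq> {}" "\<forall>x\<in>A. x < n" "finite B" "B \<noteq> {}" "\<forall>x\<in>B. x < n"
    using move.prems by auto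
  have M: "M \<subseteq> A" "finite M" "n \<notin> M" "Min A \<notin> M"
    using move.hyps(1) fin finite_subset by blast+
  have Min: "Min (insert n A) = Min A"
    using fin by (subst Min_insert) (auto simp: min_absorb2 less_imp_le)
  have "Min A < n" using fin by simp
  show ?case
  proof (cases k)
    case 0
    have "moves_to (insert n A # B # As) ((insert n A - M) # As')"
      using move.hyps Min by (intro moves_to.move) auto
    moreover have "insert n A - M = insert n (A - M)" using M by auto
    ultimately show ?thesis using 0 by simp
  next
    case (Suc k')
    have "\<forall>C\<in>set ((B \<union> M) # As). finite C \<and> C \<noteq> {} \<and> (\<forall>x\<in>C. x < n)"
      using move.prems M fin by auto
    then have "moves_to (insert n (B \<union> M) # As) (As'[k' := insert n (As' ! k')])"
      using move.hyps(4)[of k'] move.prems Suc by auto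
    then have 1: "moves_to ((B \<union> insert n M) # As) (As'[k' := insert n (As' ! k')])" by simp
    have "Max B < Min (insert n M)"
      using fin M move.hyps(2) by (cases "M = {}") auto
    then have "moves_to (insert n A # B # As)
        ((insert n A - insert n M) # As'[k' := insert n (As' ! k')])"
      using 1 Min M move.hyps(1) \<open>Min A < n\<close> by (intro moves_to.move) auto
    moreover have "insert n A - insert n M = A - M" using fin by auto
    ultimately show ?thesis using Suc by simp
  qed
qed

lemma blocks_desc_partition:
  "B \<in> set (desc_partition v) \<Longrightarrow> finite B \<and> B \<noteq> {} \<and> B \<subseteq> set v"
proof -
  assume "B \<in> set (desc_partition v)"
  then obtain R where R: "R \<in> set (runs_wrt (>) v)" "B = set R" by (auto simp: desc_partition_def)
  then have "set R \<subseteq> set v" using concat_runs_wrt[of "(>)" v] by (metis UN_upper set_concat)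
  then show ?thesis using R runs_wrt_nonempty by auto
qed

text \<open>The maximum always begins a descending run, and that run continues with the letter after
  it.\<close>

lemma desc_partition_max:
  assumes "\<forall>x\<in>set us. x < n" "\<forall>x\<in>set vs. x < n"
  shows "desc_partition (us @ n # vs) = desc_partition us @
    (if vs = [] then [{n}] else insert n (hd (desc_partition vs)) # tl (desc_partition vs))"
proof -
  have "runs_wrt (>) (us @ n # vs) = runs_wrt (>) us @ runs_wrt (>) (n # vs)"
    using assms by (intro runs_wrt_append) (auto simp: not_less intro: less_imp_le)
  then show ?thesis
    using assms by (cases vs) (auto simp: desc_partition_def Let_def hd_map map_tl)
qed

text \<open>The two parts of the word evolve separately, with the empty move between them, while
  \<open>n\<close> starts in the first block of \<open>vs\<close> and is carried to position
  \<open>k\<close>.\<close>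

lemma moves_to_desc_partition_max:
  assumes "\<forall>x\<in>set us. x < n" "\<forall>x\<in>set vs. x < n"
    "moves_to (desc_partition us) As" "moves_to (desc_partition vs) Bs"
    "vs \<noteq> [] \<Longrightarrow> k < length Bs"
  shows "moves_to (desc_partition (us @ n # vs))
    (As @ (if vs = [] then [{n}] else Bs[k := insert n (Bs ! k)]))"
  unfolding desc_partition_max[OF assms(1,2)]
proof (rule moves_to_append[OF assms(3)])
  show "moves_to (if vs = [] then [{n}] else insert n (hd (desc_partition vs)) # tl (desc_partition vs))
     (if vs = [] then [{n}] else Bs[k := insert n (Bs ! k)])"
  proof (cases "vs = []")
    case False
    then obtain B Cs where B: "desc_partition vs = B # Cs"
      by (cases "desc_partition vs") (auto simp: desc_partition_def)
    then have "\<forall>B\<in>set (B # Cs). finite B \<and> B \<noteq> {} \<and> (\<forall>x\<in>B. x < n)"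
      using blocks_desc_partition[of _ vs] assms(2) by (metis subsetD)
    then show ?thesis using moves_to_insert[of B Cs Bs k n] assms B False by auto
  qed (auto intro: moves_to.single)
qed

section \<open>Pairs of 132-avoiding ordered partitions\<close>

definition avoids132 :: "(nat \<Rightarrow> nat) \<Rightarrow> nat set \<Rightarrow> bool" where
  "avoids132 f X \<longleftrightarrow> (\<forall>x\<in>X. \<forall>y\<in>X. \<forall>z\<in>X. x < y \<longrightarrow> y < z \<longrightarrow> f x \<le> f z \<longrightarrow> f y \<le> f z)"

definition separated :: "(nat \<Rightarrow> nat) \<Rightarrow> (nat \<Rightarrow> nat) \<Rightarrow> nat set \<Rightarrow> bool" where
  "separated f g X \<longleftrightarrow> (\<forall>x\<in>X. \<forall>y\<in>X. x < y \<longrightarrow> g x \<le> g y \<longrightarrow> f x < f y)"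

lemma avoids132_subset: "avoids132 f X \<Longrightarrow> Y \<subseteq> X \<Longrightarrow> avoids132 f Y"
  unfolding avoids132_def by blast

lemma separated_subset: "separated f g X \<Longrightarrow> Y \<subseteq> X \<Longrightarrow> separated f g Y"
  unfolding separated_def by blast

lemma avoids132D:
  "avoids132 f X \<Longrightarrow> x \<in> X \<Longrightarrow> y \<in> X \<Longrightarrow> z \<in> X \<Longrightarrow> x < y \<Longrightarrow> y < z \<Longrightarrow> f x \<le> f z \<Longrightarrow> f y \<le> f z"
  unfolding avoids132_def by blast

lemma separatedD:
  "separated f g X \<Longrightarrow> x \<in> X \<Longrightarrow> y \<in> X \<Longrightarrow> x < y \<Longrightarrow> g x \<le> g y \<Longrightarrow> f x < f y"
  unfolding separated_def by blast

section \<open>Counting blocks through rises\<close>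

definition nonmin :: "(nat \<Rightarrow> nat) \<Rightarrow> nat set \<Rightarrow> nat set" where
  "nonmin g X = {j\<in>X. \<exists>i\<in>X. i < j \<and> g i = g j}"

definition rises :: "(nat \<Rightarrow> nat) \<Rightarrow> nat \<Rightarrow> nat \<Rightarrow> nat set" where
  "rises f a b = {j. a < j \<and> j < b \<and> f (j - 1) < f j}"

lemma card_nonmin:
  assumes "finite X"
  shows "card (nonmin g X) + card (g ` X) = card X"
proof -
  have "g ` (X - nonmin g X) = g ` X"
  proof (intro equalityI subsetI)
    fix c assume "c \<in> g ` X"
    then have ne: "{x\<in>X. g x = c} \<noteq> {}" by auto
    define m where "m = Min {x\<in>X. g x = c}"
    have m: "m \<in> X" "g m = c" using Min_in[OF _ ne] assms by (auto simp: m_def)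
    have "m \<notin> nonmin g X"
    proof
      assume "m \<in> nonmin g X"
      then obtain i where "i \<in> {x\<in>X. g x = c}" "i < m" using m by (auto simp: nonmin_def)
      moreover have "finite {x\<in>X. g x = c}" using assms by simp
      ultimately show False using Min_le[of "{x\<in>X. g x = c}" i] unfolding m_def by (simp add: not_le[symmetric])
    qed
    then show "c \<in> g ` (X - nonmin g X)" using m by auto
  qed auto
  moreover have "inj_on g (X - nonmin g X)"
  proof (rule inj_onI)
    fix x y assume "x \<in> X - nonmin g X" "y \<in> X - nonmin g X" "g x = g y"
    then show "x = y" by (cases x y rule: linorder_cases) (auto simp: nonmin_def)
  qed
  ultimately have "card (g ` X) = card (X - nonmin g X)" by (metis card_image)
  moreover have "nonmin g X \<subseteq> X" by (auto simp: nonmin_def)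
  ultimately show ?thesis using assms by (simp add: card_Diff_subset finite_subset card_mono)
qed

text \<open>If \<open>i < j\<close> share a \<open>g\<close>-block, 132-avoidance at
  \<open>i < j - 1 < j\<close> gives \<open>g (j - 1) \<le> g j\<close>, and
  \<open>separated\<close> turns this into a rise of \<open>f\<close>.\<close>

lemma nonmin_subset_rises:
  assumes "avoids132 g {a..<b}" "separated f g {a..<b}"
  shows "nonmin g {a..<b} \<subseteq> rises f a b"
proof
  fix j assume "j \<in> nonmin g {a..<b}"
  then obtain i where i: "a \<le> i" "i < j" "j < b" "g i = g j" by (auto simp: nonmin_def)
  have "g (j - 1) \<le> g j"
  proof (cases "i = j - 1")
    case False
    then show ?thesis using avoids132D[OF assms(1), of i "j - 1" j] i by auto
  qed (use i in simp)
  moreover have "j - 1 \<in> {a..<b}" "j \<in> {a..<b}" "j - 1 < j" using i by auto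
  ultimately have "f (j - 1) < f j" using separatedD[OF assms(2), of "j - 1" j] by simp
  then show "j \<in> rises f a b" using i by (auto simp: rises_def)
qed

text \<open>For two rises \<open>j < k\<close> with \<open>f (j - 1) = f (k - 1)\<close>, the
  elements \<open>j - 1 < j < k - 1\<close> would violate 132-avoidance.\<close>

lemma inj_on_rises:
  assumes "avoids132 f {a..<b}"
  shows "inj_on (\<lambda>j. f (j - 1)) (rises f a b)"
proof (rule linorder_inj_onI)
  fix j k assume jk: "j < k" "j \<in> rises f a b" "k \<in> rises f a b"
  show "f (j - 1) \<noteq> f (k - 1)"
  proof
    assume eq: "f (j - 1) = f (k - 1)"
    have "f (j - 1) < f j" using jk by (simp add: rises_def)
    then have "j < k - 1" using eq jk by (cases "j = k - 1") auto
    moreover have "j - 1 \<in> {a..<b}" "j \<in> {a..<b}" "k - 1 \<in> {a..<b}" "j - 1 < j"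
      using jk by (auto simp: rises_def)
    ultimately have "f j \<le> f (k - 1)"
      using avoids132D[OF assms, of "j - 1" j "k - 1"] eq by auto
    then show False using eq \<open>f (j - 1) < f j\<close> by simp
  qed
qed auto

lemma rises_image_subset: "(\<lambda>j. f (j - 1)) ` rises f a b \<subseteq> f ` {a..<b} - {Max (f ` {a..<b})}"
proof
  fix c assume "c \<in> (\<lambda>j. f (j - 1)) ` rises f a b"
  then obtain j where j: "c = f (j - 1)" "a < j" "j < b" "f (j - 1) < f j" by (auto simp: rises_def)
  have "f j \<le> Max (f ` {a..<b})" using j by (intro Max_ge) auto
  moreover have "j - 1 \<in> {a..<b}" using j by auto
  ultimately show "c \<in> f ` {a..<b} - {Max (f ` {a..<b})}"
    using j by (metis DiffI imageI leD singletonD)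
qed

lemma card_rises:
  assumes "avoids132 f {a..<b}" "a < b"
  shows "card (rises f a b) + 1 \<le> card (f ` {a..<b})"
proof -
  have "card (rises f a b) \<le> card (f ` {a..<b} - {Max (f ` {a..<b})})"
    using card_image[OF inj_on_rises[OF assms(1)]] rises_image_subset
    by (metis card_mono finite_Diff finite_atLeastLessThan finite_imageI)
  moreover have "Max (f ` {a..<b}) \<in> f ` {a..<b}" using assms(2) by (intro Max_in) auto
  moreover have "card (f ` {a..<b}) > 0" using assms(2) by (simp add: card_gt_0_iff)
  ultimately show ?thesis by (simp add: card_Diff_singleton)
qed

lemma finite_rises: "finite (rises f a b)"
  by (rule finite_subset[of _ "{..<b}"]) (auto simp: rises_def)

lemma card_blocks_ge:
  assumes "avoids132 f {a..<b}" "avoids132 g {a..<b}" "separated f g {a..<b}" "a < b"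
  shows "b - a + 1 \<le> card (f ` {a..<b}) + card (g ` {a..<b})"
  using card_mono[OF finite_rises nonmin_subset_rises[OF assms(2,3)]] card_rises[OF assms(1,4)]
    card_nonmin[of "{a..<b}" g] by simp

text \<open>Equality in \<open>card_blocks_ge\<close> is equality in each link of its chain: every
  rise is a non-minimum of \<open>g\<close>, and every value of \<open>f\<close> but the largest
  occurs just before a rise. If \<open>f (b - 1)\<close> were not the largest, a rise
  \<open>j\<close> with \<open>f (j - 1) = f (b - 1)\<close> would violate 132-avoidance at
  \<open>j - 1 < j < b - 1\<close>.\<close>

lemma tight_imp:
  assumes "avoids132 f {a..<b}" "avoids132 g {a..<b}" "separated f g {a..<b}" "a < b"
    and "card (f ` {a..<b}) + card (g ` {a..<b}) = b - a + 1"
  shows "nonmin g {a..<b} = rises f a b" "f (b - 1) = Max (f ` {a..<b})"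
proof -
  note ineqs = card_mono[OF finite_rises nonmin_subset_rises[OF assms(2,3)]] card_rises[OF assms(1,4)]
    card_nonmin[of "{a..<b}" g]
  have 1: "card (nonmin g {a..<b}) = card (rises f a b)"
    and 2: "card (rises f a b) + 1 = card (f ` {a..<b})"
    using ineqs assms(5) by auto
  show "nonmin g {a..<b} = rises f a b"
    using card_subset_eq[OF finite_rises nonmin_subset_rises[OF assms(2,3)] 1] .
  have "Max (f ` {a..<b}) \<in> f ` {a..<b}" using assms(4) by (intro Max_in) auto
  then have "card (f ` {a..<b} - {Max (f ` {a..<b})}) = card ((\<lambda>j. f (j - 1)) ` rises f a b)"
    using card_image[OF inj_on_rises[OF assms(1)]] 2 by (simp add: card_Diff_singleton)
  then have im: "(\<lambda>j. f (j - 1)) ` rises f a b = f ` {a..<b} - {Max (f ` {a..<b})}"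
    by (intro card_subset_eq rises_image_subset) auto
  show "f (b - 1) = Max (f ` {a..<b})"
  proof (rule ccontr)
    assume "f (b - 1) \<noteq> Max (f ` {a..<b})"
    then have "f (b - 1) \<in> (\<lambda>j. f (j - 1)) ` rises f a b" using im assms(4) by auto
    then obtain j where j: "a < j" "j < b" "f (j - 1) < f j" "f (b - 1) = f (j - 1)"
      by (auto simp: rises_def)
    have "j \<noteq> b - 1" using j by auto
    have "j - 1 \<in> {a..<b}" "j < b - 1" using j \<open>j \<noteq> b - 1\<close> by auto
    then have "f j \<le> f (b - 1)" using avoids132D[OF assms(1), of "j - 1" j "b - 1"] j by auto
    then show False using j by simp
  qed
qed

lemma card_image_Un_disjoint:
  fixes f :: "nat \<Rightarrow> nat"
  assumes "finite A" "finite B" "\<And>x y. x \<in> A \<Longrightarrow> y \<in> B \<Longrightarrow> f x < f y"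
  shows "card (f ` (A \<union> B)) = card (f ` A) + card (f ` B)"
  unfolding image_Un using assms by (intro card_Un_disjoint) fastforce+

text \<open>The cut of the recursion: the maximum \<open>n\<close> splits the word into the part \<open>{s..<n}\<close>
  to its left and the part \<open>{a..<s}\<close> to its right.\<close>

lemma tight_cut:
  assumes "avoids132 f {a..<Suc n}" "avoids132 g {a..<Suc n}" "separated f g {a..<Suc n}" "a \<le> n"
    and tight: "card (f ` {a..<Suc n}) + card (g ` {a..<Suc n}) = n - a + 2"
  obtains s where "a \<le> s" "s \<le> n"
    "\<And>l r. l \<in> {s..<n} \<Longrightarrow> r \<in> {a..<s} \<Longrightarrow> f l < f r \<and> g l < g r"
    "\<And>l. l \<in> {s..<n} \<Longrightarrow> f l < f n" "\<And>r. r \<in> {a..<s} \<Longrightarrow> g n < g r"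
    "a < s \<Longrightarrow> f n \<in> f ` {a..<s}" "s < n \<Longrightarrow> g n \<in> g ` {s..<n}"
    "s < n \<Longrightarrow> card (f ` {s..<n}) + card (g ` {s..<n}) = n - s + 1"
    "a < s \<Longrightarrow> card (f ` {a..<s}) + card (g ` {a..<s}) = s - a + 1"
proof (cases "a = n")
  case True
  show ?thesis by (rule that[of n]) (use True in auto)
next
  case False
  let ?X = "{a..<Suc n}"
  have an: "a < n" using False assms(4) by simp
  have nonmin: "nonmin g ?X = rises f a (Suc n)" and Max: "f n = Max (f ` ?X)"
    using tight_imp[OF assms(1-3)] tight assms(4) by auto
  have le_n: "f x \<le> f n" if "x \<in> ?X" for x using that Max by auto
  have X: "?X = insert n {a..<n}" using an by auto
  show ?thesis
  proof (cases "f (n - 1) < f n")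
    case not_rise: False
    have "n - 1 \<in> ?X" using an by auto
    then have eq: "f (n - 1) = f n" using not_rise le_n[of "n - 1"] an by fastforce
    \<comment> \<open>As the largest element, \<open>n\<close> is then alone in its
      \<open>g\<close>-block. The cut is \<open>s = n\<close>: removing \<open>n\<close> costs
      \<open>g\<close> one block and \<open>f\<close> none, so the rest remains tight.\<close>
    have "n \<notin> nonmin g ?X" using nonmin not_rise by (simp add: rises_def)
    then have ne: "g r \<noteq> g n" if "r \<in> {a..<n}" for r using that by (auto simp: nonmin_def)
    have last: "g n < g (n - 1)"
      using separatedD[OF assms(3), of "n - 1" n] an eq by (metis One_nat_def Suc_pred atLeastLessThan_iff
        gr_zeroI lessI less_Suc_eq less_Suc_eq_le not_less not_less0 order_less_irrefl)
    have lt: "g n < g r" if "r \<in> {a..<n}" for r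
    proof (rule ccontr)
      assume "\<not> g n < g r"
      then have "g r < g n" using ne[OF that] by simp
      then have "r \<noteq> n - 1" using last by auto
      then have "g (n - 1) \<le> g n"
        using avoids132D[OF assms(2), of r "n - 1" n] that \<open>g r < g n\<close> by auto
      then show False using last by simp
    qed
    have fn: "f n \<in> f ` {a..<n}" using eq an by (intro image_eqI[of _ _ "n - 1"]) auto
    have "g n \<notin> g ` {a..<n}" using ne by (metis imageE)
    then have "card (f ` ?X) = card (f ` {a..<n})" "card (g ` ?X) = Suc (card (g ` {a..<n}))"
      using fn X by (simp_all add: insert_absorb)
    then have "card (f ` {a..<n}) + card (g ` {a..<n}) = n - a + 1" using tight by simp
    then show ?thesis using that[of n] lt fn assms(4) by simp
  next
    case rise: True
    then have "n \<in> nonmin g ?X" using nonmin an by (simp add: rises_def)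
    then obtain i where i: "i \<in> {a..<n}" "g i = g n" by (auto simp: nonmin_def)
    \<comment> \<open>By 132-avoidance, the elements of \<open>{a..<n}\<close> with value at most
      \<open>f (n - 1)\<close> are exactly \<open>{s..<n}\<close>.\<close>
    define s where "s = (LEAST x. a \<le> x \<and> f x \<le> f (n - 1))"
    have s: "a \<le> s" "f s \<le> f (n - 1)" and s_le: "s \<le> n - 1"
      using LeastI[of "\<lambda>x. a \<le> x \<and> f x \<le> f (n - 1)" "n - 1"]
        Least_le[of "\<lambda>x. a \<le> x \<and> f x \<le> f (n - 1)" "n - 1"] an by (auto simp: s_def)
    have sn: "s < n" using s_le an by simp
    have L: "f l \<le> f (n - 1)" if l: "l \<in> {s..<n}" for l
    proof (cases "l = s \<or> l = n - 1")
      case False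
      then show ?thesis using avoids132D[OF assms(1), of s l "n - 1"] s l by auto
    qed (use s in auto)
    have R: "f (n - 1) < f r" if "r \<in> {a..<s}" for r
      using that not_less_Least[of r "\<lambda>x. a \<le> x \<and> f x \<le> f (n - 1)"] by (auto simp: s_def not_le)
    have LR: "f l < f r \<and> g l < g r" if l: "l \<in> {s..<n}" and r: "r \<in> {a..<s}" for l r
    proof -
      have "f l < f r" using L[OF l] R[OF r] by simp
      moreover have "\<not> g r \<le> g l"
        using separatedD[OF assms(3), of r l] l r \<open>f l < f r\<close> by auto
      ultimately show ?thesis by simp
    qed
    have Ln: "f l < f n" if "l \<in> {s..<n}" for l using L[OF that] rise by simp
    have split: "{a..<n} = {s..<n} \<union> {a..<s}" using s(1) sn by auto
    have cards: "card (f ` {a..<n}) = card (f ` {s..<n}) + card (f ` {a..<s})"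
      "card (g ` {a..<n}) = card (g ` {s..<n}) + card (g ` {a..<s})"
      unfolding split using LR by (intro card_image_Un_disjoint; simp)+
    have "g n \<in> g ` {a..<n}" using i by (metis image_eqI)
    then have gX: "card (g ` ?X) = card (g ` {a..<n})" using X by (simp add: insert_absorb)
    have fL: "f n \<notin> f ` {s..<n}" using Ln by fastforce
    have sub: "{s..<n} \<subseteq> ?X" "{a..<s} \<subseteq> ?X" using s(1) sn by auto
    note ge = card_blocks_ge[OF avoids132_subset[OF assms(1)] avoids132_subset[OF assms(2)]
        separated_subset[OF assms(3)]]
    have geL: "n - s + 1 \<le> card (f ` {s..<n}) + card (g ` {s..<n})" using ge sub sn by blast
    show ?thesis
    proof (cases "s = a")
      \<comment> \<open>Without a right part, \<open>n\<close> ends the word and forms the last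
        \<open>f\<close>-block by itself.\<close>
      case True
      have "card (f ` ?X) = Suc (card (f ` {s..<n}))" using X fL True by simp
      then have "card (f ` {s..<n}) + card (g ` {s..<n}) = n - s + 1" using gX True tight by simp
      moreover have "g n \<in> g ` {s..<n}" using i True by (metis image_eqI)
      ultimately show ?thesis using that[of s] True Ln sn by auto
    next
      case False
      then have as: "a < s" using s(1) by simp
      have geR: "s - a + 1 \<le> card (f ` {a..<s}) + card (g ` {a..<s})" using ge sub as by blast
      \<comment> \<open>If \<open>n\<close> formed an \<open>f\<close>-block by itself, the lower
        bounds for the two parts together with this block would already give
        \<open>n - a + 3\<close>.\<close>
      have fn: "f n \<in> f ` {a..<s}"
      proof (rule ccontr)
        assume "f n \<notin> f ` {a..<s}"
        then have "f n \<notin> f ` {a..<n}" using fL split by auto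
        then have "card (f ` ?X) = Suc (card (f ` {a..<n}))" using X by simp
        then show False using gX cards geL geR tight as sn by simp
      qed
      then have "f n \<in> f ` {a..<n}" using split by auto
      then have "card (f ` ?X) = card (f ` {a..<n})" using X by (simp add: insert_absorb)
      \<comment> \<open>Now \<open>n\<close> adds no block to either partition, and the two lower
        bounds sum to exactly \<open>n - a + 2\<close>, so both are attained.\<close>
      then have tL: "card (f ` {s..<n}) + card (g ` {s..<n}) = n - s + 1"
        and tR: "card (f ` {a..<s}) + card (g ` {a..<s}) = s - a + 1"
        using gX cards geL geR tight as sn by simp_all
      \<comment> \<open>Tightness of the right part puts \<open>s - 1\<close> into its last
        \<open>f\<close>-block, so \<open>f n \<le> f (s - 1)\<close>. Separation then gives
        \<open>g n < g (s - 1)\<close>, and 132-avoidance of \<open>g\<close> extends this to the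
        smaller \<open>r\<close>.\<close>
      have "f (s - 1) = Max (f ` {a..<s})"
        using tight_imp(2)[OF avoids132_subset[OF assms(1)] avoids132_subset[OF assms(2)]
            separated_subset[OF assms(3)], OF sub(2) sub(2) sub(2) as tR] .
      also have "f n \<le> \<dots>" using fn by (intro Max_ge) auto
      finally have "f n \<le> f (s - 1)" .
      have s1: "s - 1 \<in> ?X" "s - 1 < n" using as sn by auto
      then have last: "g n < g (s - 1)"
        using separatedD[OF assms(3), of "s - 1" n] \<open>f n \<le> f (s - 1)\<close> assms(4)
        by (auto simp: not_le[symmetric])
      have lt: "g n < g r" if r: "r \<in> {a..<s}" for r
      proof (rule ccontr)
        assume *: "\<not> g n < g r"
        then have "r \<noteq> s - 1" using last by auto
        then have "r < s - 1" using r by auto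
        then have "g (s - 1) \<le> g n"
          using avoids132D[OF assms(2), of r "s - 1" n] r s1 sn * by auto
        then show False using last by simp
      qed
      have "i \<in> {s..<n}" using i lt[of i] by (cases "i < s") auto
      then have "g n \<in> g ` {s..<n}" using i by (metis image_eqI)
      then show ?thesis using that[of s] LR Ln lt fn tL tR s(1) sn by simp
    qed
  qed
qed

text \<open>Reversing the word exchanges its two parts, so the same step places \<open>n\<close>
  among the \<open>f\<close>-blocks of the right part and among the \<open>g\<close>-blocks of the
  left part. The count is assumed only for nonempty intervals, since an empty one has no blocks
  instead of one.\<close>

lemma moves_to_fibres:
  assumes "avoids132 f {a..<b}" "avoids132 g {a..<b}" "separated f g {a..<b}"
    and "a < b \<Longrightarrow> card (f ` {a..<b}) + card (g ` {a..<b}) = b - a + 1"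
  shows "\<exists>\<sigma>. set \<sigma> = {a..<b} \<and> distinct \<sigma> \<and> moves_to (desc_partition \<sigma>) (fibres f {a..<b}) \<and>
    moves_to (desc_partition (rev \<sigma>)) (rev (fibres g {a..<b}))"
  using assms
proof (induction "b - a" arbitrary: a b rule: less_induct)
  case less
  show ?case
  proof (cases "a < b")
    case False
    then show ?thesis by (intro exI[of _ "[]"]) (auto simp: desc_partition_def intro: moves_to.Nil)
  next
    case True
    then obtain n where b: "b = Suc n" and an: "a \<le> n" by (cases b) auto
    note prems = less.prems[unfolded b]
    have tight: "card (f ` {a..<Suc n}) + card (g ` {a..<Suc n}) = n - a + 2" using prems(4) an by simp
    show ?thesis
    proof (rule tight_cut[OF prems(1-3) an tight])
      fix s assume s: "a \<le> s" "s \<le> n"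
        and LR: "\<And>l r. l \<in> {s..<n} \<Longrightarrow> r \<in> {a..<s} \<Longrightarrow> f l < f r \<and> g l < g r"
        and Ln: "\<And>l. l \<in> {s..<n} \<Longrightarrow> f l < f n" and nR: "\<And>r. r \<in> {a..<s} \<Longrightarrow> g n < g r"
        and fn: "a < s \<Longrightarrow> f n \<in> f ` {a..<s}" and gn: "s < n \<Longrightarrow> g n \<in> g ` {s..<n}"
        and tL: "s < n \<Longrightarrow> card (f ` {s..<n}) + card (g ` {s..<n}) = n - s + 1"
        and tR: "a < s \<Longrightarrow> card (f ` {a..<s}) + card (g ` {a..<s}) = s - a + 1"
      have sub: "{s..<n} \<subseteq> {a..<b}" "{a..<s} \<subseteq> {a..<b}" using s b by auto
      have "n - s < b - a" "s - a < b - a" using s b by auto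
      note IH = less.hyps[OF _ avoids132_subset[OF less.prems(1)] avoids132_subset[OF less.prems(2)]
          separated_subset[OF less.prems(3)]]
      obtain us where us: "set us = {s..<n}" "distinct us" "moves_to (desc_partition us) (fibres f {s..<n})"
        "moves_to (desc_partition (rev us)) (rev (fibres g {s..<n}))"
        using IH[OF \<open>n - s < b - a\<close> sub(1) sub(1) sub(1) tL] by blast
      obtain vs where vs: "set vs = {a..<s}" "distinct vs" "moves_to (desc_partition vs) (fibres f {a..<s})"
        "moves_to (desc_partition (rev vs)) (rev (fibres g {a..<s}))"
        using IH[OF \<open>s - a < b - a\<close> sub(2) sub(2) sub(2) tR] by blast
      have lt: "\<forall>x\<in>set us. x < n" "\<forall>x\<in>set vs. x < n" using us vs s by auto
      have X: "{a..<b} = {s..<n} \<union> insert n {a..<s}" "{a..<b} = insert n {s..<n} \<union> {a..<s}"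
        using s b by auto
      have f: "fibres f {a..<b} = fibres f {s..<n} @ fibres f (insert n {a..<s})"
        unfolding X(1) using LR Ln by (intro fibres_Un) auto
      have g: "fibres g {a..<b} = fibres g (insert n {s..<n}) @ fibres g {a..<s}"
        unfolding X(2) using LR nR by (intro fibres_Un) auto
      have vs_Nil: "vs = [] \<longleftrightarrow> \<not> a < s" and us_Nil: "rev us = [] \<longleftrightarrow> \<not> s < n"
        using us(1) vs(1) by (metis atLeastLessThan_empty_iff set_empty rev_is_Nil_conv)+
      obtain k where k: "vs \<noteq> [] \<Longrightarrow> k < length (fibres f {a..<s})"
        "fibres f (insert n {a..<s}) =
          (if vs = [] then [{n}] else (fibres f {a..<s})[k := insert n (fibres f {a..<s} ! k)])"
      proof (cases "a < s")
        case True
        have "n \<notin> {a..<s}" using s by simp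
        then show ?thesis using fibres_insert[of "{a..<s}" n f, OF _ _ fn[OF True]] that vs_Nil True
          by (metis finite_atLeastLessThan)
      next
        case False
        \<comment> \<open>The right part is empty and \<open>n\<close> is a block by itself, so the
          position is a dummy.\<close>
        then show ?thesis using that[of 0] vs_Nil by simp
      qed
      obtain j where j: "rev us \<noteq> [] \<Longrightarrow> j < length (rev (fibres g {s..<n}))"
        "rev (fibres g (insert n {s..<n})) =
          (if rev us = [] then [{n}] else (rev (fibres g {s..<n}))[j := insert n (rev (fibres g {s..<n}) ! j)])"
      proof (cases "s < n")
        case True
        obtain m where m: "m < length (fibres g {s..<n})"
          "fibres g (insert n {s..<n}) = (fibres g {s..<n})[m := insert n (fibres g {s..<n} ! m)]"
          using fibres_insert[of "{s..<n}" n g, OF _ _ gn[OF True]] by auto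
        show ?thesis
          \<comment> \<open>The position \<open>m\<close>, counted from the other end of the
            reversed list.\<close>
          by (rule that[of "length (fibres g {s..<n}) - 1 - m"])
            (use m us_Nil True in \<open>auto simp: rev_update rev_nth\<close>)
      next
        case False
        then show ?thesis using that[of 0] us_Nil by simp
      qed
      have "moves_to (desc_partition (us @ n # vs)) (fibres f {a..<b})"
        using moves_to_desc_partition_max[OF lt us(3) vs(3) k(1)] f k(2) by simp
      moreover have "moves_to (desc_partition (rev vs @ n # rev us)) (rev (fibres g {a..<b}))"
        using moves_to_desc_partition_max[of "rev vs" n "rev us", OF _ _ vs(4) us(4) j(1)] lt g j(2)
        by simp
      moreover have "set (us @ n # vs) = {a..<b}" using us vs X by auto
      moreover have "distinct (us @ n # vs)" using us vs lt s by fastforce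
      ultimately show ?thesis by (intro exI[of _ "us @ n # vs"]) simp
    qed
  qed
qed

section \<open>Faces of the permutahedron as fibres\<close>

lemma P_face_fibres: "P_face n (fibres f {1..n})"
proof -
  have "inj_on (\<lambda>c. {x \<in> {1..n}. f x = c}) (f ` {1..n})"
    by (rule inj_onI) blast
  then show ?thesis
    by (auto simp: P_face_def partition_on_def fibres_def distinct_map disjoint_def)
qed

lemma P_face_obtain:
  assumes "P_face n u"
  obtains h where "u = fibres h {1..n}" "h ` {1..n} = {..<length u}"
    "\<forall>i<length u. u ! i = {x\<in>{1..n}. h x = i}"
proof -
  have part: "partition_on {1..n} (set u)" "distinct u" using assms by (auto simp: P_face_def)
  define h where "h x = (THE i. i < length u \<and> x \<in> u ! i)" for x
  have uniq: "i = j" if "i < length u" "j < length u" "x \<in> u ! i" "x \<in> u ! j" for i j x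
  proof (rule ccontr)
    assume "i \<noteq> j"
    then have "u ! i \<noteq> u ! j" using part(2) that nth_eq_iff_index_eq by blast
    then have "u ! i \<inter> u ! j = {}"
      using part(1) that unfolding partition_on_def disjoint_def by (meson nth_mem)
    then show False using that by auto
  qed
  have h: "h x = i" if "i < length u" "x \<in> u ! i" for i x
    unfolding h_def using that uniq by (intro the_equality) auto
  have sub: "u ! i \<subseteq> {1..n}" "u ! i \<noteq> {}" if "i < length u" for i
    using part(1) that unfolding partition_on_def by (auto dest!: nth_mem[of i u])
  have ex: "\<exists>i<length u. x \<in> u ! i" if "x \<in> {1..n}" for x
    using part(1) that unfolding partition_on_def by (metis Union_iff in_set_conv_nth)
  have iff: "x \<in> u ! i \<longleftrightarrow> x \<in> {1..n} \<and> h x = i" if "i < length u" for i x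
    using that h sub ex by (metis subsetD)
  have image: "h ` {1..n} = {..<length u}"
  proof (intro equalityI subsetI)
    fix i assume "i \<in> {..<length u}"
    then have i: "i < length u" by simp
    then obtain x where "x \<in> u ! i" using sub(2) by blast
    then show "i \<in> h ` {1..n}" using iff[OF i] by auto
  next
    fix i assume "i \<in> h ` {1..n}"
    then obtain x where "x \<in> {1..n}" "i = h x" by blast
    then show "i \<in> {..<length u}" using ex[of x] h by auto
  qed
  have "u = fibres h {1..n}"
  proof (rule nth_equalityI)
    show "length u = length (fibres h {1..n})" by (simp only: length_fibres image card_lessThan)
    fix i assume i: "i < length u"
    show "u ! i = fibres h {1..n} ! i" unfolding fibres_nth[OF image i] using iff[OF i] by blast
  qed
  moreover have "\<forall>i<length u. u ! i = {x\<in>{1..n}. h x = i}"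
    using iff by (intro allI impI set_eqI) simp
  ultimately show ?thesis using that image by metis
qed

text \<open>Both \<open>theta\<close> and the first runs in \<open>subdivision_cells\<close> are
  computed from these unions.\<close>

definition prefix_unions :: "'a set list \<Rightarrow> 'a set set" where
  "prefix_unions u = {\<Union> (set (take i u)) | i. 1 \<le> i \<and> i < length u}"

text \<open>The element \<open>b\<close> excludes the largest value of \<open>f\<close>, whose
  sublevel set is the union of the full list.\<close>

lemma prefix_unions_fibres:
  assumes "finite X"
  shows "prefix_unions (fibres f X) = {{x\<in>X. f x \<le> f a} | a. a \<in> X \<and> (\<exists>b\<in>X. f a < f b)}"
proof -
  define cs where "cs = sorted_list_of_set (f ` X)"
  have cs: "sorted_wrt (<) cs" "set cs = f ` X" using assms by (auto simp: cs_def)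
  have less_iff: "cs ! i < cs ! j \<longleftrightarrow> i < j" if "i < length cs" "j < length cs" for i j
    using cs(1) that by (metis linorder_neqE_nat order_less_asym order_less_irrefl sorted_wrt_nth_less)
  have fib: "fibres f X = map (\<lambda>c. {x\<in>X. f x = c}) cs" by (simp add: fibres_def cs_def)
  have pre: "\<Union> (set (take (Suc k) (fibres f X))) = {x\<in>X. f x \<le> cs ! k}" if k: "k < length cs" for k
  proof -
    have "c \<in> set (take (Suc k) cs) \<longleftrightarrow> c \<le> cs ! k" if "c \<in> f ` X" for c
    proof -
      obtain j where j: "j < length cs" "cs ! j = c" using \<open>c \<in> f ` X\<close> cs(2) by (metis in_set_conv_nth)
      have dist: "distinct cs" using cs(1) by (simp add: strict_sorted_iff)
      have "c \<in> set (take (Suc k) cs) \<longleftrightarrow> j \<le> k"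
      proof
        assume "c \<in> set (take (Suc k) cs)"
        then obtain i where "i < Suc k" "i < length cs" "cs ! i = c" by (auto simp: in_set_conv_nth)
        then show "j \<le> k" using j dist nth_eq_iff_index_eq by (metis less_Suc_eq_le)
      next
        assume "j \<le> k"
        then show "c \<in> set (take (Suc k) cs)" using j by (auto simp: in_set_conv_nth intro!: exI[of _ j])
      qed
      then show ?thesis using less_iff[OF k j(1)] j by (simp add: not_less[symmetric])
    qed
    then show ?thesis unfolding fib by (auto simp: take_map)
  qed
  show ?thesis
  proof (intro equalityI subsetI)
    fix P assume "P \<in> prefix_unions (fibres f X)"
    then obtain k where k: "P = \<Union> (set (take (Suc k) (fibres f X)))" "Suc k < length cs"
      unfolding prefix_unions_def by (auto simp: fib) (metis Suc_le_D)
    obtain a where a: "a \<in> X" "f a = cs ! k"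
      using k(2) cs(2) by (metis Suc_lessD image_iff nth_mem)
    obtain b where b: "b \<in> X" "f b = cs ! Suc k"
      using k(2) cs(2) by (metis image_iff nth_mem)
    have "f a < f b" using a b less_iff k(2) by simp
    moreover have "P = {x\<in>X. f x \<le> f a}" using pre[of k] k a(2) by simp
    ultimately show "P \<in> {{x\<in>X. f x \<le> f a} | a. a \<in> X \<and> (\<exists>b\<in>X. f a < f b)}"
      using a(1) b(1) by blast
  next
    fix P assume "P \<in> {{x\<in>X. f x \<le> f a} | a. a \<in> X \<and> (\<exists>b\<in>X. f a < f b)}"
    then obtain a b where ab: "P = {x\<in>X. f x \<le> f a}" "a \<in> X" "b \<in> X" "f a < f b" by auto
    have "f a \<in> set cs" "f b \<in> set cs" using ab cs(2) by auto
    then obtain i j where ij: "i < length cs" "f a = cs ! i" "j < length cs" "f b = cs ! j"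
      by (metis in_set_conv_nth)
    then have "Suc i < length cs" using ab(4) less_iff by force
    then show "P \<in> prefix_unions (fibres f X)"
      using pre[OF ij(1)] ab(1) ij(2) unfolding prefix_unions_def by (auto simp: fib)
  qed
qed

section \<open>Minimal vertices and 132 patterns\<close>

lemma sorted_wrt_concat_fibres:
  assumes "sorted_wrt (<) cs" "finite X"
  shows "sorted_wrt (\<lambda>x y. f x < f y \<or> f x = f y \<and> x < y)
    (concat (map (\<lambda>c. sorted_list_of_set {x\<in>X. f x = c}) cs))"
  using assms(1)
proof (induction cs)
  case (Cons c cs)
  have "sorted_wrt (<) (sorted_list_of_set {x\<in>X. f x = c})" by simp
  then have "sorted_wrt (\<lambda>x y. f x < f y \<or> f x = f y \<and> x < y) (sorted_list_of_set {x\<in>X. f x = c})"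
    by (rule sorted_wrt_mono_rel[rotated]) (use assms(2) in auto)
  then show ?case using Cons assms(2) by (auto simp: sorted_wrt_append)
qed auto

lemma sorted_wrt_irrefl_distinct: "sorted_wrt r v \<Longrightarrow> (\<And>x. \<not> r x x) \<Longrightarrow> distinct v"
  by (induction v) auto

text \<open>Ties are written in increasing order, so for \<open>x < y\<close> a tie is a
  non-inversion. Hence \<open>g x \<le> g y\<close> in \<open>separated\<close> says that
  \<open>x < y\<close> is a non-inversion of the minimal vertex for \<open>g\<close>, while
  \<open>f x < f y\<close> says this of the maximal vertex for \<open>f\<close>.\<close>

lemma P_min_fibres:
  assumes "finite X"
  shows "set (P_min (fibres f X)) = X" "distinct (P_min (fibres f X))"
    "x \<in> X \<Longrightarrow> y \<in> X \<Longrightarrow> prec (P_min (fibres f X)) x y \<longleftrightarrow> f x < f y \<or> f x = f y \<and> x < y"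
proof -
  let ?v = "P_min (fibres f X)"
  have v: "?v = concat (map (\<lambda>c. sorted_list_of_set {x\<in>X. f x = c}) (sorted_list_of_set (f ` X)))"
    by (simp add: P_min_def fibres_def comp_def)
  have sorted: "sorted_wrt (\<lambda>x y. f x < f y \<or> f x = f y \<and> x < y) ?v"
    unfolding v by (rule sorted_wrt_concat_fibres) (use assms in auto)
  show set: "set ?v = X" unfolding v using assms by auto
  show "distinct ?v" using sorted_wrt_irrefl_distinct[OF sorted] by auto
  show "prec ?v x y \<longleftrightarrow> f x < f y \<or> f x = f y \<and> x < y" if "x \<in> X" "y \<in> X"
    using prec_sorted_wrt[OF sorted] prec_linear[of x ?v y] that set
    by (metis less_irrefl not_less_iff_gr_or_eq prec_sorted_wrt[OF sorted])
qed

lemma prec_concat: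
  "j < k \<Longrightarrow> k < length rs \<Longrightarrow> x \<in> set (rs ! j) \<Longrightarrow> y \<in> set (rs ! k) \<Longrightarrow> prec (concat rs) x y"
proof (induction rs arbitrary: j k)
  case (Cons R rs)
  show ?case
  proof (cases j)
    case 0
    then have "y \<in> set (concat rs)" using Cons.prems by (auto simp: nth_Cons split: nat.splits)
    then show ?thesis using 0 Cons.prems by (simp add: prec_append)
  next
    case (Suc j')
    then show ?thesis using Cons.prems Cons.IH[of j' "k - 1"] by (auto simp: prec_append nth_Cons split: nat.splits)
  qed
qed auto

lemma prec_concat_same:
  "j < length rs \<Longrightarrow> prec (rs ! j) x y \<Longrightarrow> prec (concat rs) x y"
  by (induction rs arbitrary: j) (auto simp: prec_append nth_Cons split: nat.splits)

text \<open>A discrete intermediate value argument: on the way from \<open>x\<close> to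
  \<open>z\<close> some adjacent pair of letters steps over \<open>y\<close>.\<close>

lemma prec_ascent:
  fixes v :: "nat list"
  assumes "prec v x z" "x \<le> y" "y < z"
  shows "\<exists>us a b ws. v = us @ a # b # ws \<and> a \<le> y \<and> y < b \<and> (b = z \<or> prec v b z)"
  using assms
proof (induction v arbitrary: x)
  case (Cons c v)
  have rec: ?case if "prec v x' z" "x' \<le> y" for x'
  proof -
    have "\<exists>us a b ws. v = us @ a # b # ws \<and> a \<le> y \<and> y < b \<and> (b = z \<or> prec v b z)"
      using that Cons.prems(3) by (rule Cons.IH)
    then obtain us a b ws where "v = us @ a # b # ws" "a \<le> y" "y < b" "b = z \<or> prec v b z"
      by blast
    then show ?thesis by (intro exI[of _ "c # us"] exI[of _ a] exI[of _ b] exI[of _ ws]) auto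
  qed
  show ?case
  proof (cases "prec v x z")
    case True
    then show ?thesis using rec Cons.prems by blast
  next
    case False
    then have x: "x = c" "z \<in> set v" using Cons.prems(1) by auto
    then obtain d v' where v: "v = d # v'" by (cases v) auto
    show ?thesis
    proof (cases "y < d")
      case True
      then show ?thesis using x v Cons.prems
        by (intro exI[of _ "[]"] exI[of _ c] exI[of _ d] exI[of _ v']) auto
    next
      case False
      then have "prec v d z" using v x Cons.prems(3) by auto
      then show ?thesis using rec False by auto
    qed
  qed
qed auto

text \<open>In a 132 pattern the ascent from \<open>x\<close> to \<open>z\<close> can be replaced by
  an adjacent one over \<open>y\<close>, by \<open>prec_ascent\<close>. Its two letters lie in one
  ascending run, and \<open>y\<close>, which comes after the larger of them, lies in a later
  run.\<close>

lemma associahedral_iff: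
  assumes "distinct v"
  shows "associahedral v \<longleftrightarrow> (\<forall>x y z. x < y \<longrightarrow> y < z \<longrightarrow> prec v x z \<longrightarrow> \<not> prec v z y)"
proof -
  define rs where "rs = runs_wrt (<) v"
  have v: "concat rs = v" and sorted: "\<forall>R\<in>set rs. sorted_wrt (<) R"
    by (auto simp: rs_def concat_runs_wrt sorted_wrt_runs_wrt)
  have asc: "asc_partition v = map set rs" by (simp add: asc_partition_def rs_def)
  have same: "prec v x z" if "j < length rs" "x \<in> set (rs ! j)" "z \<in> set (rs ! j)" "x < z" for j x z
  proof -
    have "\<not> prec (rs ! j) z x" using prec_sorted_wrt[of "(<)" "rs ! j" z x] sorted that by auto
    then have "prec (rs ! j) x z" using prec_linear[OF that(2,3)] that(4) by auto
    then show ?thesis using prec_concat_same[OF that(1)] v by simp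
  qed
  have later: "prec v x y" if "j < k" "k < length rs" "x \<in> set (rs ! j)" "y \<in> set (rs ! k)" for j k x y
    using prec_concat[OF that] v by simp
  have "has_degeneracy (asc_partition v) \<longleftrightarrow> (\<exists>x y z. x < y \<and> y < z \<and> prec v x z \<and> prec v z y)"
  proof
    assume "has_degeneracy (asc_partition v)"
    then obtain j k x y z where *: "0 < k" "j + k < length rs" "x \<in> set (rs ! j)" "z \<in> set (rs ! j)"
      "y \<in> set (rs ! (j + k))" "x < y" "y < z"
      by (auto simp: has_degeneracy_def asc)
    then have "prec v x z" "prec v z y" using same[of j x z] later[of j "j + k" z y] by auto
    then show "\<exists>x y z. x < y \<and> y < z \<and> prec v x z \<and> prec v z y" using * by blast
  next
    assume "\<exists>x y z. x < y \<and> y < z \<and> prec v x z \<and> prec v z y"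
    then obtain x y z where xyz: "x < y" "y < z" "prec v x z" "prec v z y" by blast
    then obtain us a b ws where ab: "v = us @ a # b # ws" "a \<le> y" "y < b" "b = z \<or> prec v b z"
      using prec_ascent[of v x z y] by auto
    have b_y: "prec v b y" using ab(4) xyz(4) prec_trans[OF assms] by blast
    have "prec v a b" using ab(1) by (auto simp: prec_append)
    then have "a \<noteq> y" using b_y prec_asym[OF assms] by blast
    then have "a < y" using ab(2) by simp
    have "\<exists>R\<in>set rs. a \<in> set R \<and> b \<in> set R"
      unfolding rs_def ab(1) using ab(2,3) by (intro runs_wrt_adjacent) simp
    then obtain j where j: "j < length rs" "a \<in> set (rs ! j)" "b \<in> set (rs ! j)"
      by (metis in_set_conv_nth)
    have "y \<in> set (concat rs)" using prec_in_set[OF b_y] v by simp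
    then obtain R where "R \<in> set rs" "y \<in> set R" by auto
    then obtain k where k: "k < length rs" "y \<in> set (rs ! k)" by (metis in_set_conv_nth)
    have not: "\<not> prec v y b" using b_y prec_asym[OF assms] by blast
    have "k \<noteq> j" using same[of j y b] not j k ab(3) by auto
    moreover have "\<not> k < j" using later[of k j y b] not j k by auto
    ultimately have "j < k" by simp
    then show "has_degeneracy (asc_partition v)"
      unfolding has_degeneracy_def asc
      using j k \<open>a < y\<close> ab(3)
      by (intro exI[of _ j] exI[of _ "k - j"] exI[of _ a] exI[of _ y] exI[of _ b]) auto
  qed
  then show ?thesis unfolding associahedral_def by blast
qed

section \<open>The projection\<close>

text \<open>The guard \<open>0 < s\<close> is there because truncated subtraction makes
  \<open>s - 1\<close> equal to \<open>s\<close> for \<open>s = 0\<close>.\<close>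

lemma max_runs_iff:
  "R \<in> max_runs A \<longleftrightarrow> (\<exists>s t. s \<le> t \<and> R = {s..t} \<and> R \<subseteq> A \<and> (0 < s \<longrightarrow> s - 1 \<notin> A) \<and> Suc t \<notin> A)"
proof
  assume R: "R \<in> max_runs A"
  then obtain s t where st: "s \<le> t" "R = {s..t}" by (auto simp: max_runs_def nat_interval_def)
  have sub: "{s..t} \<subseteq> A" using R st by (auto simp: max_runs_def)
  have max: "{s'..t'} = {s..t}" if "s' \<le> t'" "{s..t} \<subseteq> {s'..t'}" "{s'..t'} \<subseteq> A" for s' t'
    using R st that unfolding max_runs_def nat_interval_def by blast
  have "Suc t \<notin> A"
  proof
    assume "Suc t \<in> A"
    then have "{s..Suc t} = {s..t}" using sub st by (intro max) (auto simp: le_Suc_eq)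
    then show False using st by (metis atLeastAtMost_iff le_SucI le_refl not_less_eq_eq)
  qed
  moreover have "s - 1 \<notin> A" if "0 < s"
  proof
    assume "s - 1 \<in> A"
    have "{s - 1..t} = insert (s - 1) {s..t}" using that st by auto
    then have "{s - 1..t} = {s..t}" using sub st \<open>s - 1 \<in> A\<close> by (intro max) auto
    then have "s - 1 \<in> {s..t}" using st by (metis atLeastAtMost_iff diff_le_self le_refl le_trans)
    then have "s \<le> s - 1" unfolding atLeastAtMost_iff by simp
    then show False using that by linarith
  qed
  ultimately show "\<exists>s t. s \<le> t \<and> R = {s..t} \<and> R \<subseteq> A \<and> (0 < s \<longrightarrow> s - 1 \<notin> A) \<and> Suc t \<notin> A"
    using st sub by blast
next
  assume "\<exists>s t. s \<le> t \<and> R = {s..t} \<and> R \<subseteq> A \<and> (0 < s \<longrightarrow> s - 1 \<notin> A) \<and> Suc t \<notin> A"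
  then obtain s t where st: "s \<le> t" "R = {s..t}" "R \<subseteq> A" "0 < s \<longrightarrow> s - 1 \<notin> A" "Suc t \<notin> A" by blast
  have "{s'..t'} = {s..t}" if "s' \<le> t'" "{s..t} \<subseteq> {s'..t'}" "{s'..t'} \<subseteq> A" for s' t'
  proof -
    have le: "s' \<le> s" "t \<le> t'" using that st(1) by auto
    have "\<not> s' < s"
    proof
      assume "s' < s"
      then have "s - 1 \<in> {s'..t'}" using le st(1) by auto
      then show False using st(4) that(3) \<open>s' < s\<close> by auto
    qed
    moreover have "\<not> t < t'"
    proof
      assume "t < t'"
      then have "Suc t \<in> {s'..t'}" using le st(1) by auto
      then show False using st(5) that(3) by auto
    qed
    ultimately show ?thesis using le by simp
  qed
  then show "R \<in> max_runs A" using st unfolding max_runs_def nat_interval_def by blast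
qed

lemma max_run_superset:
  assumes "finite A" "i \<le> k" "{i..k} \<subseteq> A"
  shows "\<exists>R\<in>max_runs A. {i..k} \<subseteq> R"
proof -
  define \<I> where "\<I> = {R. nat_interval R \<and> {i..k} \<subseteq> R \<and> R \<subseteq> A}"
  have "finite \<I>" by (rule finite_subset[of _ "Pow A"]) (auto simp: \<I>_def assms(1))
  moreover have "{i..k} \<in> \<I>" using assms by (auto simp: \<I>_def nat_interval_def)
  ultimately obtain R where R: "R \<in> \<I>" "\<And>R'. R' \<in> \<I> \<Longrightarrow> R \<subseteq> R' \<Longrightarrow> R = R'"
    using finite_has_maximal[of \<I>] by blast
  then have "R \<in> max_runs A" by (auto simp: max_runs_def \<I>_def)
  then show ?thesis using R(1) by (auto simp: \<I>_def)
qed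

lemma theta_prefix_unions: "theta u = \<Union> (max_runs ` prefix_unions u)"
  by (auto simp: theta_def prefix_unions_def)

lemma obtain_max_on:
  fixes f :: "nat \<Rightarrow> nat"
  assumes "s \<le> t"
  obtains x where "x \<in> {s..t}" "\<And>y. y \<in> {s..t} \<Longrightarrow> f y \<le> f x"
proof -
  have "Max (f ` {s..t}) \<in> f ` {s..t}" using assms by (intro Max_in) auto
  then obtain x where x: "x \<in> {s..t}" "f x = Max (f ` {s..t})" by (metis imageE)
  have "f y \<le> f x" if "y \<in> {s..t}" for y using that x(2) by simp
  then show ?thesis using that x(1) by blast
qed

text \<open>The lowest level whose sublevel set contains \<open>{s..t}\<close> is the maximum of
  \<open>f\<close> on it, and at this level it is a maximal run exactly if its neighbours have
  larger values. The guards \<open>1 < s\<close> and \<open>t < n\<close> tell which neighbours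
  exist.\<close>

lemma theta_fibres_iff:
  "I \<in> theta (fibres f {1..n}) \<longleftrightarrow> (\<exists>s t. I = {s..t} \<and> 1 \<le> s \<and> s \<le> t \<and> t \<le> n \<and> {s..t} \<noteq> {1..n} \<and>
     (\<forall>x\<in>{s..t}. (1 < s \<longrightarrow> f x < f (s - 1)) \<and> (t < n \<longrightarrow> f x < f (Suc t))))" (is "_ \<longleftrightarrow> ?rhs")
proof
  assume "I \<in> theta (fibres f {1..n})"
  then obtain a b where a: "I \<in> max_runs {x\<in>{1..n}. f x \<le> f a}" "a \<in> {1..n}" "b \<in> {1..n}" "f a < f b"
    unfolding theta_prefix_unions prefix_unions_fibres[OF finite_atLeastAtMost] by auto
  then obtain s t where st: "s \<le> t" "I = {s..t}" "{s..t} \<subseteq> {x\<in>{1..n}. f x \<le> f a}"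
    "0 < s \<longrightarrow> s - 1 \<notin> {x\<in>{1..n}. f x \<le> f a}" "Suc t \<notin> {x\<in>{1..n}. f x \<le> f a}"
    unfolding max_runs_iff by blast
  have in_set: "s \<in> {s..t}" "t \<in> {s..t}" using st(1) by auto
  then have "1 \<le> s" "t \<le> n" using subsetD[OF st(3)] by simp_all
  moreover have "b \<notin> {s..t}" using st(3) a(4) by auto
  moreover have "(1 < s \<longrightarrow> f x < f (s - 1)) \<and> (t < n \<longrightarrow> f x < f (Suc t))"
    if "x \<in> {s..t}" for x
  proof -
    have "f x \<le> f a" using that st(3) by auto
    moreover have "1 < s \<longrightarrow> f a < f (s - 1)" using st(1,4) \<open>t \<le> n\<close> by (auto simp: not_le)
    moreover have "t < n \<longrightarrow> f a < f (Suc t)" using st(5) by (auto simp: not_le)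
    ultimately show ?thesis by auto
  qed
  ultimately show ?rhs using st(1,2) a(3) by blast
next
  assume ?rhs
  then obtain s t where st: "I = {s..t}" "1 \<le> s" "s \<le> t" "t \<le> n" "{s..t} \<noteq> {1..n}"
    "\<And>x. x \<in> {s..t} \<Longrightarrow> (1 < s \<longrightarrow> f x < f (s - 1)) \<and> (t < n \<longrightarrow> f x < f (Suc t))" by blast
  obtain a where a: "a \<in> {s..t}" and le: "\<And>x. x \<in> {s..t} \<Longrightarrow> f x \<le> f a"
    by (rule obtain_max_on[OF st(3), of f]) blast
  have "1 < s \<or> t < n" using st by auto
  then have "\<exists>b\<in>{1..n}. f a < f b"
  proof
    assume "1 < s"
    then show ?thesis using st(2-4) st(6)[OF a] by (intro bexI[of _ "s - 1"]) auto
  next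
    assume "t < n"
    then show ?thesis using st(6)[OF a] by (intro bexI[of _ "Suc t"]) auto
  qed
  moreover have "I \<in> max_runs {x\<in>{1..n}. f x \<le> f a}"
    unfolding max_runs_iff
  proof (intro exI conjI)
    show "I \<subseteq> {x\<in>{1..n}. f x \<le> f a}" using st(1,2,4) le by auto
    show "0 < s \<longrightarrow> s - 1 \<notin> {x\<in>{1..n}. f x \<le> f a}" using st(6)[OF a] by auto
    show "Suc t \<notin> {x\<in>{1..n}. f x \<le> f a}" using st(6)[OF a] by auto
  qed (use st in auto)
  moreover have "a \<in> {1..n}" using a st by auto
  ultimately show "I \<in> theta (fibres f {1..n})"
    unfolding theta_prefix_unions prefix_unions_fibres[OF finite_atLeastAtMost] by blast
qed

text \<open>The bracket is the maximal run around \<open>{i..k}\<close> among the elements strictly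
  below \<open>y\<close>; its neighbours have value at least \<open>f y\<close>.\<close>

lemma theta_fibres_superset:
  assumes "1 \<le> i" "i \<le> k" "k \<le> n" "y \<in> {1..n}" "\<And>z. z \<in> {i..k} \<Longrightarrow> f z < f y"
  shows "\<exists>I\<in>theta (fibres f {1..n}). {i..k} \<subseteq> I \<and> y \<notin> I"
proof -
  let ?A = "{x\<in>{1..n}. f x < f y}"
  have "{i..k} \<subseteq> ?A" using assms by auto
  then obtain R where R: "R \<in> max_runs ?A" "{i..k} \<subseteq> R" using max_run_superset[of ?A i k] assms(2) by auto
  then obtain s t where st: "s \<le> t" "R = {s..t}" "{s..t} \<subseteq> ?A" "0 < s \<longrightarrow> s - 1 \<notin> ?A" "Suc t \<notin> ?A"
    unfolding max_runs_iff by blast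
  have in_set: "s \<in> {s..t}" "t \<in> {s..t}" using st(1) by auto
  then have bounds: "1 \<le> s" "t \<le> n" using subsetD[OF st(3)] by simp_all
  have y: "y \<notin> {s..t}" using st(3) by auto
  moreover have "(1 < s \<longrightarrow> f x < f (s - 1)) \<and> (t < n \<longrightarrow> f x < f (Suc t))"
    if "x \<in> {s..t}" for x
  proof -
    have "f x < f y" using that st(3) by auto
    moreover have "1 < s \<longrightarrow> f y \<le> f (s - 1)" using st(1,4) bounds by (auto simp: not_less)
    moreover have "t < n \<longrightarrow> f y \<le> f (Suc t)" using st(5) by (auto simp: not_less)
    ultimately show ?thesis by auto
  qed
  ultimately have "{s..t} \<in> theta (fibres f {1..n})"
    unfolding theta_fibres_iff using st(1) bounds assms(4) by blast
  then show ?thesis using R(2) y st(2) by blast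
qed

lemma K_face_theta: "K_face n (theta (fibres f {1..n}))"
  unfolding K_face_def
proof (intro conjI ballI)
  fix I assume "I \<in> theta (fibres f {1..n})"
  then show "nat_interval I" "I \<subset> {1..n}"
    unfolding theta_fibres_iff nat_interval_def by auto
next
  \<comment> \<open>If the brackets cross or touch, \<open>s' - 1\<close> lies in the first and
    \<open>Suc t\<close> in the second, and each of the two would need a smaller value than the
    other.\<close>
  have key: "{s..t} \<subseteq> {s'..t'} \<or> {s'..t'} \<subseteq> {s..t} \<or> Suc t < s'"
    if I: "{s..t} \<in> theta (fibres f {1..n})" and J: "{s'..t'} \<in> theta (fibres f {1..n})" and "s \<le> s'"
      "s \<le> t" "s' \<le> t'" for s t s' t'
  proof (rule ccontr)
    assume *: "\<not> ?thesis"
    then have lt: "s < s'" "t < t'" "s' \<le> Suc t" using \<open>s \<le> s'\<close> \<open>s \<le> t\<close> \<open>s' \<le> t'\<close> by auto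
    have I': "1 \<le> s" "\<And>x. x \<in> {s..t} \<Longrightarrow> t < n \<Longrightarrow> f x < f (Suc t)"
      using I \<open>s \<le> t\<close> unfolding theta_fibres_iff by (auto simp: Icc_eq_Icc)
    have J': "t' \<le> n" "\<And>x. x \<in> {s'..t'} \<Longrightarrow> 1 < s' \<Longrightarrow> f x < f (s' - 1)"
      using J \<open>s' \<le> t'\<close> unfolding theta_fibres_iff by (auto simp: Icc_eq_Icc)
    have "f (s' - 1) < f (Suc t)" 
    proof (rule I'(2))
      show "s' - 1 \<in> {s..t}" "t < n" using lt J'(1) by auto
    qed
    moreover have "f (Suc t) < f (s' - 1)" 
    proof (rule J'(2))
      show "Suc t \<in> {s'..t'}" "1 < s'" using lt I'(1) by auto
    qed
    ultimately show False by simp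
  qed
  have gap: "\<not> nat_interval ({s..t} \<union> {s'..t'})" if "Suc t < s'" "s \<le> t" "s' \<le> t'" for s t s' t' :: nat
  proof
    assume "nat_interval ({s..t} \<union> {s'..t'})"
    then obtain p q where pq: "{s..t} \<union> {s'..t'} = {p..q}" by (auto simp: nat_interval_def)
    have "s \<in> {p..q}" "s' \<in> {p..q}" unfolding pq[symmetric] using that by auto
    then have "Suc t \<in> {p..q}" using that by auto
    then show False unfolding pq[symmetric] using that by auto
  qed
  fix I J assume IJ: "I \<in> theta (fibres f {1..n})" "J \<in> theta (fibres f {1..n})"
  then obtain s t s' t' where st: "I = {s..t}" "s \<le> t" "J = {s'..t'}" "s' \<le> t'"
    unfolding theta_fibres_iff by metis
  show "I \<subseteq> J \<or> J \<subseteq> I \<or> I \<inter> J = {} \<and> \<not> nat_interval (I \<union> J)"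
  proof (cases "s \<le> s'")
    case True
    then show ?thesis using key[of s t s' t'] gap[of t s' s t'] IJ st by auto
  next
    case False
    then show ?thesis using key[of s' t' s t] gap[of t' s s' t] IJ st by (auto simp: Un_commute)
  qed
qed

lemma vertex_face_obtain:
  assumes "v \<in> permutations_of_set {1..n}"
  obtains h where "vertex_face v = fibres h {1..n}"
    "\<And>x y. x \<in> {1..n} \<Longrightarrow> y \<in> {1..n} \<Longrightarrow> prec v x y \<longleftrightarrow> h x < h y"
proof -
  have v: "set v = {1..n}" "distinct v" using assms by (auto simp: permutations_of_set_def)
  have "P_face n (vertex_face v)"
    using v by (auto simp: P_face_def vertex_face_def partition_on_def distinct_map disjoint_def)
  then obtain h where h: "vertex_face v = fibres h {1..n}" "h ` {1..n} = {..<length (vertex_face v)}"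
    "\<forall>i<length (vertex_face v). vertex_face v ! i = {x\<in>{1..n}. h x = i}"
    by (rule P_face_obtain)
  have hv: "h (v ! i) = i" if "i < length v" for i
  proof -
    have "v ! i \<in> vertex_face v ! i" "i < length (vertex_face v)"
      using that by (simp_all add: vertex_face_def)
    then show ?thesis using h(3) by blast
  qed
  have imp: "prec v x y" if "h x < h y" and xy: "x \<in> {1..n}" "y \<in> {1..n}" for x y
  proof -
    have "x \<in> set v" "y \<in> set v" using xy v by auto
    then obtain i j where "i < length v" "x = v ! i" "j < length v" "y = v ! j"
      by (metis in_set_conv_nth)
    then show ?thesis using that(1) hv prec_nth[of i j v] by simp
  qed
  have "prec v x y \<longleftrightarrow> h x < h y" if xy: "x \<in> {1..n}" "y \<in> {1..n}" for x y
  proof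
    assume p: "prec v x y"
    have "x \<in> set v" "y \<in> set v" using xy v by auto
    then obtain i j where "i < length v" "x = v ! i" "j < length v" "y = v ! j"
      by (metis in_set_conv_nth)
    moreover have "x \<noteq> y" using p prec_irrefl v by metis
    ultimately have "h x \<noteq> h y" using hv by auto
    moreover have "\<not> h y < h x" using imp[of y x] xy p prec_asym v by metis
    ultimately show "h x < h y" by simp
  qed (use imp xy in simp)
  then show ?thesis using that h(1) by blast
qed

section \<open>Faces of the associahedron\<close>

lemma max_runs_unique:
  assumes "R \<in> max_runs A" "R' \<in> max_runs A" "m \<in> R" "m \<in> R'"
  shows "R = R'"
proof -
  have *: "s' \<le> s \<and> t \<le> t'"
    if "{s..t} \<subseteq> A" "m \<in> {s..t}" "m \<in> {s'..t'}" "0 < s' \<longrightarrow> s' - 1 \<notin> A" "Suc t' \<notin> A"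
    for s t s' t'
  proof (intro conjI; rule ccontr)
    assume "\<not> s' \<le> s"
    then have "s' - 1 \<in> {s..t}" "0 < s'" using that(2,3) by auto
    then show False using that(1,4) by blast
  next
    assume "\<not> t \<le> t'"
    then have "Suc t' \<in> {s..t}" using that(2,3) by auto
    then show False using that(1,5) by blast
  qed
  obtain s t where st: "R = {s..t}" "{s..t} \<subseteq> A" "0 < s \<longrightarrow> s - 1 \<notin> A" "Suc t \<notin> A"
    using assms(1) unfolding max_runs_iff by blast
  obtain s' t' where st': "R' = {s'..t'}" "{s'..t'} \<subseteq> A" "0 < s' \<longrightarrow> s' - 1 \<notin> A" "Suc t' \<notin> A"
    using assms(2) unfolding max_runs_iff by blast
  have "s' \<le> s \<and> t \<le> t'" using st st' assms(3,4) by (intro *) auto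
  moreover have "s \<le> s' \<and> t' \<le> t" using st st' assms(3,4) by (intro *) auto
  ultimately show ?thesis using st st' by simp
qed

lemma first_run_eqI: "R \<in> max_runs A \<Longrightarrow> Min A \<in> R \<Longrightarrow> first_run A = R"
  unfolding first_run_def by (rule the_equality) (use max_runs_unique in blast)+

lemma first_run:
  assumes "finite A" "A \<noteq> {}"
  shows "first_run A \<in> max_runs A" "Min A \<in> first_run A"
proof -
  obtain R where "R \<in> max_runs A" "{Min A..Min A} \<subseteq> R"
    using max_run_superset[of A "Min A" "Min A"] assms by auto
  then show "first_run A \<in> max_runs A" "Min A \<in> first_run A" using first_run_eqI by auto
qed

text \<open>In the tree, \<open>x\<close> is the gap between the leaves \<open>x\<close> and
  \<open>x + 1\<close>, and this is the vertex at which the gap sits. The interval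
  \<open>{1..n}\<close> is added as the root, which \<open>F\<close> does not list.\<close>

definition node :: "nat \<Rightarrow> nat set set \<Rightarrow> nat \<Rightarrow> nat set" where
  "node n F x = \<Inter> {I \<in> insert {1..n} F. x \<in> I}"

lemma K_face_interval:
  assumes "K_face n F" "I \<in> insert {1..n} F" "x \<in> I"
  obtains s t where "I = {s..t}" "1 \<le> s" "s \<le> t" "t \<le> n"
proof (cases "I = {1..n}")
  case True
  then show ?thesis using that[of 1 n] assms(3) by auto
next
  case False
  then have I: "nat_interval I" "I \<subset> {1..n}" using assms by (auto simp: K_face_def)
  then obtain s t where st: "s \<le> t" "I = {s..t}" by (auto simp: nat_interval_def)
  then have "s \<in> {1..n}" "t \<in> {1..n}" using I(2) by auto
  then show ?thesis using that st by simp
qed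

lemma K_face_nested:
  assumes "K_face n F" "I \<in> insert {1..n} F" "J \<in> insert {1..n} F"
  shows "I \<subseteq> J \<or> J \<subseteq> I \<or> I \<inter> J = {} \<and> \<not> nat_interval (I \<union> J)"
  using assms unfolding K_face_def by blast

text \<open>\<open>J\<close> contains a position next to \<open>{s..t}\<close>, so it is not inside
  that bracket. If the two were disjoint, their union would be an interval, which a face
  forbids.\<close>

lemma K_face_adjacent:
  assumes "K_face n F" "{s..t} \<in> insert {1..n} F" "J \<in> insert {1..n} F" "s \<le> t"
    "y \<in> J" "y = Suc t \<or> Suc y = s"
  shows "{s..t} \<subset> J"
proof -
  obtain p q where J: "J = {p..q}" "p \<le> q" using K_face_interval[OF assms(1,3,5)] by metis
  have y: "y \<notin> {s..t}" using assms(6) by auto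
  have "\<not> ({s..t} \<inter> J = {} \<and> \<not> nat_interval ({s..t} \<union> J))"
  proof
    assume *: "{s..t} \<inter> J = {} \<and> \<not> nat_interval ({s..t} \<union> J)"
    then have dis: "x \<notin> J" if "x \<in> {s..t}" for x using that by auto
    show False
    proof (cases "y = Suc t")
      case True
      have "p = Suc t" using dis[of t] J assms(4,5) True by auto
      then have "{s..t} \<union> J = {s..q}" using J assms(4) by auto
      then show False using * J assms(4) \<open>p = Suc t\<close> unfolding nat_interval_def by (metis le_SucI le_trans)
    next
      case False
      then have "Suc y = s" using assms(6) by simp
      then have "q = y" using dis[of s] J assms(4,5) by auto
      then have "{s..t} \<union> J = {p..t}" using J assms(4) \<open>Suc y = s\<close> by auto
      then show False using * J assms(4) \<open>q = y\<close> \<open>Suc y = s\<close> unfolding nat_interval_def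
        by (metis Suc_leD le_trans)
    qed
  qed
  then show ?thesis using K_face_nested[OF assms(1-3)] y assms(5) by blast
qed

lemma finite_K_face: "K_face n F \<Longrightarrow> finite F"
  by (rule finite_subset[of _ "Pow {1..n}"]) (auto simp: K_face_def)

text \<open>Brackets around a common \<open>x\<close> form a chain, so their intersection is one of
  them.\<close>

lemma node:
  assumes "K_face n F" "x \<in> {1..n}"
  shows "node n F x \<in> insert {1..n} F" "x \<in> node n F x"
    "\<And>I. I \<in> insert {1..n} F \<Longrightarrow> x \<in> I \<Longrightarrow> node n F x \<subseteq> I"
proof -
  let ?S = "{I \<in> insert {1..n} F. x \<in> I}"
  show "\<And>I. I \<in> insert {1..n} F \<Longrightarrow> x \<in> I \<Longrightarrow> node n F x \<subseteq> I" by (auto simp: node_def)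
  have "finite ?S" "{1..n} \<in> ?S" using finite_K_face[OF assms(1)] assms(2) by auto
  then obtain M where M: "M \<in> ?S" "\<And>I. I \<in> ?S \<Longrightarrow> I \<subseteq> M \<Longrightarrow> I = M"
    using finite_has_minimal[of ?S] by (metis (no_types, lifting) empty_iff)
  have "M \<subseteq> I" if "I \<in> ?S" for I
  proof -
    have "I \<subseteq> M \<or> M \<subseteq> I" using K_face_nested[OF assms(1), of I M] that M(1) by blast
    then show ?thesis using M(2)[OF that] by blast
  qed
  then have "node n F x = M" using M(1) by (auto simp: node_def)
  then show "node n F x \<in> insert {1..n} F" "x \<in> node n F x" using M(1) by auto
qed

definition lo :: "nat \<Rightarrow> nat set set \<Rightarrow> nat \<Rightarrow> nat" where "lo n F x = Min (node n F x)"
definition hi :: "nat \<Rightarrow> nat set set \<Rightarrow> nat \<Rightarrow> nat" where "hi n F x = Max (node n F x)"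

lemma node_interval:
  assumes "K_face n F" "x \<in> {1..n}"
  shows "node n F x = {lo n F x..hi n F x}" "1 \<le> lo n F x" "lo n F x \<le> x" "x \<le> hi n F x" "hi n F x \<le> n"
proof -
  obtain s t where st: "node n F x = {s..t}" "1 \<le> s" "s \<le> t" "t \<le> n"
    using K_face_interval[OF assms(1) node(1,2)[OF assms]] by blast
  then have "lo n F x = s" "hi n F x = t"
    by (auto simp: lo_def hi_def intro: Min_eqI Max_eqI)
  then show "node n F x = {lo n F x..hi n F x}" "1 \<le> lo n F x" "lo n F x \<le> x" "x \<le> hi n F x" "hi n F x \<le> n"
    using st node(2)[OF assms] by auto
qed

lemma mem_node_iff:
  "K_face n F \<Longrightarrow> x \<in> {1..n} \<Longrightarrow> y \<in> node n F x \<longleftrightarrow> lo n F x \<le> y \<and> y \<le> hi n F x"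
  using node_interval(1) by (metis atLeastAtMost_iff)

lemma node_mono:
  assumes "K_face n F" "x \<in> {1..n}" "y \<in> node n F x"
  shows "node n F y \<subseteq> node n F x"
proof -
  have "y \<in> {1..n}" using node(3)[OF assms(1,2), of "{1..n}"] assms by auto
  then show ?thesis using node[OF assms(1)] assms by blast
qed

text \<open>Comparing this key orders the intervals by decreasing left end, then increasing right end. This
  is the right-to-left postorder of the tree.\<close>

definition node_key :: "nat \<Rightarrow> nat set set \<Rightarrow> nat \<Rightarrow> nat" where
  "node_key n F x = (n - lo n F x) * Suc n + hi n F x"

lemma lex_key_less_iff:
  fixes a a' t t' n :: nat
  assumes "t \<le> n" "t' \<le> n"
  shows "a * Suc n + t < a' * Suc n + t' \<longleftrightarrow> a < a' \<or> a = a' \<and> t < t'"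
proof -
  have *: "a * Suc n + t < a' * Suc n + t'" if "a < a'" "t \<le> n" for a a' t t'
  proof -
    have "a * Suc n + t < Suc a * Suc n" using that by simp
    also have "\<dots> \<le> a' * Suc n" using that(1) by (intro mult_right_mono) auto
    finally show ?thesis by simp
  qed
  show ?thesis using *[of a a' t t'] *[of a' a t' t] assms by (cases a a' rule: linorder_cases) auto
qed

lemma node_key_less_iff:
  assumes "K_face n F" "x \<in> {1..n}" "y \<in> {1..n}"
  shows "node_key n F x < node_key n F y \<longleftrightarrow>
    lo n F y < lo n F x \<or> lo n F x = lo n F y \<and> hi n F x < hi n F y"
proof -
  note x = node_interval[OF assms(1,2)] and y = node_interval[OF assms(1,3)]
  have "n - lo n F x < n - lo n F y \<longleftrightarrow> lo n F y < lo n F x"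
    "n - lo n F x = n - lo n F y \<longleftrightarrow> lo n F x = lo n F y"
    using x(3) y(3) assms(2,3) by auto
  then show ?thesis using x(5) y(5) unfolding node_key_def by (subst lex_key_less_iff) auto
qed

lemma node_key_eq_iff:
  assumes "K_face n F" "x \<in> {1..n}" "y \<in> {1..n}"
  shows "node_key n F x = node_key n F y \<longleftrightarrow> node n F x = node n F y"
proof
  assume "node_key n F x = node_key n F y"
  then have "lo n F x = lo n F y \<and> hi n F x = hi n F y"
    using node_key_less_iff[OF assms] node_key_less_iff[OF assms(1,3,2)]
    by (metis less_irrefl linorder_neq_iff)
  then show "node n F x = node n F y" using node_interval(1)[OF assms(1)] assms(2,3) by metis
qed (simp add: node_key_def lo_def hi_def)

lemma node_key_mono:
  assumes "K_face n F" "x \<in> {1..n}" "y \<in> {1..n}" "node n F x \<subset> node n F y"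
  shows "node_key n F x < node_key n F y"
proof -
  note x = node_interval[OF assms(1,2)] and y = node_interval[OF assms(1,3)]
  have "lo n F y \<le> lo n F x" "hi n F x \<le> hi n F y"
    using assms(4) x(3,4) mem_node_iff[OF assms(1,2)] mem_node_iff[OF assms(1,3)]
    by (meson le_trans order_refl psubsetD)+
  moreover have "\<not> (lo n F x = lo n F y \<and> hi n F x = hi n F y)"
    using assms(4) x(1) y(1) by (metis psubset_eq)
  ultimately show ?thesis unfolding node_key_less_iff[OF assms(1-3)] by auto
qed

text \<open>If \<open>i\<close> is outside the node of \<open>j\<close>, it lies to the left of it,
  and the left ends decide the comparison. This describes the non-inversions of the minimal
  vertex.\<close>

lemma node_key_le_iff:
  assumes "K_face n F" "i \<in> {1..n}" "j \<in> {1..n}" "i < j"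
  shows "node_key n F i \<le> node_key n F j \<longleftrightarrow> i \<in> node n F j"
proof
  assume "i \<in> node n F j"
  then have "node n F i \<subseteq> node n F j" using node_mono assms by blast
  then show "node_key n F i \<le> node_key n F j"
    using node_key_mono[OF assms(1-3)] node_key_eq_iff[OF assms(1-3)] by (metis less_imp_le order_refl psubsetI)
next
  assume le: "node_key n F i \<le> node_key n F j"
  show "i \<in> node n F j"
  proof (rule ccontr)
    note x = node_interval[OF assms(1,2)] and y = node_interval[OF assms(1,3)]
    assume "i \<notin> node n F j"
    then have "i < lo n F j" using y(4) assms(4) mem_node_iff[OF assms(1,3)] by simp
    then have "lo n F i < lo n F j" using x(3) by linarith
    then show False using le node_key_less_iff[OF assms(1,3,2)] by simp
  qed
qed

lemma avoids132_node_key: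
  assumes "K_face n F"
  shows "avoids132 (node_key n F) {1..n}"
  unfolding avoids132_def
proof (intro ballI impI)
  fix x y z assume *: "x \<in> {1..n}" "y \<in> {1..n}" "z \<in> {1..n}" "x < y" "y < z"
    "node_key n F x \<le> node_key n F z"
  then have "x \<in> node n F z" using node_key_le_iff[OF assms, of x z] by simp
  then have "y \<in> node n F z"
    using node_interval(4)[OF assms *(3)] *(4,5) by (simp add: mem_node_iff[OF assms *(3)])
  then show "node_key n F y \<le> node_key n F z" using node_key_le_iff[OF assms, of y z] * by simp
qed

lemma node_key_adjacent:
  assumes "K_face n F" "{s..t} \<in> insert {1..n} F" "x \<in> {s..t}" "y \<in> {1..n}" "y = Suc t \<or> Suc y = s"
  shows "node n F x \<subset> node n F y" "node_key n F x < node_key n F y"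
proof -
  have "s \<le> t" using assms(3) by auto
  obtain s' t' where "{s..t} = {s'..t'}" "1 \<le> s'" "t' \<le> n" by (rule K_face_interval[OF assms(1-3)])
  then have x: "x \<in> {1..n}" using assms(3) by auto
  have "{s..t} \<subset> node n F y"
    using K_face_adjacent[OF assms(1,2) node(1)[OF assms(1,4)] \<open>s \<le> t\<close> node(2)[OF assms(1,4)] assms(5)] .
  moreover have "node n F x \<subseteq> {s..t}" using node(3)[OF assms(1) x] assms(2,3) by blast
  ultimately show "node n F x \<subset> node n F y" by blast
  then show "node_key n F x < node_key n F y" using node_key_mono[OF assms(1) x assms(4)] by blast
qed

text \<open>If the node of \<open>x\<close> stopped inside \<open>{s..t}\<close>, the position next
  to its end would lie in \<open>{s..t}\<close> and have a larger key.\<close>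

lemma node_of_max_key:
  assumes "K_face n F" "{s..t} \<subseteq> {1..n}" "x \<in> {s..t}" "node n F x \<subseteq> {s..t}"
    "\<And>y. y \<in> {s..t} \<Longrightarrow> node_key n F y \<le> node_key n F x"
  shows "node n F x = {s..t}"
proof -
  have x: "x \<in> {1..n}" using assms(2,3) by auto
  note nx = node_interval[OF assms(1) x]
  have mem: "{lo n F x..hi n F x} \<in> insert {1..n} F" "x \<in> {lo n F x..hi n F x}"
    using node(1,2)[OF assms(1) x] unfolding nx(1)[symmetric] by simp_all
  have adj: "y \<notin> {s..t}" if "y = Suc (hi n F x) \<or> Suc y = lo n F x" for y
  proof
    assume y: "y \<in> {s..t}"
    then have "node_key n F x < node_key n F y"
      using node_key_adjacent(2)[OF assms(1) mem _ that] assms(2) by blast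
    then show False using assms(5)[OF y] by simp
  qed
  have xst: "s \<le> x" "x \<le> t" using assms(3) by simp_all
  have "lo n F x \<le> s"
  proof (rule ccontr)
    assume "\<not> lo n F x \<le> s"
    then have "lo n F x - 1 \<in> {s..t}" unfolding atLeastAtMost_iff using nx(3) xst by linarith
    moreover have "Suc (lo n F x - 1) = lo n F x" using nx(2) by linarith
    ultimately show False using adj by blast
  qed
  moreover have "t \<le> hi n F x"
  proof (rule ccontr)
    assume "\<not> t \<le> hi n F x"
    then have "Suc (hi n F x) \<in> {s..t}" unfolding atLeastAtMost_iff using nx(4) xst by linarith
    then show False using adj by blast
  qed
  ultimately have "{s..t} \<subseteq> node n F x" by (auto simp: mem_node_iff[OF assms(1) x])
  then show ?thesis using assms(4) by blast
qed

text \<open>Every tree vertex owns a gap: an element of largest key in a bracket has this bracket as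
  its node.\<close>

lemma node_image:
  assumes "K_face n F" "1 \<le> n"
  shows "node n F ` {1..n} = insert {1..n} F"
proof (intro equalityI subsetI)
  fix I assume I: "I \<in> insert {1..n} F"
  then have "I \<noteq> {}" using assms by (auto simp: K_face_def nat_interval_def)
  then obtain x where "x \<in> I" by auto
  then obtain s t where st: "I = {s..t}" "1 \<le> s" "s \<le> t" "t \<le> n" by (rule K_face_interval[OF assms(1) I])
  obtain x where x: "x \<in> {s..t}" "\<And>y. y \<in> {s..t} \<Longrightarrow> node_key n F y \<le> node_key n F x"
    by (rule obtain_max_on[OF st(3), of "node_key n F"]) blast
  have xn: "x \<in> {1..n}" using x(1) st by auto
  then have "node n F x \<subseteq> {s..t}" using node(3)[OF assms(1) xn, of I] I st(1) x(1) by blast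
  then have "node n F x = I" using node_of_max_key[OF assms(1) _ x(1) _ x(2)] st by auto
  then show "I \<in> node n F ` {1..n}" using xn by blast
next
  fix I assume "I \<in> node n F ` {1..n}"
  then show "I \<in> insert {1..n} F" using node(1)[OF assms(1)] by blast
qed

text \<open>The neighbours of an interval in \<open>theta\<close> have larger keys than all its
  elements, whereas a node contains no key above its own. So the node of an element of largest key
  stays inside the interval, and by \<open>node_of_max_key\<close> it fills it.\<close>

lemma theta_node_key:
  assumes "K_face n F" "1 \<le> n"
  shows "theta (fibres (node_key n F) {1..n}) = F"
proof (intro equalityI subsetI)
  fix I assume "I \<in> F"
  then have I: "I \<in> insert {1..n} F" "I \<noteq> {1..n}" "I \<noteq> {}"
    using assms by (auto simp: K_face_def nat_interval_def)
  then obtain z where "z \<in> I" by auto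
  then obtain s t where st: "I = {s..t}" "1 \<le> s" "s \<le> t" "t \<le> n" by (rule K_face_interval[OF assms(1) I(1)])
  have "(1 < s \<longrightarrow> node_key n F x < node_key n F (s - 1)) \<and> (t < n \<longrightarrow> node_key n F x < node_key n F (Suc t))"
    if x: "x \<in> {s..t}" for x
  proof (intro conjI impI)
    show "node_key n F x < node_key n F (s - 1)" if "1 < s"
      by (rule node_key_adjacent(2)[OF assms(1) I(1)[unfolded st(1)] x]) (use st that in auto)
    show "node_key n F x < node_key n F (Suc t)" if "t < n"
      by (rule node_key_adjacent(2)[OF assms(1) I(1)[unfolded st(1)] x]) (use st that in auto)
  qed
  then show "I \<in> theta (fibres (node_key n F) {1..n})"
    unfolding theta_fibres_iff using st I(2) by blast
next
  fix I assume "I \<in> theta (fibres (node_key n F) {1..n})"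
  then obtain s t where st: "I = {s..t}" "1 \<le> s" "s \<le> t" "t \<le> n" "{s..t} \<noteq> {1..n}"
    and less: "\<And>x. x \<in> {s..t} \<Longrightarrow> (1 < s \<longrightarrow> node_key n F x < node_key n F (s - 1)) \<and>
      (t < n \<longrightarrow> node_key n F x < node_key n F (Suc t))"
    unfolding theta_fibres_iff by blast
  obtain x where x: "x \<in> {s..t}" "\<And>y. y \<in> {s..t} \<Longrightarrow> node_key n F y \<le> node_key n F x"
    by (rule obtain_max_on[OF st(3), of "node_key n F"]) blast
  have xn: "x \<in> {1..n}" using x(1) st by auto
  note nx = node_interval[OF assms(1) xn]
  have le: "node_key n F y \<le> node_key n F x" if y: "y \<in> node n F x" for y
  proof -
    have yn: "y \<in> {1..n}" using y nx(2,5) mem_node_iff[OF assms(1) xn] by simp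
    show ?thesis
      using node_mono[OF assms(1) xn y] node_key_mono[OF assms(1) yn xn] node_key_eq_iff[OF assms(1) yn xn]
      by (metis less_imp_le order_refl psubsetI)
  qed
  have "node n F x \<subseteq> {s..t}"
  proof -
    have "s \<le> lo n F x"
    proof (rule ccontr)
      assume *: "\<not> s \<le> lo n F x"
      then have "s - 1 \<in> node n F x" using nx(3,4) x(1) by (auto simp: mem_node_iff[OF assms(1) xn])
      then show False using le[of "s - 1"] less[OF x(1)] * nx(2) by auto
    qed
    moreover have "hi n F x \<le> t"
    proof (rule ccontr)
      assume *: "\<not> hi n F x \<le> t"
      then have "Suc t \<in> node n F x" using nx(3,4) x(1) by (auto simp: mem_node_iff[OF assms(1) xn])
      then show False using le[of "Suc t"] less[OF x(1)] * nx(5) by auto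
    qed
    ultimately show ?thesis by (auto simp: mem_node_iff[OF assms(1) xn])
  qed
  then have "node n F x = {s..t}" using node_of_max_key[OF assms(1) _ x(1) _ x(2)] st by auto
  then show "I \<in> F" using node(1)[OF assms(1) xn] st by auto
qed

lemma card_node_key:
  assumes "K_face n F" "1 \<le> n"
  shows "card (node_key n F ` {1..n}) = card F + 1"
proof -
  define \<phi> where "\<phi> I = (n - Min I) * Suc n + Max I" for I :: "nat set"
  have im: "node_key n F ` {1..n} = \<phi> ` node n F ` {1..n}"
    by (simp add: node_key_def lo_def hi_def \<phi>_def image_image)
  have "inj_on \<phi> (node n F ` {1..n})"
    using node_key_eq_iff[OF assms(1)] unfolding node_key_def lo_def hi_def \<phi>_def inj_on_def by blast
  then have "card (node_key n F ` {1..n}) = card (insert {1..n} F)"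
    unfolding im node_image[OF assms, symmetric] by (rule card_image)
  moreover have "{1..n} \<notin> F" using assms(1) by (auto simp: K_face_def)
  ultimately show ?thesis using finite_K_face[OF assms(1)] by simp
qed

lemma card_K_face_le: "K_face n F \<Longrightarrow> 1 \<le> n \<Longrightarrow> card F \<le> n - 1"
  using card_node_key[of n F] card_image_le[of "{1..n}" "node_key n F"] by simp

text \<open>\<open>covers F i j\<close> says that the vertices of \<open>F\<close> are forced to list \<open>i\<close> before \<open>j\<close>.\<close>

definition covers :: "nat set set \<Rightarrow> nat \<Rightarrow> nat \<Rightarrow> bool" where
  "covers F i j \<longleftrightarrow> (\<exists>s\<le>i. {s..<j} \<in> F)"

text \<open>The left end of the longest bracket that ends at \<open>j - 1\<close>. The default
  \<open>j\<close> makes \<open>lmax F j \<le> i\<close> equivalent to \<open>covers F i j\<close>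
  for \<open>i < j\<close>.\<close>

definition lmax :: "nat set set \<Rightarrow> nat \<Rightarrow> nat" where
  "lmax F j = (LEAST s. s = j \<or> {s..<j} \<in> F)"

lemma lmax_le: "lmax F j \<le> j"
  unfolding lmax_def by (rule Least_le) simp

lemma lmax_le_iff:
  assumes "i < j"
  shows "lmax F j \<le> i \<longleftrightarrow> covers F i j"
proof
  assume "lmax F j \<le> i"
  moreover have "lmax F j = j \<or> {lmax F j..<j} \<in> F"
    unfolding lmax_def by (rule LeastI[of _ j]) simp
  ultimately show "covers F i j" using assms by (auto simp: covers_def)
next
  assume "covers F i j"
  then obtain s where "s \<le> i" "{s..<j} \<in> F" by (auto simp: covers_def)
  then show "lmax F j \<le> i" using Least_le[of "\<lambda>s. s = j \<or> {s..<j} \<in> F" s]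
    unfolding lmax_def by linarith
qed

lemma covers_node_psubset:
  assumes "K_face n F" "i \<in> {1..n}" "j \<in> {1..n}" "i < j" "covers F i j"
  shows "node n F i \<subset> node n F j"
proof -
  obtain s where s: "s \<le> i" "{s..<j} \<in> F" using assms(5) by (auto simp: covers_def)
  have *: "{s..<j} = {s..j - 1}" using assms(3) by auto
  show ?thesis
    using node_key_adjacent(1)[OF assms(1), of s "j - 1" i j] s assms unfolding * by auto
qed

text \<open>A bracket that ends at \<open>i - 1\<close> is adjacent to \<open>i\<close>, so it is
  contained in every bracket around \<open>i\<close>, in particular in the longest one ending at
  \<open>j - 1\<close>. This makes \<open>covers\<close> transitive.\<close>

lemma lmax_closed:
  assumes "K_face n F" "lmax F j \<le> i" "i < j"
  shows "lmax F j \<le> lmax F i"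
proof (cases "lmax F i < i")
  case True
  obtain s where s: "s \<le> i" "{s..<j} \<in> F" "s = lmax F j"
    using assms(2,3) LeastI[of "\<lambda>s. s = j \<or> {s..<j} \<in> F" j] unfolding lmax_def[symmetric] by auto
  have r: "{lmax F i..<i} \<in> F"
    using True LeastI[of "\<lambda>s. s = i \<or> {s..<i} \<in> F" i] unfolding lmax_def[symmetric] by auto
  have *: "{s..<j} = {s..j - 1}" "{lmax F i..<i} = {lmax F i..i - 1}" using assms(3) True by auto
  show ?thesis
  proof (rule ccontr)
    assume "\<not> ?thesis"
    then have less: "lmax F i < s" using s by simp
    have "{lmax F i..i - 1} \<subset> {s..j - 1}"
      using K_face_adjacent[OF assms(1), of "lmax F i" "i - 1" "{s..j - 1}" i] s r * True assms(3) by auto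
    then have "lmax F i \<in> {s..j - 1}" using True by auto
    then show False using less by simp
  qed
next
  case False
  then show ?thesis using lmax_le[of F i] assms(2) by simp
qed

text \<open>The further a bracket before \<open>j\<close> reaches to the left, the later
  \<open>j\<close> comes; \<open>n\<close> only reverses the order. The maximal vertex is written
  with this key, ties in increasing order.\<close>

definition max_key :: "nat \<Rightarrow> nat set set \<Rightarrow> nat \<Rightarrow> nat" where
  "max_key n F j = n - lmax F j"

lemma max_key_le_iff:
  assumes "K_face n F" "i \<in> {1..n}" "j \<in> {1..n}" "i < j"
  shows "max_key n F i \<le> max_key n F j \<longleftrightarrow> covers F i j"
proof -
  have "max_key n F i \<le> max_key n F j \<longleftrightarrow> lmax F j \<le> lmax F i"
    using lmax_le[of F i] lmax_le[of F j] assms by (auto simp: max_key_def)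
  also have "\<dots> \<longleftrightarrow> lmax F j \<le> i"
    using lmax_closed[OF assms(1) _ assms(4)] lmax_le[of F i] by (meson le_trans)
  finally show ?thesis using lmax_le_iff[OF assms(4)] by simp
qed

section \<open>The extreme vertices of a face\<close>

lemma K_vertices_iff:
  assumes "K_face n F"
  shows "v \<in> K_vertices n F \<longleftrightarrow> v \<in> permutations_of_set {1..n} \<and>
    (\<forall>x y z. x < y \<longrightarrow> y < z \<longrightarrow> prec v x z \<longrightarrow> \<not> prec v z y) \<and>
    (\<forall>s t x. {s..t} \<in> F \<longrightarrow> x \<in> {s..t} \<longrightarrow> (1 < s \<longrightarrow> prec v x (s - 1)) \<and> (t < n \<longrightarrow> prec v x (Suc t)))"
    (is "_ \<longleftrightarrow> _ \<and> _ \<and> ?A")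
proof (cases "v \<in> permutations_of_set {1..n}")
  case True
  then have dist: "distinct v" by (simp add: permutations_of_set_def)
  obtain h where h: "vertex_face v = fibres h {1..n}"
    "\<And>x y. x \<in> {1..n} \<Longrightarrow> y \<in> {1..n} \<Longrightarrow> prec v x y \<longleftrightarrow> h x < h y"
    by (rule vertex_face_obtain[OF True]) blast
  have bounds: "1 \<le> s \<and> t \<le> n \<and> {s..t} \<noteq> {1..n}" if "{s..t} \<in> F" "s \<le> t" for s t
  proof -
    have "{s..t} \<subset> {1..n}" using assms that(1) by (simp add: K_face_def)
    then show ?thesis using that(2) by auto
  qed
  have prec_h: "(1 < s \<longrightarrow> prec v x (s - 1)) \<and> (t < n \<longrightarrow> prec v x (Suc t)) \<longleftrightarrow>
      (1 < s \<longrightarrow> h x < h (s - 1)) \<and> (t < n \<longrightarrow> h x < h (Suc t))"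
    if "{s..t} \<in> F" "x \<in> {s..t}" for s t x
  proof -
    have "s \<le> t" using that(2) by simp
    then have b: "1 \<le> s" "t \<le> n" using bounds that(1) by blast+
    have x: "x \<in> {1..n}" using that(2) b by simp
    have "1 < s \<Longrightarrow> s - 1 \<in> {1..n}" "t < n \<Longrightarrow> Suc t \<in> {1..n}" using b \<open>s \<le> t\<close> by auto
    then show ?thesis using h(2)[OF x] by blast
  qed
  have "K_subface (theta (vertex_face v)) F \<longleftrightarrow> ?A"
  proof
    assume sub: "K_subface (theta (vertex_face v)) F"
    show ?A
    proof (intro allI impI)
      fix s t x assume st: "{s..t} \<in> F" "x \<in> {s..t}"
      then have "{s..t} \<in> theta (fibres h {1..n})" using sub h(1) by (auto simp: K_subface_def)
      then obtain s' t' where st': "{s..t} = {s'..t'}" "s' \<le> t'"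
        "\<And>x. x \<in> {s'..t'} \<Longrightarrow> (1 < s' \<longrightarrow> h x < h (s' - 1)) \<and> (t' < n \<longrightarrow> h x < h (Suc t'))"
        unfolding theta_fibres_iff by blast
      then have "s' = s" "t' = t" using st(2) by (simp_all add: Icc_eq_Icc)
      then show "(1 < s \<longrightarrow> prec v x (s - 1)) \<and> (t < n \<longrightarrow> prec v x (Suc t))"
        using prec_h[OF st] st'(3) st(2) by blast
    qed
  next
    assume A: ?A
    show "K_subface (theta (vertex_face v)) F"
      unfolding K_subface_def h(1)
    proof
      fix I assume I: "I \<in> F"
      then obtain s t where st: "s \<le> t" "I = {s..t}" using assms by (auto simp: K_face_def nat_interval_def)
      have "(1 < s \<longrightarrow> h x < h (s - 1)) \<and> (t < n \<longrightarrow> h x < h (Suc t))" if "x \<in> {s..t}" for x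
        using prec_h[of s t x] A I st(2) that by blast
      then show "I \<in> theta (fibres h {1..n})"
        unfolding theta_fibres_iff using st bounds[of s t] I by blast
    qed
  qed
  then show ?thesis using True associahedral_iff[OF dist] by (simp add: K_vertices_def)
qed (simp add: K_vertices_def)

lemma K_vertices_covers:
  assumes "K_face n F" "v \<in> K_vertices n F" "i \<in> {1..n}" "j \<in> {1..n}" "i < j" "covers F i j"
  shows "prec v i j"
proof -
  obtain s where s: "s \<le> i" "{s..<j} \<in> F" using assms(6) by (auto simp: covers_def)
  have *: "{s..<j} = {s..j - 1}" using assms(4) by auto
  have "j - 1 < n" "Suc (j - 1) = j" "i \<in> {s..j - 1}" using s(1) assms(4,5) by auto
  then show ?thesis using assms(2) s(2) unfolding K_vertices_iff[OF assms(1)] * by metis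
qed

text \<open>Every element of the node of \<open>j\<close> precedes its left neighbour
  \<open>lo n F j - 1\<close>. If \<open>i\<close> were outside, this neighbour would be
  \<open>i\<close> itself or complete a 132 pattern with \<open>i\<close> and
  \<open>j\<close>.\<close>

lemma K_vertices_node:
  assumes "K_face n F" "v \<in> K_vertices n F" "i \<in> {1..n}" "j \<in> {1..n}" "i < j" "prec v i j"
  shows "i \<in> node n F j"
proof (rule ccontr)
  note nj = node_interval[OF assms(1,4)]
  note v = assms(2)[unfolded K_vertices_iff[OF assms(1)]]
  have dist: "distinct v" using v by (simp add: permutations_of_set_def)
  assume "i \<notin> node n F j"
  then have i: "i < lo n F j" using nj(4) assms(5) mem_node_iff[OF assms(1,4)] by simp
  then have "node n F j \<in> F" using node(1)[OF assms(1,4)] nj(1) assms(3)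
    by (metis assms(1,4) atLeastAtMost_iff insertE mem_node_iff not_le)
  then have "{lo n F j..hi n F j} \<in> F" using nj(1) by simp
  moreover have "1 < lo n F j" using i assms(3) by simp
  ultimately have p: "prec v j (lo n F j - 1)" using v nj(3,4) by (metis atLeastAtMost_iff)
  show False
  proof (cases "i = lo n F j - 1")
    case True
    then show False using p assms(6) prec_asym[OF dist] by simp
  next
    case False
    then have "i < lo n F j - 1" "lo n F j - 1 < j" using i nj(2,3) by linarith+
    then show False using v p assms(6) by blast
  qed
qed

lemma P_min_permutation: "P_min (fibres h {1..n}) \<in> permutations_of_set {1..n}"
  using P_min_fibres[where X = "{1..n}" and f = h] by (simp add: permutations_of_set_def)

text \<open>The inequality on the right may be weak because \<open>x < Suc t\<close> and ties are
  written in increasing order; \<open>max_key\<close> can have such ties.\<close>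

lemma P_min_in_K_vertices:
  assumes "K_face n F" "avoids132 h {1..n}"
    "\<And>s t x. {s..t} \<in> F \<Longrightarrow> x \<in> {s..t} \<Longrightarrow> (1 < s \<longrightarrow> h x < h (s - 1)) \<and> (t < n \<longrightarrow> h x \<le> h (Suc t))"
  shows "P_min (fibres h {1..n}) \<in> K_vertices n F"
proof -
  let ?v = "P_min (fibres h {1..n})"
  note v = P_min_fibres[where X = "{1..n}" and f = h, OF finite_atLeastAtMost]
  have "\<not> prec ?v z y" if "x < y" "y < z" "prec ?v x z" for x y z
  proof
    assume zy: "prec ?v z y"
    have mem: "x \<in> {1..n}" "y \<in> {1..n}" "z \<in> {1..n}"
      using prec_in_set[OF zy] prec_in_set[OF that(3)] v(1) by blast+
    then have "h x \<le> h z" using that(3) v(3) by auto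
    then have "h y \<le> h z" using avoids132D[OF assms(2)] mem that by blast
    then show False using zy v(3)[OF mem(3,2)] that(2) by auto
  qed
  moreover have "(1 < s \<longrightarrow> prec ?v x (s - 1)) \<and> (t < n \<longrightarrow> prec ?v x (Suc t))"
    if st: "{s..t} \<in> F" "x \<in> {s..t}" for s t x
  proof -
    have "{s..t} \<subset> {1..n}" using assms(1) st(1) by (simp add: K_face_def)
    then have b: "1 \<le> s" "t \<le> n" using st(2) by auto
    have x: "x \<in> {1..n}" using st(2) b by simp
    have "1 < s \<Longrightarrow> s - 1 \<in> {1..n}" "t < n \<Longrightarrow> Suc t \<in> {1..n}" "x < Suc t" using b st(2) by auto
    then show ?thesis using v(3)[OF x] assms(3)[OF st] by (metis le_neq_implies_less)
  qed
  ultimately show ?thesis unfolding K_vertices_iff[OF assms(1)] using P_min_permutation by blast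
qed

lemma K_vertices_weak_le:
  assumes "v \<in> K_vertices n F" "w \<in> K_vertices n F"
    "\<And>x y. x \<in> {1..n} \<Longrightarrow> y \<in> {1..n} \<Longrightarrow> x < y \<Longrightarrow> prec w x y \<Longrightarrow> prec v x y"
  shows "weak_le v w"
proof -
  have *: "set v = {1..n}" "distinct v" "set w = {1..n}" "distinct w"
    using assms(1,2) by (auto simp: K_vertices_def permutations_of_set_def)
  show ?thesis using assms(3) * prec_in_set[of w] by (intro weak_le_if_noninversions) auto
qed

lemma K_min_mem:
  assumes "K_face n F"
  shows "P_min (fibres (node_key n F) {1..n}) \<in> K_vertices n F"
proof (rule P_min_in_K_vertices[OF assms avoids132_node_key[OF assms]])
  fix s t x assume st: "{s..t} \<in> F" "x \<in> {s..t}"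
  have "{s..t} \<subset> {1..n}" using assms st(1) by (simp add: K_face_def)
  then have b: "1 \<le> s" "t \<le> n" "s \<le> t" using st(2) by auto
  have F: "{s..t} \<in> insert {1..n} F" using st(1) by simp
  have "node_key n F x < node_key n F (s - 1)" if "1 < s"
    by (rule node_key_adjacent(2)[OF assms F st(2)]) (use b that in auto)
  moreover have "node_key n F x < node_key n F (Suc t)" if "t < n"
    by (rule node_key_adjacent(2)[OF assms F st(2)]) (use b that in auto)
  ultimately show "(1 < s \<longrightarrow> node_key n F x < node_key n F (s - 1)) \<and>
      (t < n \<longrightarrow> node_key n F x \<le> node_key n F (Suc t))" by (simp add: less_imp_le)
qed

text \<open>By \<open>K_vertices_node\<close>, every non-inversion of a vertex of \<open>F\<close>
  is one of this word.\<close>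

lemma K_min_eq:
  assumes "K_face n F"
  shows "K_min n F = P_min (fibres (node_key n F) {1..n})"
proof -
  let ?v = "P_min (fibres (node_key n F) {1..n})"
  note v = P_min_fibres[where X = "{1..n}" and f = "node_key n F", OF finite_atLeastAtMost]
  have least: "weak_le ?v w" if w: "w \<in> K_vertices n F" for w
  proof (rule K_vertices_weak_le[OF K_min_mem[OF assms] w])
    fix x y assume xy: "x \<in> {1..n}" "y \<in> {1..n}" "x < y" "prec w x y"
    then have "x \<in> node n F y" using K_vertices_node[OF assms w] by blast
    then have "node_key n F x \<le> node_key n F y" using node_key_le_iff[OF assms] xy by blast
    then show "prec ?v x y" using v(3)[OF xy(1,2)] xy(3) by auto
  qed
  show ?thesis
    unfolding K_min_def
  proof (rule the_equality)
    fix w assume "w \<in> K_vertices n F \<and> (\<forall>u\<in>K_vertices n F. weak_le w u)"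
    then show "w = ?v" using least K_min_mem[OF assms] weak_le_antisym[OF _ _ v(2)] by blast
  qed (use least K_min_mem[OF assms] in blast)
qed

text \<open>By \<open>K_vertices_covers\<close>, every non-inversion of this word is forced in all
  vertices of \<open>F\<close>.\<close>

lemma K_max_eq:
  assumes "K_face n F"
  shows "K_max n F = P_min (fibres (max_key n F) {1..n})"
proof -
  let ?v = "P_min (fibres (max_key n F) {1..n})"
  note v = P_min_fibres[where X = "{1..n}" and f = "max_key n F", OF finite_atLeastAtMost]
  have "avoids132 (max_key n F) {1..n}"
    unfolding avoids132_def
  proof (intro ballI impI)
    fix x y z assume *: "x \<in> {1..n}" "y \<in> {1..n}" "z \<in> {1..n}" "x < y" "y < z"
      "max_key n F x \<le> max_key n F z"
    then have "covers F x z" using max_key_le_iff[OF assms, of x z] by simp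
    then have "covers F y z" using *(4) by (meson covers_def le_trans less_imp_le)
    then show "max_key n F y \<le> max_key n F z" using max_key_le_iff[OF assms, of y z] * by simp
  qed
  then have mem: "?v \<in> K_vertices n F"
  proof (rule P_min_in_K_vertices[OF assms])
    fix s t x assume st: "{s..t} \<in> F" "x \<in> {s..t}"
    have "{s..t} \<subset> {1..n}" using assms st(1) by (simp add: K_face_def)
    then have b: "1 \<le> s" "t \<le> n" "s \<le> x" "x \<le> t" using st(2) by auto
    \<comment> \<open>Otherwise a bracket starting left of \<open>s\<close> ends at
      \<open>x - 1\<close>; being adjacent to \<open>x\<close>, it would have to lie inside
      \<open>{s..t}\<close>.\<close>
    have "max_key n F x < max_key n F (s - 1)" if "1 < s"
    proof (rule ccontr)
      assume "\<not> max_key n F x < max_key n F (s - 1)"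
      then have "covers F (s - 1) x" using max_key_le_iff[OF assms, of "s - 1" x] b that by auto
      then obtain r where r: "r \<le> s - 1" "{r..<x} \<in> F" by (auto simp: covers_def)
      have *: "{r..<x} = {r..x - 1}" using b by auto
      have "{r..x - 1} \<subset> {s..t}"
        using K_face_adjacent[OF assms, of r "x - 1" "{s..t}" x] r st b that unfolding * by auto
      moreover have "r \<in> {r..x - 1}" "r \<notin> {s..t}" using r(1) b that by auto
      ultimately show False by blast
    qed
    moreover have "max_key n F x \<le> max_key n F (Suc t)" if "t < n"
    proof -
      have "covers F x (Suc t)" using st b unfolding covers_def by (metis atLeastLessThanSuc_atLeastAtMost)
      then show ?thesis using max_key_le_iff[OF assms, of x "Suc t"] b that by auto
    qed
    ultimately show "(1 < s \<longrightarrow> max_key n F x < max_key n F (s - 1)) \<and>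
        (t < n \<longrightarrow> max_key n F x \<le> max_key n F (Suc t))" by blast
  qed
  have greatest: "weak_le w ?v" if w: "w \<in> K_vertices n F" for w
  proof (rule K_vertices_weak_le[OF w mem])
    fix x y assume xy: "x \<in> {1..n}" "y \<in> {1..n}" "x < y" "prec ?v x y"
    then have "max_key n F x \<le> max_key n F y" using v(3)[OF xy(1,2)] by auto
    then have "covers F x y" using max_key_le_iff[OF assms] xy by blast
    then show "prec w x y" using K_vertices_covers[OF assms w] xy by blast
  qed
  show ?thesis
    unfolding K_max_def
  proof (rule the_equality)
    fix w assume w: "w \<in> K_vertices n F \<and> (\<forall>u\<in>K_vertices n F. weak_le u w)"
    then have "distinct w" by (simp add: K_vertices_def permutations_of_set_def)
    then show "w = ?v" using greatest mem weak_le_antisym[of w ?v] w by blast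
  qed (use greatest mem in blast)
qed

lemma K_le_iff:
  assumes "K_face n F" "K_face n G"
  shows "K_le n F G \<longleftrightarrow> (\<forall>i\<in>{1..n}. \<forall>j\<in>{1..n}. i < j \<longrightarrow> i \<in> node n G j \<longrightarrow> covers F i j)"
proof -
  let ?w = "P_min (fibres (max_key n F) {1..n})" and ?v = "P_min (fibres (node_key n G) {1..n})"
  note w = P_min_fibres[where X = "{1..n}" and f = "max_key n F", OF finite_atLeastAtMost]
  note v = P_min_fibres[where X = "{1..n}" and f = "node_key n G", OF finite_atLeastAtMost]
  have pw: "prec ?w i j \<longleftrightarrow> covers F i j" if "i \<in> {1..n}" "j \<in> {1..n}" "i < j" for i j
    using w(3)[OF that(1,2)] max_key_le_iff[OF assms(1) that] that(3) by auto
  have pv: "prec ?v i j \<longleftrightarrow> i \<in> node n G j" if "i \<in> {1..n}" "j \<in> {1..n}" "i < j" for i j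
    using v(3)[OF that(1,2)] node_key_le_iff[OF assms(2) that] that(3) by auto
  have "weak_le ?w ?v \<longleftrightarrow> (\<forall>i j. i < j \<longrightarrow> prec ?v i j \<longrightarrow> prec ?w i j)"
    using weak_le_imp[OF _ w(2)] weak_le_if_noninversions[OF w(2) v(2)] w(1) v(1) by blast
  also have "\<dots> \<longleftrightarrow> (\<forall>i\<in>{1..n}. \<forall>j\<in>{1..n}. i < j \<longrightarrow> i \<in> node n G j \<longrightarrow> covers F i j)"
    using pw pv prec_in_set[of ?v] v(1) by metis
  finally show ?thesis by (simp only: K_le_def K_max_eq[OF assms(1)] K_min_eq[OF assms(2)])
qed

section \<open>The cell with the minimal vertex\<close>

text \<open>Keys compare left ends first, so the sublevel set of \<open>x\<close> has nothing to the
  left of \<open>lo n F x\<close>; both neighbours of the node have larger keys, so the node is a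
  full run.\<close>

lemma first_run_node:
  assumes "K_face n F" "x \<in> {1..n}"
  shows "first_run {k\<in>{1..n}. node_key n F k \<le> node_key n F x} = node n F x"
proof (rule first_run_eqI)
  let ?A = "{k\<in>{1..n}. node_key n F k \<le> node_key n F x}"
  note nx = node_interval[OF assms]
  have sub: "node n F x \<subseteq> ?A"
  proof
    fix k assume k: "k \<in> node n F x"
    then have kn: "k \<in> {1..n}" using nx(2,5) mem_node_iff[OF assms] by simp
    have "node_key n F k \<le> node_key n F x"
      using node_mono[OF assms k] node_key_mono[OF assms(1) kn assms(2)] node_key_eq_iff[OF assms(1) kn assms(2)]
      by (metis less_imp_le order_refl psubsetI)
    then show "k \<in> ?A" using kn by simp
  qed
  have mem: "{lo n F x..hi n F x} \<in> insert {1..n} F" "x \<in> {lo n F x..hi n F x}"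
    using node(1,2)[OF assms] unfolding nx(1)[symmetric] by simp_all
  have adj: "y \<notin> ?A" if "y = Suc (hi n F x) \<or> Suc y = lo n F x" for y
    using node_key_adjacent(2)[OF assms(1) mem _ that] by auto
  show "node n F x \<in> max_runs ?A"
    unfolding max_runs_iff
  proof (intro exI conjI)
    show "node n F x = {lo n F x..hi n F x}" by (rule nx(1))
    show "0 < lo n F x \<longrightarrow> lo n F x - 1 \<notin> ?A" using adj[of "lo n F x - 1"] by simp
    show "Suc (hi n F x) \<notin> ?A" using adj by blast
  qed (use nx sub in auto)
  have "lo n F x \<in> ?A" using sub nx(3,4) mem_node_iff[OF assms, of "lo n F x"] by auto
  moreover have "lo n F x \<le> k" if k: "k \<in> ?A" for k
  proof -
    have kn: "k \<in> {1..n}" "node_key n F k \<le> node_key n F x" using k by auto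
    then have "lo n F x \<le> lo n F k"
      using node_key_less_iff[OF assms kn(1)] by (meson not_le)
    then show ?thesis using node_interval(3)[OF assms(1) kn(1)] by simp
  qed
  ultimately have "Min ?A = lo n F x" by (intro Min_eqI) auto
  then show "Min ?A \<in> node n F x" using nx(3,4) mem_node_iff[OF assms] by simp
qed

lemma fibres_in_subdivision_cells:
  assumes "K_face n F" "1 \<le> n"
  shows "fibres (node_key n F) {1..n} \<in> subdivision_cells n F"
proof -
  let ?u = "fibres (node_key n F) {1..n}"
  have len: "length ?u = n - K_dim n F"
    using card_node_key[OF assms] card_K_face_le[OF assms] assms(2) by (simp add: length_fibres K_dim_def)
  \<comment> \<open>The value left out of the prefix unions is the key of the root, so their first
    runs are exactly the nodes other than the root.\<close>
  have max_iff: "(\<exists>b\<in>{1..n}. node_key n F a < node_key n F b) \<longleftrightarrow> node n F a \<noteq> {1..n}"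
    if a: "a \<in> {1..n}" for a
  proof
    assume "\<exists>b\<in>{1..n}. node_key n F a < node_key n F b"
    then obtain b where b: "b \<in> {1..n}" "node_key n F a < node_key n F b" by blast
    show "node n F a \<noteq> {1..n}"
    proof
      assume *: "node n F a = {1..n}"
      then have "b \<in> node n F a" using b(1) by simp
      then show False
        using b(2) node_mono[OF assms(1) a] node_key_mono[OF assms(1) b(1) a] node_key_eq_iff[OF assms(1) b(1) a]
        by (metis less_asym less_irrefl psubsetI)
    qed
  next
    assume *: "node n F a \<noteq> {1..n}"
    obtain b where b: "b \<in> {1..n}" "node n F b = {1..n}" using node_image[OF assms] by (metis imageE insertI1)
    have "node n F a \<subset> node n F b" using * b(2) node(3)[OF assms(1) a, of "{1..n}"] a by auto
    then show "\<exists>b\<in>{1..n}. node_key n F a < node_key n F b" using node_key_mono[OF assms(1) a b(1)] b(1) by blast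
  qed
  have "{first_run (\<Union> (set (take i ?u))) | i. 1 \<le> i \<and> i < length ?u} = first_run ` prefix_unions ?u"
    by (auto simp: prefix_unions_def)
  also have "\<dots> = {node n F a | a. a \<in> {1..n} \<and> node n F a \<noteq> {1..n}}"
  proof -
    let ?A = "\<lambda>a. {k\<in>{1..n}. node_key n F k \<le> node_key n F a}"
    have "first_run ` prefix_unions ?u =
        {first_run (?A a) | a. a \<in> {1..n} \<and> (\<exists>b\<in>{1..n}. node_key n F a < node_key n F b)}"
      unfolding prefix_unions_fibres[OF finite_atLeastAtMost] by blast
    also have "\<dots> = {node n F a | a. a \<in> {1..n} \<and> node n F a \<noteq> {1..n}}"
      using first_run_node[OF assms(1)] max_iff by (intro Collect_cong ex_cong1) metis
    finally show ?thesis .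
  qed
  also have "\<dots> = node n F ` {1..n} - {{1..n}}" by blast
  also have "\<dots> = F" using assms(1) unfolding node_image[OF assms] by (auto simp: K_face_def)
  finally show ?thesis using len P_face_fibres unfolding subdivision_cells_def by blast
qed

text \<open>In a 132-avoiding word, a letter added to a prefix is either a new minimum or extends the first
  run. Hence the first run determines the prefix.\<close>

lemma first_run_inj:
  assumes "distinct v" "\<forall>x y z. x < y \<longrightarrow> y < z \<longrightarrow> prec v x z \<longrightarrow> \<not> prec v z y"
    and P: "P \<noteq> {}" "P \<subset> Q" "Q \<subseteq> set v"
    and down: "\<And>x y. y \<in> P \<Longrightarrow> prec v x y \<Longrightarrow> x \<in> P" "\<And>x y. y \<in> Q \<Longrightarrow> prec v x y \<Longrightarrow> x \<in> Q"
    and interval: "set v = {1..n}"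
  shows "first_run P \<noteq> first_run Q"
proof
  assume eq: "first_run P = first_run Q"
  have fin: "finite P" "finite Q" "Q \<noteq> {}" using P finite_subset[of _ "set v"] by blast+
  note fP = first_run[OF fin(1) P(1)] and fQ = first_run[OF fin(2,3)]
  have "first_run P \<subseteq> P" using fP(1) by (simp add: max_runs_def)
  then have "Min Q \<in> P" using fQ(2) eq by blast
  obtain y where y: "y \<in> Q" "y \<notin> P" using P(2) by blast
  have "Min Q < y" using y \<open>Min Q \<in> P\<close> Min_le[OF fin(2) y(1)] by (metis le_neq_implies_less)
  have mem: "Min Q \<in> set v" "y \<in> set v" using P y(1) \<open>Min Q \<in> P\<close> by blast+
  have m: "prec v (Min Q) y"
    using prec_linear[OF mem] \<open>Min Q < y\<close> down(1)[OF \<open>Min Q \<in> P\<close>, of y] y(2) by auto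
  \<comment> \<open>\<open>Min Q\<close> lies in \<open>P\<close> and hence precedes
    \<open>y\<close>. An intermediate \<open>k\<close> coming after \<open>y\<close> would complete
    a 132 pattern.\<close>
  have "k \<in> Q" if k: "k \<in> {Min Q..y}" for k
  proof -
    consider "k = Min Q" | "k = y" | "Min Q < k" "k < y" using k by fastforce
    then show ?thesis
    proof cases
      case 3
      then have "\<not> prec v y k" using assms(2) m by blast
      moreover have "k \<in> set v" using 3 mem interval by auto
      ultimately have "prec v k y" using prec_linear[of k v y] mem(2) 3(2) by auto
      then show ?thesis using down(2)[OF y(1)] by blast
    qed (use \<open>Min Q \<in> P\<close> P(2) y(1) in auto)
  qed
  then have "{Min Q..y} \<subseteq> Q" by blast
  then obtain R where R: "R \<in> max_runs Q" "{Min Q..y} \<subseteq> R"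
    using max_run_superset[OF fin(2), of "Min Q" y] \<open>Min Q < y\<close> by auto
  then have "Min Q \<in> R" "y \<in> R" using \<open>Min Q < y\<close> by auto
  then have "y \<in> first_run Q" using first_run_eqI[OF R(1)] by simp
  then show False using eq \<open>first_run P \<subseteq> P\<close> y(2) by blast
qed

text \<open>A competitor \<open>u\<close> has the same minimal vertex, so the prefix unions of both
  partitions are initial segments of one word. By \<open>first_run_inj\<close> each is determined by
  its first run, and in both cases the first runs make up \<open>F\<close>. So the prefix unions
  agree, and with them the partitions.\<close>

lemma F_min_eq:
  assumes "K_face n F" "1 \<le> n"
  shows "F_min n F = fibres (node_key n F) {1..n}"
  unfolding F_min_def
proof (rule the_equality)
  let ?f = "node_key n F"
  show "fibres ?f {1..n} \<in> subdivision_cells n F \<and> P_min (fibres ?f {1..n}) = K_min n F"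
    using fibres_in_subdivision_cells[OF assms] K_min_eq[OF assms(1)] by simp
  fix u assume u: "u \<in> subdivision_cells n F \<and> P_min u = K_min n F"
  then have "P_face n u" by (simp add: subdivision_cells_def)
  then obtain h where h: "u = fibres h {1..n}" by (rule P_face_obtain)
  define v where "v = K_min n F"
  have v: "P_min (fibres ?f {1..n}) = v" "P_min (fibres h {1..n}) = v"
    using u h K_min_eq[OF assms(1)] by (auto simp: v_def)
  have "v \<in> K_vertices n F" using K_min_mem[OF assms(1)] v(1) by simp
  then have vK: "distinct v" "set v = {1..n}" "\<forall>x y z. x < y \<longrightarrow> y < z \<longrightarrow> prec v x z \<longrightarrow> \<not> prec v z y"
    unfolding K_vertices_iff[OF assms(1)] permutations_of_set_def by blast+
  let ?pre = "\<lambda>h::nat \<Rightarrow> nat. prefix_unions (fibres h {1..n})"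
  have down: "P \<noteq> {} \<and> P \<subseteq> set v \<and> (\<forall>x y. y \<in> P \<longrightarrow> prec v x y \<longrightarrow> x \<in> P)"
    if P: "P \<in> ?pre k" and k: "P_min (fibres k {1..n}) = v" for P k
  proof -
    obtain a where a: "a \<in> {1..n}" "P = {x\<in>{1..n}. k x \<le> k a}"
      using P unfolding prefix_unions_fibres[OF finite_atLeastAtMost] by blast
    have "x \<in> P" if "y \<in> P" "prec v x y" for x y
    proof -
      have "x \<in> {1..n}" "y \<in> {1..n}" using prec_in_set[OF that(2)] vK(2) by auto
      then have "k x \<le> k y" using P_min_fibres(3)[of "{1..n}" x y k] that(2) k by auto
      then show ?thesis using that(1) a(2) \<open>x \<in> {1..n}\<close> by auto
    qed
    moreover have "P \<noteq> {}" "P \<subseteq> set v" unfolding vK(2) using a by auto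
    ultimately show ?thesis by blast
  qed
  have not_psubset: "\<not> P \<subset> Q" if P: "P \<in> ?pre k" "P_min (fibres k {1..n}) = v"
    and Q: "Q \<in> ?pre l" "P_min (fibres l {1..n}) = v" and eq: "first_run P = first_run Q" for P Q k l
  proof
    assume PQ: "P \<subset> Q"
    have "first_run P \<noteq> first_run Q"
      by (rule first_run_inj[OF vK(1,3) _ PQ _ _ _ vK(2)]) (use down[OF P] down[OF Q] in blast)+
    then show False using eq by simp
  qed
  have inj: "P = Q" if P: "P \<in> ?pre k" "P_min (fibres k {1..n}) = v"
    and Q: "Q \<in> ?pre l" "P_min (fibres l {1..n}) = v" and eq: "first_run P = first_run Q" for P Q k l
  proof -
    note dP = down[OF P] and dQ = down[OF Q]
    have "P \<subseteq> Q \<or> Q \<subseteq> P"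
    proof (rule ccontr)
      assume "\<not> ?thesis"
      then obtain x y where xy: "x \<in> P" "x \<notin> Q" "y \<in> Q" "y \<notin> P" by blast
      then have "x \<in> set v" "y \<in> set v" "x \<noteq> y" using dP dQ by auto
      then have "prec v x y \<or> prec v y x" by (rule prec_linear)
      moreover have "\<not> prec v x y" using xy(2,3) dQ by metis
      moreover have "\<not> prec v y x" using xy(1,4) dP by metis
      ultimately show False by simp
    qed
    moreover have "\<not> P \<subset> Q" by (rule not_psubset[OF P Q eq])
    moreover have "\<not> Q \<subset> P" by (rule not_psubset[OF Q P eq[symmetric]])
    ultimately show ?thesis by blast
  qed
  have cells: "first_run ` ?pre k = F" if "fibres k {1..n} \<in> subdivision_cells n F" for k
  proof -
    have "F = {first_run (\<Union> (set (take i (fibres k {1..n})))) | i. 1 \<le> i \<and> i < length (fibres k {1..n})}"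
      using that unfolding subdivision_cells_def by blast
    then show ?thesis by (simp add: prefix_unions_def setcompr_eq_image image_image)
  qed
  have F1: "first_run ` ?pre h = F" and F2: "first_run ` ?pre ?f = F"
    using cells u h fibres_in_subdivision_cells[OF assms] by simp_all
  have pre_eq: "?pre h = ?pre ?f"
  proof (intro equalityI subsetI)
    fix P assume P: "P \<in> ?pre h"
    then obtain Q where "Q \<in> ?pre ?f" "first_run Q = first_run P" using F1 F2 by (metis imageE imageI)
    then show "P \<in> ?pre ?f" using inj[OF P v(2) _ v(1)] by metis
  next
    fix P assume P: "P \<in> ?pre ?f"
    then obtain Q where "Q \<in> ?pre h" "first_run Q = first_run P" using F1 F2 by (metis imageE imageI)
    then show "P \<in> ?pre h" using inj[OF P v(1) _ v(2)] by metis
  qed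
  \<comment> \<open>The order of the blocks can be recovered from the prefix unions.\<close>
  have less_iff: "k x < k y \<longleftrightarrow> (\<exists>P\<in>?pre k. x \<in> P \<and> y \<notin> P)" if "x \<in> {1..n}" "y \<in> {1..n}" for k x y
  proof
    assume "k x < k y"
    then have "{z\<in>{1..n}. k z \<le> k x} \<in> ?pre k"
      unfolding prefix_unions_fibres[OF finite_atLeastAtMost] using that by blast
    then show "\<exists>P\<in>?pre k. x \<in> P \<and> y \<notin> P" using that \<open>k x < k y\<close> by (intro bexI) auto
  next
    assume "\<exists>P\<in>?pre k. x \<in> P \<and> y \<notin> P"
    then show "k x < k y"
      unfolding prefix_unions_fibres[OF finite_atLeastAtMost] using that by auto
  qed
  show "u = fibres ?f {1..n}"
    unfolding h using less_iff pre_eq by (intro fibres_cong) auto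
qed

section \<open>From matching pairs to complementary pairs\<close>

lemma desc_partition_rev: "desc_partition (rev v) = rev (asc_partition v)"
  using runs_wrt_rev[of "(>)" v] by (simp add: desc_partition_def asc_partition_def rev_map comp_def)

lemma separated_node_keys:
  assumes "K_face n F" "K_face n G" "K_le n F G"
  shows "separated (node_key n F) (node_key n G) {1..n}"
  unfolding separated_def
proof (intro ballI impI)
  fix x y assume xy: "x \<in> {1..n}" "y \<in> {1..n}" "x < y" "node_key n G x \<le> node_key n G y"
  then have "x \<in> node n G y" using node_key_le_iff[OF assms(2)] by blast
  then have "covers F x y" using assms(3) K_le_iff[OF assms(1,2)] xy by blast
  then show "node_key n F x < node_key n F y"
    using covers_node_psubset[OF assms(1)] node_key_mono[OF assms(1)] xy by blast
qed

lemma matching_pair_complementary: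
  assumes "matching_pair n F G" "1 \<le> n"
  shows "complementary_pair n (F_min n F) (F_min n G)"
proof -
  have F: "K_face n F" and G: "K_face n G" and le: "K_le n F G"
    and dim: "K_dim n F + K_dim n G = n - 1"
    using assms(1) by (auto simp: matching_pair_def)
  let ?f = "node_key n F" and ?g = "node_key n G"
  have X: "{1..n} = {1..<Suc n}" by auto
  \<comment> \<open>The dimensions add up to \<open>n - 1\<close>, hence so do \<open>card F\<close>
    and \<open>card G\<close>, and each root contributes one more block.\<close>
  have "card (?f ` {1..<Suc n}) + card (?g ` {1..<Suc n}) = Suc n - 1 + 1"
    using card_node_key[OF F assms(2)] card_node_key[OF G assms(2)] dim assms(2)
      card_K_face_le[OF F assms(2)] card_K_face_le[OF G assms(2)]
    unfolding X by (simp add: K_dim_def)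
  then obtain \<sigma> where \<sigma>: "set \<sigma> = {1..n}" "distinct \<sigma>"
    "moves_to (desc_partition \<sigma>) (fibres ?f {1..n})"
    "moves_to (desc_partition (rev \<sigma>)) (rev (fibres ?g {1..n}))"
    using moves_to_fibres[of ?f 1 "Suc n" ?g] avoids132_node_key[OF F] avoids132_node_key[OF G]
      separated_node_keys[OF F G le] unfolding X by blast
  obtain Ms where Ms: "R_admissible Ms (desc_partition \<sigma>)" "R_move Ms (desc_partition \<sigma>) = fibres ?f {1..n}"
    using moves_to_R_move[OF \<sigma>(3)] by blast
  obtain Ns where "R_admissible Ns (rev (asc_partition \<sigma>))"
    "R_move Ns (rev (asc_partition \<sigma>)) = rev (fibres ?g {1..n})"
    using moves_to_R_move[OF \<sigma>(4)] unfolding desc_partition_rev by blast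
  then have Ns: "L_admissible Ns (asc_partition \<sigma>)" "L_move Ns (asc_partition \<sigma>) = fibres ?g {1..n}"
    by (simp_all add: L_admissible_def L_move_def)
  have "\<sigma> \<in> permutations_of_set {1..n}" using \<sigma> by (simp add: permutations_of_set_def)
  then show ?thesis
    unfolding complementary_pair_def F_min_eq[OF F assms(2)] F_min_eq[OF G assms(2)]
    using Ms Ns by metis
qed

text \<open>A degeneracy \<open>x < y < z\<close> would have \<open>x\<close> and \<open>z\<close>
  in one block and \<open>y\<close> in a later one, against 132-avoidance.\<close>

lemma F_min_non_degenerate:
  assumes "K_face n F" "1 \<le> n"
  shows "non_degenerate n (F_min n F)"
proof -
  let ?f = "node_key n F"
  let ?u = "fibres ?f {1..n}"
  have "associahedral (P_min ?u)" using K_min_mem[OF assms(1)] by (simp add: K_vertices_def)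
  moreover have "\<not> has_degeneracy ?u"
  proof
    assume "has_degeneracy ?u"
    then obtain i k x y z where *: "0 < k" "i + k < length ?u" "x \<in> ?u ! i" "z \<in> ?u ! i"
      "y \<in> ?u ! (i + k)" "x < y" "y < z" unfolding has_degeneracy_def by blast
    define cs where "cs = sorted_list_of_set (?f ` {1..n})"
    have u: "?u ! m = {x\<in>{1..n}. ?f x = cs ! m}" if "m < length ?u" for m
      using that by (simp add: fibres_def cs_def)
    have mem: "x \<in> {1..n}" "y \<in> {1..n}" "z \<in> {1..n}" "?f x = cs ! i" "?f z = cs ! i" "?f y = cs ! (i + k)"
      using * u[of i] u[of "i + k"] by auto
    have "sorted_wrt (<) cs" by (simp add: cs_def)
    then have "?f z < ?f y" using sorted_wrt_nth_less[of "(<)" cs i "i + k"] * mem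
      by (simp add: cs_def length_fibres)
    then show False
      using avoids132D[OF avoids132_node_key[OF assms(1)] mem(1-3) *(6,7)] mem(4,5) by simp
  qed
  ultimately show ?thesis by (simp add: non_degenerate_def F_min_eq[OF assms])
qed

section \<open>From complementary pairs to matching pairs\<close>

lemma P_face_desc_partition:
  assumes "distinct v" "set v = {1..n}"
  shows "P_face n (desc_partition v)"
proof -
  define rs where "rs = runs_wrt (>) v"
  have v: "concat rs = v" unfolding rs_def by (rule concat_runs_wrt)
  have ne: "[] \<notin> set rs" unfolding rs_def by (rule runs_wrt_nonempty)
  have rem: "removeAll [] rs = rs" using ne by simp
  have "distinct (concat rs)" using assms(1) v by simp
  then have d: "distinct rs" "\<And>R S. R \<in> set rs \<Longrightarrow> S \<in> set rs \<Longrightarrow> R \<noteq> S \<Longrightarrow> set R \<inter> set S = {}"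
    unfolding distinct_concat_iff rem by metis+
  have "inj_on set (set rs)"
  proof (rule inj_onI, rule ccontr)
    fix R S assume RS: "R \<in> set rs" "S \<in> set rs" "set R = set S" "R \<noteq> S"
    then have "set R = {}" using d(2)[of R S] by simp
    then show False using ne RS(1) by (metis set_empty)
  qed
  moreover have "\<Union> (set ` set rs) = {1..n}" using v assms(2) by (metis set_concat)
  moreover have "{} \<notin> set ` set rs" using ne by (metis imageE set_empty)
  moreover have "disjoint (set ` set rs)" unfolding disjoint_def using d(2) by (metis (no_types, lifting) imageE)
  ultimately show ?thesis
    using d(1) by (simp add: P_face_def partition_on_def desc_partition_def distinct_map rs_def[symmetric])
qed

lemma desc_partition_separates:
  assumes "distinct v" "x < y" "prec v x y" "i < length (desc_partition v)" "j < length (desc_partition v)"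
    "x \<in> desc_partition v ! i" "y \<in> desc_partition v ! j"
  shows "i < j"
proof -
  let ?rs = "runs_wrt (>) v"
  have ij: "i < length ?rs" "j < length ?rs" "x \<in> set (?rs ! i)" "y \<in> set (?rs ! j)"
    using assms(4-7) by (auto simp: desc_partition_def)
  have not: "\<not> prec v y x" using assms(1,3) prec_asym by metis
  have "\<not> j < i" using prec_concat[of j i ?rs y x] ij not by (auto simp: concat_runs_wrt)
  moreover have "i \<noteq> j"
  proof
    assume "i = j"
    have "sorted_wrt (>) (?rs ! i)" using sorted_wrt_runs_wrt[of "(>)" v] ij(1) by auto
    then have "\<not> prec (?rs ! i) x y" using prec_sorted_wrt[of "(>)" "?rs ! i" x y] assms(2) by auto
    then have "prec (?rs ! i) y x" using prec_linear[of x "?rs ! i" y] ij \<open>i = j\<close> assms(2) by auto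
    then show False using prec_concat_same[OF ij(1)] not by (auto simp: concat_runs_wrt)
  qed
  ultimately show ?thesis by simp
qed

text \<open>Along right moves on \<open>a\<^sub>\<sigma>\<close>, every non-inversion of \<open>\<sigma>\<close> keeps its two entries in
  distinct blocks, in the right order: the maximal vertex stays below \<open>\<sigma>\<close>.\<close>

lemma move_right_fibres:
  assumes "finite X" "h ` X = {..<p}" "Suc j < p" "admissible_move j M (fibres h X)"
    and mono: "\<And>x y. x \<in> X \<Longrightarrow> y \<in> X \<Longrightarrow> x < y \<Longrightarrow> R x y \<Longrightarrow> h x < h y"
  defines "h' \<equiv> \<lambda>x. if x \<in> M then Suc j else h x"
  shows "move_right j M (fibres h X) = fibres h' X" "h' ` X = {..<p}"
    "\<And>x y. x \<in> X \<Longrightarrow> y \<in> X \<Longrightarrow> x < y \<Longrightarrow> R x y \<Longrightarrow> h' x < h' y"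
proof -
  note nth = fibres_nth[OF assms(2)]
  have len: "length (fibres h X) = p" by (simp add: length_fibres assms(2))
  let ?B = "\<lambda>i. {x\<in>X. h x = i}"
  have M: "M \<subseteq> ?B j - {Min (?B j)}" "M \<noteq> {} \<longrightarrow> Max (?B (Suc j)) < Min M"
    using assms(3,4) nth[of j] nth[of "Suc j"] by (simp_all add: admissible_move_def)
  have ne: "?B i \<noteq> {}" if "i < p" for i
  proof -
    have "i \<in> h ` X" using assms(2) that by simp
    then show ?thesis by auto
  qed
  have "finite M" using M(1) assms(1) finite_subset[of M X] by auto
  show image: "h' ` X = {..<p}"
  proof (intro equalityI subsetI)
    fix c assume "c \<in> h' ` X"
    then obtain x where "x \<in> X" "c = h' x" by blast
    moreover have "h x < p" using \<open>x \<in> X\<close> assms(2) by blast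
    ultimately show "c \<in> {..<p}" using assms(3) by (auto simp: h'_def)
  next
    fix c assume c: "c \<in> {..<p}"
    show "c \<in> h' ` X"
    proof (cases "c = j")
      case True
      \<comment> \<open>The minimum never moves, so block \<open>j\<close> stays nonempty.\<close>
      have "Min (?B j) \<in> ?B j" using ne[of j] assms(1,3) by (intro Min_in) auto
      moreover have "Min (?B j) \<notin> M" using M(1) by blast
      ultimately show ?thesis using True by (intro image_eqI[of _ _ "Min (?B j)"]) (auto simp: h'_def)
    next
      case False
      obtain x where x: "x \<in> X" "h x = c" using ne[of c] c by auto
      then have "x \<notin> M" using M(1) False by auto
      then show ?thesis using x by (intro image_eqI[of _ _ x]) (auto simp: h'_def)
    qed
  qed
  show "move_right j M (fibres h X) = fibres h' X"
  proof (rule nth_equalityI)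
    show "length (move_right j M (fibres h X)) = length (fibres h' X)"
      by (simp add: move_right_def length_fibres image assms(2))
    fix i assume "i < length (move_right j M (fibres h X))"
    then have i: "i < p" using len by (simp add: move_right_def)
    have "move_right j M (fibres h X) ! i =
        (if i = Suc j then ?B (Suc j) \<union> M else if i = j then ?B j - M else ?B i)"
      using i assms(3) nth len by (simp add: move_right_def nth_list_update)
    also have "\<dots> = {x\<in>X. h' x = i}" using M(1) by (auto simp: h'_def)
    also have "\<dots> = fibres h' X ! i" using fibres_nth[OF image i] by simp
    finally show "move_right j M (fibres h X) ! i = fibres h' X ! i" .
  qed
  fix x y assume xy: "x \<in> X" "y \<in> X" "x < y" "R x y"
  then have less: "h x < h y" using mono by blast
  show "h' x < h' y"
  proof (cases "x \<in> M")
    case True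
    then have "h x = j" using M(1) by auto
    \<comment> \<open>An element of the block that is entered lies below all of \<open>M\<close>,
      hence below \<open>x\<close>.\<close>
    have "h y \<noteq> Suc j"
    proof
      assume "h y = Suc j"
      then have "y \<le> Max (?B (Suc j))" using xy(2) assms(1) by (intro Max_ge) auto
      moreover have "Min M \<le> x" using True \<open>finite M\<close> by simp
      ultimately show False using M(2) True xy(3) by fastforce
    qed
    moreover have "y \<notin> M" using less \<open>h x = j\<close> M(1) by auto
    ultimately show ?thesis using less \<open>h x = j\<close> True by (simp add: h'_def)
  next
    case False
    then show ?thesis using less M(1) by (auto simp: h'_def)
  qed
qed

lemma move_right_seq_fibres:
  assumes "finite X" "h ` X = {..<p}" "j + length Ms < p" "admissible_seq j Ms (fibres h X)"
    "\<And>x y. x \<in> X \<Longrightarrow> y \<in> X \<Longrightarrow> x < y \<Longrightarrow> R x y \<Longrightarrow> h x < h y"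
  shows "\<exists>h'. move_right_seq j Ms (fibres h X) = fibres h' X \<and> h' ` X = {..<p} \<and>
    (\<forall>x\<in>X. \<forall>y\<in>X. x < y \<longrightarrow> R x y \<longrightarrow> h' x < h' y)"
  using assms
proof (induction Ms arbitrary: j h)
  case (Cons M Ms)
  let ?h = "\<lambda>x. if x \<in> M then Suc j else h x"
  have adm: "admissible_move j M (fibres h X)" and j: "Suc j < p" using Cons.prems(3,4) by auto
  note step = move_right_fibres[OF assms(1) Cons.prems(2) j adm Cons.prems(5)]
  have "\<exists>h'. move_right_seq (Suc j) Ms (fibres ?h X) = fibres h' X \<and> h' ` X = {..<p} \<and>
    (\<forall>x\<in>X. \<forall>y\<in>X. x < y \<longrightarrow> R x y \<longrightarrow> h' x < h' y)"
  proof (rule Cons.IH[OF assms(1)])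
    show "?h ` X = {..<p}" using step(2) by blast
    show "Suc j + length Ms < p" using Cons.prems(3) by simp
    show "admissible_seq (Suc j) Ms (fibres ?h X)" using step(1) Cons.prems(4) by simp
    show "\<And>x y. x \<in> X \<Longrightarrow> y \<in> X \<Longrightarrow> x < y \<Longrightarrow> R x y \<Longrightarrow> ?h x < ?h y" using step(3) by blast
  qed
  then show ?case using step(1) by simp
qed auto

lemma R_move_desc_partition:
  assumes "\<sigma> \<in> permutations_of_set {1..n}" "1 \<le> n" "R_admissible Ms (desc_partition \<sigma>)"
  obtains f where "R_move Ms (desc_partition \<sigma>) = fibres f {1..n}"
    "f ` {1..n} = {..<length (desc_partition \<sigma>)}"
    "\<forall>x\<in>{1..n}. \<forall>y\<in>{1..n}. x < y \<longrightarrow> prec \<sigma> x y \<longrightarrow> f x < f y"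
proof -
  have \<sigma>: "set \<sigma> = {1..n}" "distinct \<sigma>" using assms(1) by (auto simp: permutations_of_set_def)
  let ?D = "desc_partition \<sigma>"
  obtain h where h: "?D = fibres h {1..n}" "h ` {1..n} = {..<length ?D}"
    "\<forall>i<length ?D. ?D ! i = {x\<in>{1..n}. h x = i}"
    by (rule P_face_obtain[OF P_face_desc_partition[OF \<sigma>(2,1)]])
  have mono: "h x < h y" if "x \<in> {1..n}" "y \<in> {1..n}" "x < y" "prec \<sigma> x y" for x y
  proof -
    have "h x < length ?D" "h y < length ?D" using h(2) that(1,2) by blast+
    then show ?thesis using desc_partition_separates[OF \<sigma>(2) that(3,4)] h(3) that(1,2) by blast
  qed
  have "0 < length ?D" 
  proof -
    have "h 1 \<in> {..<length ?D}" using h(2) assms(2) by auto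
    then show ?thesis by auto
  qed
  then have "0 + length Ms < length ?D" using assms(3) by (simp add: R_admissible_def)
  moreover have "admissible_seq 0 Ms (fibres h {1..n})"
    using assms(3) h(1) by (simp add: R_admissible_def)
  ultimately obtain f where "move_right_seq 0 Ms (fibres h {1..n}) = fibres f {1..n}"
    "f ` {1..n} = {..<length ?D}" "\<forall>x\<in>{1..n}. \<forall>y\<in>{1..n}. x < y \<longrightarrow> prec \<sigma> x y \<longrightarrow> f x < f y"
    using move_right_seq_fibres[OF finite_atLeastAtMost h(2), of 0 Ms "prec \<sigma>"] mono by blast
  then show ?thesis using that h(1) by (simp add: R_move_def)
qed

text \<open>Moves keep the number of blocks, so the lengths are the numbers of monotone runs of
  \<open>\<sigma>\<close>, counted by \<open>length_runs_wrt\<close>.\<close>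

lemma complementary_pair_obtain:
  assumes "complementary_pair n \<alpha> \<beta>" "1 \<le> n"
  obtains f g where "\<alpha> = fibres f {1..n}" "f ` {1..n} = {..<length \<alpha>}"
    "\<beta> = fibres g {1..n}" "g ` {1..n} = {..<length \<beta>}"
    "separated f g {1..n}" "length \<alpha> + length \<beta> = n + 1"
proof -
  obtain \<sigma> Ms Ns where \<sigma>: "\<sigma> \<in> permutations_of_set {1..n}"
    and Ms: "R_admissible Ms (desc_partition \<sigma>)" and Ns: "L_admissible Ns (asc_partition \<sigma>)"
    and \<alpha>: "\<alpha> = R_move Ms (desc_partition \<sigma>)" and \<beta>: "\<beta> = L_move Ns (asc_partition \<sigma>)"
    using assms(1) unfolding complementary_pair_def by blast
  have set: "set \<sigma> = {1..n}" "distinct \<sigma>" using \<sigma> by (auto simp: permutations_of_set_def)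
  obtain f where f: "\<alpha> = fibres f {1..n}" "f ` {1..n} = {..<length (desc_partition \<sigma>)}"
    "\<forall>x\<in>{1..n}. \<forall>y\<in>{1..n}. x < y \<longrightarrow> prec \<sigma> x y \<longrightarrow> f x < f y"
    unfolding \<alpha> by (rule R_move_desc_partition[OF \<sigma> assms(2) Ms])
  have "rev \<sigma> \<in> permutations_of_set {1..n}" using \<sigma> by (simp add: permutations_of_set_def)
  moreover have "R_admissible Ns (desc_partition (rev \<sigma>))"
    using Ns by (simp add: L_admissible_def desc_partition_rev)
  ultimately obtain g' where g': "R_move Ns (desc_partition (rev \<sigma>)) = fibres g' {1..n}"
    "g' ` {1..n} = {..<length (desc_partition (rev \<sigma>))}"
    "\<forall>x\<in>{1..n}. \<forall>y\<in>{1..n}. x < y \<longrightarrow> prec (rev \<sigma>) x y \<longrightarrow> g' x < g' y"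
    using R_move_desc_partition[OF _ assms(2)] by metis
  have rev: "rev \<beta> = fibres g' {1..n}" using g'(1) by (simp add: \<beta> L_move_def desc_partition_rev)
  have len: "length \<alpha> = length (desc_partition \<sigma>)" "length \<beta> = length (asc_partition \<sigma>)"
    using f(1,2) g'(2) rev length_rev[of \<beta>] by (simp_all add: length_fibres desc_partition_rev)
  have "P_face n (rev \<beta>)" unfolding rev by (rule P_face_fibres)
  then have "P_face n \<beta>" by (simp add: P_face_def)
  then obtain g where g: "\<beta> = fibres g {1..n}" "g ` {1..n} = {..<length \<beta>}"
    "\<forall>i<length \<beta>. \<beta> ! i = {x\<in>{1..n}. g x = i}" by (rule P_face_obtain)
  have g'_img: "g' ` {1..n} = {..<length \<beta>}" using g'(2) len(2) by (simp add: desc_partition_rev)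
  \<comment> \<open>\<open>g\<close> numbers the blocks of \<open>\<beta>\<close> from the left and
    \<open>g'\<close> from the right, both starting at 0.\<close>
  have gg': "g x + g' x + 1 = length \<beta>" if x: "x \<in> {1..n}" for x
  proof -
    have lt: "g x < length \<beta>" "g' x < length \<beta>" using g(2) g'_img x by blast+
    then have "x \<in> rev \<beta> ! g' x" unfolding rev using fibres_nth[OF g'_img lt(2)] x by simp
    then have "x \<in> \<beta> ! (length \<beta> - Suc (g' x))" using lt(2) by (simp add: rev_nth)
    moreover have "length \<beta> - Suc (g' x) < length \<beta>" using lt(2) by simp
    ultimately have "g x = length \<beta> - Suc (g' x)" using g(3) by blast
    then show ?thesis using lt(2) by simp
  qed
  have "separated f g {1..n}"
    unfolding separated_def
  proof (intro ballI impI)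
    fix x y assume xy: "x \<in> {1..n}" "y \<in> {1..n}" "x < y" "g x \<le> g y"
    \<comment> \<open>As \<open>g'\<close> does not increase from \<open>x\<close> to
      \<open>y\<close>, this pair is no non-inversion of \<open>rev \<sigma>\<close>; hence it is
      one of \<open>\<sigma>\<close>.\<close>
    have "\<not> g' x < g' y" using gg'[OF xy(1)] gg'[OF xy(2)] xy(4) by linarith
    then have "\<not> prec \<sigma> y x" using g'(3) xy(1-3) unfolding prec_rev by blast
    then have "prec \<sigma> x y" using prec_linear[of x \<sigma> y] xy(1-3) set(1) by auto
    then show "f x < f y" using f(3) xy(1-3) by blast
  qed
  moreover have "length \<alpha> + length \<beta> = n + 1"
  proof -
    have "\<sigma> \<noteq> []" using set(1) assms(2) by auto
    moreover have "length \<sigma> = n" using set by (metis card_atLeastAtMost diff_Suc_1 distinct_card)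
    ultimately show ?thesis
      using length_runs_wrt[of \<sigma>] set(2) by (simp add: len desc_partition_def asc_partition_def)
  qed
  ultimately show ?thesis using that f(1,2) g(1,2) len by metis
qed

lemma non_degenerate_fibres:
  assumes "non_degenerate n (fibres f {1..n})" "f ` {1..n} = {..<p}"
    "x \<in> {1..n}" "y \<in> {1..n}" "z \<in> {1..n}" "x < y" "y < z" "f x = f z"
  shows "f y \<le> f x"
proof (rule ccontr)
  assume *: "\<not> f y \<le> f x"
  have len: "length (fibres f {1..n}) = p" unfolding length_fibres assms(2) by simp
  have fy: "f y < p" using assms(2,4) by blast
  have "has_degeneracy (fibres f {1..n})"
    unfolding has_degeneracy_def
  proof (intro exI conjI)
    show "0 < f y - f x" using * by simp
    show "f x + (f y - f x) < length (fibres f {1..n})" using * fy len by simp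
    show "x \<in> fibres f {1..n} ! f x" "z \<in> fibres f {1..n} ! f x"
      "y \<in> fibres f {1..n} ! (f x + (f y - f x))"
      using fibres_nth[OF assms(2)] fy * assms(3-5,8) by simp_all
  qed (use assms in auto)
  \<comment> \<open>What remains is dimension 0, where \<open>non_degenerate\<close> tests the
    minimal vertex instead; there \<open>f\<close> is injective, contrary to
    \<open>f x = f z\<close>.\<close>
  then have "P_dim n (fibres f {1..n}) = 0" using assms(1) by (auto simp: non_degenerate_def split: if_splits)
  then have "n \<le> card (f ` {1..n})" by (simp add: P_dim_def length_fibres)
  then have "inj_on f {1..n}" using card_image_le[of "{1..n}" f] by (intro eq_card_imp_inj_on) auto
  then show False using assms(3,5-8) by (auto dest: inj_onD)
qed

lemma card_image_cong_kernel:
  assumes "\<And>x y. x \<in> X \<Longrightarrow> y \<in> X \<Longrightarrow> f x = f y \<longleftrightarrow> g x = g y"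
  shows "card (f ` X) = card (g ` X)"
proof (rule bij_betw_same_card)
  let ?\<phi> = "\<lambda>c. g (inv_into X f c)"
  have *: "?\<phi> (f x) = g x" if "x \<in> X" for x
    using assms[of "inv_into X f (f x)" x] that by (simp add: inv_into_into f_inv_into_f)
  show "bij_betw ?\<phi> (f ` X) (g ` X)"
    unfolding bij_betw_def inj_on_def using * assms by (auto simp: image_image)
qed

text \<open>Blocks correspond to nodes. If \<open>f x < f y\<close>, some bracket around
  \<open>x\<close> omits \<open>y\<close>. If \<open>f x = f y\<close> and one of the two were
  outside the node of the other, the position next to that node on its side would have a larger
  value and lie between them, a degeneracy. The root accounts for the additional block.\<close>

lemma card_theta_non_degenerate:
  assumes "non_degenerate n (fibres f {1..n})" "f ` {1..n} = {..<p}" "1 \<le> n"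
  shows "card (theta (fibres f {1..n})) + 1 = p"
proof -
  let ?F = "theta (fibres f {1..n})"
  have K: "K_face n ?F" by (rule K_face_theta)
  have separate: "node n ?F x \<noteq> node n ?F y" if xy: "x \<in> {1..n}" "y \<in> {1..n}" "f x < f y" for x y
  proof -
    have x: "1 \<le> x" "x \<le> n" "\<And>z. z \<in> {x..x} \<Longrightarrow> f z < f y" using xy by auto
    obtain I where "I \<in> ?F" "{x..x} \<subseteq> I" "y \<notin> I"
      using theta_fibres_superset[where f = f, OF x(1) order_refl x(2) xy(2) x(3)] by blast
    then have "y \<notin> node n ?F x" using node(3)[OF K xy(1), of I] by auto
    then show ?thesis using node(2)[OF K xy(2)] by blast
  qed
  have nd: "\<not> f x < f y" if "x \<in> {1..n}" "y \<in> {1..n}" "z \<in> {1..n}" "x < y" "y < z" "f x = f z" for x y z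
    using non_degenerate_fibres[OF assms(1,2) that] by simp
  have outside: "lo n ?F x - 1 \<in> {1..n} \<Longrightarrow> f x < f (lo n ?F x - 1)"
    "Suc (hi n ?F x) \<in> {1..n} \<Longrightarrow> f x < f (Suc (hi n ?F x))" if x: "x \<in> {1..n}" for x
  proof -
    note nx = node_interval[OF K x]
    have *: "f x < f y" if y: "y \<in> {1..n}" "y = lo n ?F x - 1 \<and> 1 < lo n ?F x \<or> y = Suc (hi n ?F x)" for y
    proof -
      have "y \<notin> node n ?F x" using y(2) nx(2) mem_node_iff[OF K x] by auto
      then have "node n ?F x \<noteq> {1..n}" using y(1) by blast
      then have "node n ?F x \<in> ?F" using node(1)[OF K x] by blast
      then have "{lo n ?F x..hi n ?F x} \<in> ?F" unfolding nx(1)[symmetric] .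
      then obtain s t where st: "{lo n ?F x..hi n ?F x} = {s..t}" "s \<le> t"
        "\<And>x. x \<in> {s..t} \<Longrightarrow> (1 < s \<longrightarrow> f x < f (s - 1)) \<and> (t < n \<longrightarrow> f x < f (Suc t))"
        unfolding theta_fibres_iff by blast
      then have "s = lo n ?F x" "t = hi n ?F x" using nx(3,4) by (simp_all add: Icc_eq_Icc)
      then show ?thesis using st(3)[of x] nx(3,4) y by auto
    qed
    show "f x < f (lo n ?F x - 1)" if "lo n ?F x - 1 \<in> {1..n}" using that by (intro *) auto
    show "f x < f (Suc (hi n ?F x))" if "Suc (hi n ?F x) \<in> {1..n}" using that by (intro *) auto
  qed
  have same: "node n ?F x = node n ?F y" if xy: "x \<in> {1..n}" "y \<in> {1..n}" "x < y" "f x = f y" for x y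
  proof -
    note nx = node_interval[OF K xy(1)] and ny = node_interval[OF K xy(2)]
    have "y \<in> node n ?F x"
    proof (rule ccontr)
      assume "y \<notin> node n ?F x"
      then have "Suc (hi n ?F x) \<le> y" using xy(3) nx(3) mem_node_iff[OF K xy(1)] by auto
      moreover have "Suc (hi n ?F x) \<in> {1..n}" using calculation xy(2) by auto
      moreover have "f x < f (Suc (hi n ?F x))" using outside(2)[OF xy(1)] calculation by blast
      ultimately show False using nd[OF xy(1) _ xy(2), of "Suc (hi n ?F x)"] nx(4) xy(4)
        by (metis le_imp_less_Suc le_neq_implies_less less_irrefl)
    qed
    moreover have "x \<in> node n ?F y"
    proof (rule ccontr)
      assume "x \<notin> node n ?F y"
      then have x: "x \<le> lo n ?F y - 1" "1 < lo n ?F y"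
        using xy(1,3) ny(4) mem_node_iff[OF K xy(2)] by auto
      then have mem: "lo n ?F y - 1 \<in> {1..n}" "lo n ?F y - 1 < y" using xy(1,2) ny(3) by auto
      then have "f y < f (lo n ?F y - 1)" using outside(1)[OF xy(2)] by blast
      then show False using nd[OF xy(1) mem(1) xy(2) _ mem(2) xy(4)] x(1) xy(4)
        by (metis le_neq_implies_less less_irrefl)
    qed
    ultimately show ?thesis using node_mono[OF K] xy(1,2) by blast
  qed
  have "card (f ` {1..n}) = card (node n ?F ` {1..n})"
  proof (rule card_image_cong_kernel)
    fix x y assume xy: "x \<in> {1..n}" "y \<in> {1..n}"
    show "f x = f y \<longleftrightarrow> node n ?F x = node n ?F y"
      using same[OF xy] same[OF xy(2,1)] separate[OF xy] separate[OF xy(2,1)]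
      by (metis linorder_neq_iff)
  qed
  also have "\<dots> = card ?F + 1"
    using node_image[OF K assms(3)] finite_K_face[OF K] K by (auto simp: K_face_def)
  finally show ?thesis using assms(2) by simp
qed

text \<open>If \<open>i\<close> lies in the node of \<open>j\<close> for \<open>?G\<close>, no
  bracket of \<open>?G\<close> around \<open>j\<close> omits an element \<open>k\<close> of
  \<open>{i..j - 1}\<close>. Hence \<open>g k \<le> g j\<close>, and by separation
  \<open>f k < f j\<close>. So some bracket of \<open>?F\<close> contains \<open>{i..j - 1}\<close>
  but not \<open>j\<close>; it ends at \<open>j - 1\<close>, as \<open>covers\<close>
  demands.\<close>

lemma K_le_theta:
  assumes "separated f g {1..n}"
  shows "K_le n (theta (fibres f {1..n})) (theta (fibres g {1..n}))" (is "K_le n ?F ?G")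
  unfolding K_le_iff[OF K_face_theta K_face_theta]
proof (intro ballI impI)
  fix i j assume ij: "i \<in> {1..n}" "j \<in> {1..n}" "i < j" "i \<in> node n ?G j"
  have G: "K_face n ?G" by (rule K_face_theta)
  have less: "f k < f j" if k: "k \<in> {i..j - 1}" for k
  proof -
    have kn: "k \<in> {1..n}" "k < j" using k ij by auto
    have "g k \<le> g j"
    proof (rule ccontr)
      assume "\<not> g k \<le> g j"
      then obtain I where I: "I \<in> ?G" "{j..j} \<subseteq> I" "k \<notin> I"
        using theta_fibres_superset[of j j n k g] ij(2) kn by auto
      then have "node n ?G j \<subseteq> I" using node(3)[OF G ij(2), of I] by auto
      moreover have "k \<in> node n ?G j"
        using ij(4) k node_interval(4)[OF G ij(2)] kn(2) unfolding mem_node_iff[OF G ij(2)] by auto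
      ultimately show False using I(3) by blast
    qed
    then show ?thesis using separatedD[OF assms kn(1) ij(2) kn(2)] by blast
  qed
  obtain I where I: "I \<in> ?F" "{i..j - 1} \<subseteq> I" "j \<notin> I"
  proof -
    have "1 \<le> i" "i \<le> j - 1" "j - 1 \<le> n" using ij by auto
    then show ?thesis using theta_fibres_superset[of i "j - 1" n j f] ij(2) less that by blast
  qed
  then obtain s t where st: "I = {s..t}" unfolding theta_fibres_iff by blast
  have "i \<in> I" "j - 1 \<in> I" using I(2) ij(3) by auto
  then have "s \<le> i" "t = j - 1" using st I(3) ij(3) by auto
  moreover have "{s..j - 1} = {s..<j}" using ij(3) by auto
  ultimately show "covers ?F i j" using I(1) st unfolding covers_def by auto
qed

lemma complementary_pair_matching:
  assumes "complementary_pair n \<alpha> \<beta>" "non_degenerate n \<alpha>" "non_degenerate n \<beta>" "1 \<le> n"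
  shows "matching_pair n (theta \<alpha>) (theta \<beta>)"
proof -
  obtain f g where f: "\<alpha> = fibres f {1..n}" "f ` {1..n} = {..<length \<alpha>}"
    and g: "\<beta> = fibres g {1..n}" "g ` {1..n} = {..<length \<beta>}"
    and sep: "separated f g {1..n}" and len: "length \<alpha> + length \<beta> = n + 1"
    by (rule complementary_pair_obtain[OF assms(1,4)])
  have "card (theta \<alpha>) + 1 = length \<alpha>"
    using card_theta_non_degenerate[of n f "length \<alpha>"] assms(2,4) f by simp
  moreover have "card (theta \<beta>) + 1 = length \<beta>"
    using card_theta_non_degenerate[of n g "length \<beta>"] assms(3,4) g by simp
  ultimately have "K_dim n (theta \<alpha>) + K_dim n (theta \<beta>) = n - 1"
    using len by (simp add: K_dim_def)
  moreover have "K_face n (theta \<alpha>)" "K_face n (theta \<beta>)" using f(1) g(1) K_face_theta by metis+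
  moreover have "K_le n (theta \<alpha>) (theta \<beta>)" using K_le_theta[OF sep] f(1) g(1) by metis
  ultimately show ?thesis by (simp add: matching_pair_def)
qed

theorem theorem1:
  fixes n :: nat
  assumes "n \<ge> 1"
  shows "(\<forall>F G. matching_pair n F G \<longrightarrow>
            complementary_pair n (F_min n F) (F_min n G) \<and>
            (F, G) = (theta (F_min n F), theta (F_min n G)))
         \<and> Delta_K' n = Delta_K n"
proof -
  have main: "complementary_pair n (F_min n F) (F_min n G) \<and> theta (F_min n F) = F \<and> theta (F_min n G) = G
      \<and> non_degenerate n (F_min n F) \<and> non_degenerate n (F_min n G)"
    if "matching_pair n F G" for F G
  proof -
    have "K_face n F" "K_face n G" using that by (auto simp: matching_pair_def)
    then show ?thesis
      using matching_pair_complementary[OF that assms] theta_node_key F_min_eq F_min_non_degenerate assms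
      by metis
  qed
  have "Delta_K' n = Delta_K n"
  proof (intro equalityI subsetI)
    fix c assume "c \<in> Delta_K' n"
    then obtain F G where "c = (F, G)" "matching_pair n F G" by (auto simp: Delta_K'_def)
    then have "c = (theta (F_min n F), theta (F_min n G)) \<and> complementary_pair n (F_min n F) (F_min n G) \<and>
        non_degenerate n (F_min n F) \<and> non_degenerate n (F_min n G)"
      using main by metis
    then show "c \<in> Delta_K n" unfolding Delta_K_def by blast
  next
    fix c assume "c \<in> Delta_K n"
    then obtain \<alpha> \<beta> where "c = (theta \<alpha>, theta \<beta>)" "complementary_pair n \<alpha> \<beta>"
      "non_degenerate n \<alpha>" "non_degenerate n \<beta>" unfolding Delta_K_def by blast
    then show "c \<in> Delta_K' n"
      using complementary_pair_matching[OF _ _ _ assms] unfolding Delta_K'_def by blast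
  qed
  then show ?thesis using main by metis
qed

end
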